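(* There is an algorithm that, given a monotone submodular function $f:2^E\to\mathbb{R}_+$, a weight function $w:E\to[0,1]$, and $\epsilon\in(0,1)$, outputs a (random) set $S\subseteq E$ with $w(S)\le 1$ satisfying \[ \mathbf{E}[f(S)]\ \ge\ \Bigl(1-\frac{c_f}{e}-\epsilon\Bigr)f(O), \] where $O=\arg\max_{T\subseteq E:\,w(T)\le1}f(T)$ is an optimal solution. The running time is \[ O\Bigl(\frac{n^4\,\mathrm{polylog}(n)}{(1-c_f)^2}\Bigr)\cdot\Bigl(\frac1\epsilon\log\frac{1}{1-c_f}\Bigr)^{\mathrm{poly}(1/\epsilon)/(1-c_f)}, \] where $n=|E|$.
   Context: $E$ is a finite ground set and $f$ is accessed via value queries. For $S\subseteq E$, $w(S)=\sum_{e\in S}w(e)$. For $S,T\subseteq E$, $f_S(T)=f(S\cup T)-f(S)$, and $f(e)$ means $f(\{e\})$. The (total) curvature of $f$ is $c_f=1-\min_{e\in E}\frac{f_{E-e}(e)}{f(e)}\in[0,1]$.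
   Formalization: In the running time the base (1/ε)log(1/(1-c_f)) is replaced by 2 where it is smaller (at c_f=0 the printed bound is 0); in c_f a quotient with f(e)=0 is read as 1; E is nonempty; no time bound is claimed when c_f=1. *)

theory Defs
  imports "HOL-Probability.Probability" "HOL-Computational_Algebra.Polynomial"
begin

text \<open>Set functions. Only the values on subsets of the ground set \<open>E\<close> matter.\<close>

definition submodular_on :: "'a set \<Rightarrow> ('a set \<Rightarrow> real) \<Rightarrow> bool" where
  "submodular_on E f \<longleftrightarrow>
     (\<forall>A B. A \<subseteq> E \<longrightarrow> B \<subseteq> E \<longrightarrow> f (A \<union> B) + f (A \<inter> B) \<le> f A + f B)"

definition marginal :: "('a set \<Rightarrow> real) \<Rightarrow> 'a set \<Rightarrow> 'a set \<Rightarrow> real" where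
  "marginal f S T = f (S \<union> T) - f S"

text \<open>
  If \<open>f {e} = 0\<close>, the quotient \<open>f\<^sub>E\<^sub>-\<^sub>e(e) / f(e)\<close> is \<open>0 / 0\<close> (for monotone submodular
  \<open>f \<ge> 0\<close> the element \<open>e\<close> never contributes anything); it is read as \<open>1\<close>, so that such elements
  do not influence the minimum. Isabelle's own \<open>0 / 0 = 0\<close> would force the curvature to be 1.
\<close>

definition curvature :: "'a set \<Rightarrow> ('a set \<Rightarrow> real) \<Rightarrow> real" where
  "curvature E f =
     1 - Min ((\<lambda>e. if f {e} = 0 then 1 else marginal f (E - {e}) {e} / f {e}) ` E)"

text \<open>
  The model of computation: a randomized real RAM with a value oracle, presented as a while
  language. The memory consists of arrays of natural numbers and arrays of reals, both initially
  zero outside the input (a scalar variable is cell 0 of an array). Array names are fixed in the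
  program text, so a program uses only finitely many arrays, while indices are computed. There is
  no rounding from reals to naturals, no bit operation, and the only constants are natural
  numbers, so no real-valued advice can be hidden in a program.
\<close>

datatype nexp =
    NConst nat
  | NGet nat nexp
  | NAdd nexp nexp
  | NSub nexp nexp
  | NMul nexp nexp

datatype rexp =
    RNat nexp
  | RGet nat nexp
  | RAdd rexp rexp
  | RSub rexp rexp
  | RMul rexp rexp
  | RDiv rexp rexp

datatype bexp =
    NLess nexp nexp
  | RLess rexp rexp
  | BNot bexp
  | BAnd bexp bexp

datatype com =
    Skip
  | NSet nat nexp nexp
  | RSet nat nexp rexp
  | Query nat nat nexp
  | Flip nat nexp rexp
  | Seq com com
  | Cond bexp com com
  | While bexp com

record state =
  nmem :: "nat \<Rightarrow> nat \<Rightarrow> nat"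
  rmem :: "nat \<Rightarrow> nat \<Rightarrow> real"

primrec nval :: "state \<Rightarrow> nexp \<Rightarrow> nat" where
  "nval s (NConst k) = k"
| "nval s (NGet a i) = nmem s a (nval s i)"
| "nval s (NAdd x y) = nval s x + nval s y"
| "nval s (NSub x y) = nval s x - nval s y"
| "nval s (NMul x y) = nval s x * nval s y"

primrec rval :: "state \<Rightarrow> rexp \<Rightarrow> real" where
  "rval s (RNat x) = real (nval s x)"
| "rval s (RGet a i) = rmem s a (nval s i)"
| "rval s (RAdd x y) = rval s x + rval s y"
| "rval s (RSub x y) = rval s x - rval s y"
| "rval s (RMul x y) = rval s x * rval s y"
| "rval s (RDiv x y) = rval s x / rval s y"

primrec bval :: "state \<Rightarrow> bexp \<Rightarrow> bool" where
  "bval s (NLess x y) \<longleftrightarrow> nval s x < nval s y"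
| "bval s (RLess x y) \<longleftrightarrow> rval s x < rval s y"
| "bval s (BNot b) \<longleftrightarrow> \<not> bval s b"
| "bval s (BAnd b c) \<longleftrightarrow> bval s b \<and> bval s c"

definition nwrite :: "nat \<Rightarrow> nat \<Rightarrow> nat \<Rightarrow> state \<Rightarrow> state" where
  "nwrite a i v s = s\<lparr>nmem := (nmem s)(a := (nmem s a)(i := v))\<rparr>"

definition rwrite :: "nat \<Rightarrow> nat \<Rightarrow> real \<Rightarrow> state \<Rightarrow> state" where
  "rwrite a i v s = s\<lparr>rmem := (rmem s)(a := (rmem s a)(i := v))\<rparr>"

text \<open>
  One step of computation. The oracle \<open>orc\<close> receives an array of naturals, read as a
  characteristic vector. \<open>Query a r i\<close> stores the oracle's answer for array \<open>a\<close> in cell \<open>i\<close> of the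
  real array \<open>r\<close>. \<open>Flip a i p\<close> tosses an independent coin with success probability \<open>p\<close> (cut off to
  the unit interval by \<open>bernoulli_pmf\<close>). Every executed assignment, test, query and coin toss costs
  one step; as the expressions are part of the program text, the number of arithmetic operations
  performed is within a factor depending only on the program of the number of steps.
\<close>

primrec step :: "((nat \<Rightarrow> nat) \<Rightarrow> real) \<Rightarrow> com \<Rightarrow> state \<Rightarrow> (com \<times> state) pmf" where
  "step orc Skip s = return_pmf (Skip, s)"
| "step orc (NSet a i x) s = return_pmf (Skip, nwrite a (nval s i) (nval s x) s)"
| "step orc (RSet a i x) s = return_pmf (Skip, rwrite a (nval s i) (rval s x) s)"
| "step orc (Query a r i) s = return_pmf (Skip, rwrite r (nval s i) (orc (nmem s a)) s)"
| "step orc (Flip a i p) s =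
     map_pmf (\<lambda>b. (Skip, nwrite a (nval s i) (if b then 1 else 0) s)) (bernoulli_pmf (rval s p))"
| "step orc (Seq c d) s =
     (if c = Skip then return_pmf (d, s)
      else map_pmf (\<lambda>(c', s'). (Seq c' d, s')) (step orc c s))"
| "step orc (Cond b c d) s = return_pmf (if bval s b then c else d, s)"
| "step orc (While b c) s =
     return_pmf (if bval s b then Seq c (While b c) else Skip, s)"

primrec run :: "((nat \<Rightarrow> nat) \<Rightarrow> real) \<Rightarrow> nat \<Rightarrow> com \<times> state \<Rightarrow> (com \<times> state) pmf" where
  "run orc 0 cs = return_pmf cs"
| "run orc (Suc t) cs = bind_pmf (step orc (fst cs) (snd cs)) (run orc t)"

text \<open>
  An instance is presented through an enumeration \<open>xs\<close> of the ground set; the program refers to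
  an element by its position in \<open>xs\<close>. Input: \<open>n\<close> in cell 0 of natural array 0, \<open>\<epsilon>\<close> in cell 0 of
  real array 0, the weights in real array 1. The function \<open>f\<close> is accessible only through \<open>Query\<close>, and the
  curvature is not part of the input. Output: the set with characteristic vector in natural array 1.
\<close>

definition decode :: "'a list \<Rightarrow> (nat \<Rightarrow> nat) \<Rightarrow> 'a set" where
  "decode xs v = {xs ! i | i. i < length xs \<and> v i \<noteq> 0}"

definition init_state :: "'a list \<Rightarrow> ('a \<Rightarrow> real) \<Rightarrow> real \<Rightarrow> state" where
  "init_state xs w \<epsilon> =
     \<lparr>nmem = (\<lambda>a i. if a = 0 \<and> i = 0 then length xs else 0),
      rmem = (\<lambda>a i. if a = 0 \<and> i = 0 then \<epsilon>
                    else if a = 1 \<and> i < length xs then w (xs ! i) else 0)\<rparr>"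

definition exec ::
  "com \<Rightarrow> 'a list \<Rightarrow> ('a set \<Rightarrow> real) \<Rightarrow> ('a \<Rightarrow> real) \<Rightarrow> real \<Rightarrow> nat \<Rightarrow> (com \<times> state) pmf" where
  "exec P xs f w \<epsilon> t = run (\<lambda>v. f (decode xs v)) t (P, init_state xs w \<epsilon>)"

text \<open>Worst-case running time: every random branch has terminated within \<open>t\<close> steps.\<close>

definition halts_within ::
  "com \<Rightarrow> 'a list \<Rightarrow> ('a set \<Rightarrow> real) \<Rightarrow> ('a \<Rightarrow> real) \<Rightarrow> real \<Rightarrow> nat \<Rightarrow> bool" where
  "halts_within P xs f w \<epsilon> t \<longleftrightarrow> (\<forall>(c, s) \<in> set_pmf (exec P xs f w \<epsilon> t). c = Skip)"

definition output_after ::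
  "com \<Rightarrow> 'a list \<Rightarrow> ('a set \<Rightarrow> real) \<Rightarrow> ('a \<Rightarrow> real) \<Rightarrow> real \<Rightarrow> nat \<Rightarrow> 'a set pmf" where
  "output_after P xs f w \<epsilon> t = map_pmf (\<lambda>(c, s). decode xs (nmem s 1)) (exec P xs f w \<epsilon> t)"

text \<open>
  The running time bound for curvature \<open>c < 1\<close>; \<open>q\<close> and \<open>p\<close> are the polynomials in
  \<open>polylog(n) = q(ln n)\<close> and \<open>poly(1/\<epsilon>) = p(1/\<epsilon>)\<close>. The base of the exponential factor is replaced
  by 2 where it is smaller: for \<open>c\<close> close to 0 the displayed base tends to 0, and the formula, read
  literally, would claim a running time below any positive constant.
\<close>

definition time_bound :: "real poly \<Rightarrow> real poly \<Rightarrow> nat \<Rightarrow> real \<Rightarrow> real \<Rightarrow> real" where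
  "time_bound q p n \<epsilon> c =
     real n ^ 4 * poly q (ln (real n)) / (1 - c)\<^sup>2
     * max 2 (1 / \<epsilon> * ln (1 / (1 - c))) powr (poly p (1 / \<epsilon>) / (1 - c))"

end

theory Submission
  imports Defs
begin

text \<open>
  Write \<open>f = g + \<ell>\<close> with the modular part \<open>\<ell>(e) = f\<^bsub>E-e\<^esub>(e)\<close> and \<open>g\<close> monotone submodular. As
  \<open>\<ell>(O) \<ge> (1 - c) f(O)\<close>, it suffices to reach \<open>(1 - 1/e) g(O) + \<ell>(O)\<close> up to \<open>\<epsilon> f(O)\<close>.

  Time runs through phases \<open>t < L\<close>, \<open>L \<approx> 7/\<epsilon>\<close>; in phase \<open>t\<close> the greedy rule sees the distorted
  function \<open>D g + \<ell>\<close> with \<open>D = (1 + 1/L)\<^bsup>t-L\<^esup>\<close>. At most \<open>K\<close> elements of (a near-optimal) \<open>O\<close> are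
  large. Each gets a slot, and in each phase the slot receives the lightest element whose
  gain is at least a guessed value; a candidate solution picks the content of one phase from each
  slot, and all gains are averages over the \<open>L\<^bsup>K\<^esup>\<close> candidates. Small elements are added to all
  candidates by density, up to a guessed gain per phase. Should a slot receive an element of \<open>O\<close>, this
  element is committed to all candidates and the phases start again, so that in the final run the slots
  avoid \<open>O\<close> and no part of \<open>\<ell>(O)\<close> is lost. The guesses are unary, which bounds their total
  length by a polynomial in \<open>L\<close>; the program tries all of them and keeps the best feasible set
  it has seen. It uses no coin, and its running time does not depend on the curvature.
\<close>

section \<open>Timed total correctness\<close>

text \<open>An element written into one cell of a slot reaches a \<open>1 / L\<close> share of the
  candidates, so filling slots imitates a continuous greedy step of length \<open>1 / L\<close>. Yet
  a candidate holds at most one element per slot, no heavier than the large element that owns the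
  slot. Every candidate is therefore feasible, and no rounding of a fractional solution is needed.
  The distortion satisfies \<open>a (Suc t) - a t = a t / L\<close>. A phase gains about
  \<open>D / L\<close> times the difference between \<open>g\<close> of the reference solution and
  \<open>g\<close> of the current one; the rise of \<open>D\<close> gives the second term back,
  which leaves a gain that does not depend on the state. The obstacle is that the analysis uses an
  optimal solution that the program does not know. All this knowledge is condensed into a list of at
  most \<open>3400 * L ^ 14\<close> operations, a length independent of \<open>n\<close>; the
  analysis only has to exhibit one good list. The factor \<open>n ^ 4\<close> has four sources: the
  estimates of the optimum, the picks in one round of small elements, the scan for each pick, and
  the evaluation of a set.\<close>

inductive reach :: "((nat \<Rightarrow> nat) \<Rightarrow> real) \<Rightarrow> nat \<Rightarrow> com \<times> state \<Rightarrow> com \<times> state \<Rightarrow> bool"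
  for orc where
  reach_refl: "reach orc 0 cs cs"
| reach_step: "\<lbrakk>c \<noteq> Skip; step orc c s = return_pmf cs'; reach orc t cs' cs''\<rbrakk>
    \<Longrightarrow> reach orc (Suc t) (c, s) cs''"

lemma reach_trans: "reach orc t a b \<Longrightarrow> reach orc t' b c \<Longrightarrow> reach orc (t + t') a c"
  by (induction rule: reach.induct) (auto intro: reach.intros)

lemma reach_one: "\<lbrakk>c \<noteq> Skip; step orc c s = return_pmf cs'\<rbrakk> \<Longrightarrow> reach orc 1 (c, s) cs'"
  using reach_step[OF _ _ reach_refl] by fastforce

lemma reach_Seq: "reach orc t (c, s) (c', s') \<Longrightarrow> reach orc t (Seq c d, s) (Seq c' d, s')"
proof (induction t "(c, s)" "(c', s')" arbitrary: c s rule: reach.induct)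
  case reach_refl
  then show ?case by (auto intro: reach.intros)
next
  case (reach_step c s cs' t)
  then show ?case
    by (cases cs') (auto intro!: reach.reach_step)
qed

lemma run_Skip: "run orc t (Skip, s) = return_pmf (Skip, s)"
  by (induction t) (auto simp: bind_return_pmf)

lemma run_reach: "reach orc t cs cs' \<Longrightarrow> run orc (t + t') cs = run orc t' cs'"
  by (induction rule: reach.induct) (auto simp: bind_return_pmf)

text \<open>The program tosses no coin, so every step is a point mass and the random run collapses
  to a single trace. A halted configuration stays put, hence any later time \<open>T\<close> serves
  as well.\<close>

lemma run_reach_Skip:
  assumes "reach orc t cs (Skip, s)" "t \<le> T"
  shows "run orc T cs = return_pmf (Skip, s)"
  using run_reach[OF assms(1), of "T - t"] assms(2) by (simp add: run_Skip)

text \<open>The postcondition sees the absolute clock \<open>t + t'\<close>, so sequential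
  composition needs no arithmetic on running times. Termination is part of the claim.\<close>

definition wpt ::
  "((nat \<Rightarrow> nat) \<Rightarrow> real) \<Rightarrow> com \<Rightarrow> state \<Rightarrow> nat \<Rightarrow> (nat \<Rightarrow> state \<Rightarrow> bool) \<Rightarrow> bool" where
  "wpt orc c s t Q \<longleftrightarrow> (\<exists>t' s'. reach orc t' (c, s) (Skip, s') \<and> Q (t + t') s')"

lemma wpt_Skip: "Q t s \<Longrightarrow> wpt orc Skip s t Q"
  unfolding wpt_def using reach_refl[of orc "(Skip, s)"] by fastforce

lemma wpt_step:
  assumes "c \<noteq> Skip" "step orc c s = return_pmf (c', s')" "wpt orc c' s' (t + 1) Q"
  shows "wpt orc c s t Q"
  using assms reach_trans[OF reach_one[OF assms(1,2)]] unfolding wpt_def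
  by (metis add.assoc)

lemma wpt_NSet: "Q (t + 1) (nwrite a (nval s i) (nval s x) s) \<Longrightarrow> wpt orc (NSet a i x) s t Q"
  by (rule wpt_step) (auto intro: wpt_Skip)

lemma wpt_RSet: "Q (t + 1) (rwrite a (nval s i) (rval s x) s) \<Longrightarrow> wpt orc (RSet a i x) s t Q"
  by (rule wpt_step) (auto intro: wpt_Skip)

lemma wpt_Query: "Q (t + 1) (rwrite r (nval s i) (orc (nmem s a)) s) \<Longrightarrow> wpt orc (Query a r i) s t Q"
  by (rule wpt_step) (auto intro: wpt_Skip)

lemma wpt_Cond: "wpt orc (if bval s b then c else d) s (t + 1) Q \<Longrightarrow> wpt orc (Cond b c d) s t Q"
  by (rule wpt_step) auto

lemma wpt_Seq:
  assumes "wpt orc c s t (\<lambda>t s. wpt orc d s (t + 1) Q)"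
  shows "wpt orc (Seq c d) s t Q"
proof -
  obtain t' s' where c: "reach orc t' (c, s) (Skip, s')" and d: "wpt orc d s' (t + t' + 1) Q"
    using assms unfolding wpt_def by blast
  have "reach orc (t' + 1) (Seq c d, s) (d, s')"
    by (rule reach_trans[OF reach_Seq[OF c]]) (rule reach_one, auto)
  with d show ?thesis unfolding wpt_def by (metis add.assoc reach_trans)
qed

lemma wpt_While:
  "wpt orc (if bval s b then Seq c (While b c) else Skip) s (t + 1) Q \<Longrightarrow> wpt orc (While b c) s t Q"
  by (rule wpt_step) auto

lemma wpt_mono: "wpt orc c s t Q \<Longrightarrow> (\<And>t s. Q t s \<Longrightarrow> Q' t s) \<Longrightarrow> wpt orc c s t Q'"
  unfolding wpt_def by blast

section \<open>Frames: the arrays that a program can change\<close>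

primrec nmods :: "com \<Rightarrow> nat set" where
  "nmods Skip = {}"
| "nmods (NSet a i x) = {a}"
| "nmods (RSet a i x) = {}"
| "nmods (Query a r i) = {}"
| "nmods (Flip a i p) = {a}"
| "nmods (Seq c d) = nmods c \<union> nmods d"
| "nmods (Cond b c d) = nmods c \<union> nmods d"
| "nmods (While b c) = nmods c"

primrec rmods :: "com \<Rightarrow> nat set" where
  "rmods Skip = {}"
| "rmods (NSet a i x) = {}"
| "rmods (RSet a i x) = {a}"
| "rmods (Query a r i) = {r}"
| "rmods (Flip a i p) = {}"
| "rmods (Seq c d) = rmods c \<union> rmods d"
| "rmods (Cond b c d) = rmods c \<union> rmods d"
| "rmods (While b c) = rmods c"

lemma nmem_nwrite [simp]:
  "nmem (nwrite a i v s) = (nmem s)(a := (nmem s a)(i := v))" "rmem (nwrite a i v s) = rmem s"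
  by (auto simp: nwrite_def)

lemma rmem_rwrite [simp]:
  "rmem (rwrite a i v s) = (rmem s)(a := (rmem s a)(i := v))" "nmem (rwrite a i v s) = nmem s"
  by (auto simp: rwrite_def)

text \<open>Preservation is tracked for whole arrays and read off the program text; untouched arrays
  need no mention in loop invariants.\<close>

definition frame :: "com \<Rightarrow> state \<Rightarrow> state \<Rightarrow> bool" where
  "frame c s s' \<longleftrightarrow> (\<forall>a. a \<notin> nmods c \<longrightarrow> nmem s' a = nmem s a) \<and> (\<forall>a. a \<notin> rmods c \<longrightarrow> rmem s' a = rmem s a)"

lemma frameD:
  "frame c s s' \<Longrightarrow> a \<notin> nmods c \<Longrightarrow> nmem s' a = nmem s a"
  "frame c s s' \<Longrightarrow> b \<notin> rmods c \<Longrightarrow> rmem s' b = rmem s b"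
  by (auto simp: frame_def)

lemma frame_trans: "frame c s s' \<Longrightarrow> frame c s' s'' \<Longrightarrow> frame c s s''"
  by (simp add: frame_def)

lemma step_frame:
  "(c', s') \<in> set_pmf (step orc c s) \<Longrightarrow> nmods c' \<subseteq> nmods c \<and> rmods c' \<subseteq> rmods c \<and> frame c s s'"
proof (induction c arbitrary: c' s')
  case (Seq c d)
  then show ?case
    by (cases "c = Skip") (force simp: frame_def split: prod.splits)+
qed (auto simp: frame_def split: if_splits)

lemma reach_frame:
  "reach orc t cs cs' \<Longrightarrow> nmods (fst cs') \<subseteq> nmods (fst cs) \<and> rmods (fst cs') \<subseteq> rmods (fst cs)
     \<and> frame (fst cs) (snd cs) (snd cs')"
proof (induction rule: reach.induct)
  case (reach_step c s cs' t cs'')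
  then show ?case using step_frame[of "fst cs'" "snd cs'" orc c s] by (auto simp: frame_def)
qed (auto simp: frame_def)

lemma wpt_frame: "wpt orc c s t Q \<Longrightarrow> wpt orc c s t (\<lambda>t s'. Q t s' \<and> frame c s s')"
  unfolding wpt_def using reach_frame by fastforce

text \<open>An upper bound in place of the exact number of steps lets both branches of a
  conditional, and all rounds of a loop, share one figure.\<close>

definition halts :: "((nat \<Rightarrow> nat) \<Rightarrow> real) \<Rightarrow> com \<Rightarrow> state \<Rightarrow> nat \<Rightarrow> (state \<Rightarrow> bool) \<Rightarrow> bool" where
  "halts orc c s B P \<longleftrightarrow> wpt orc c s 0 (\<lambda>t s'. t \<le> B \<and> P s')"

lemma wpt_use:
  assumes "halts orc c s B P"
    and "\<And>t' s'. t' \<le> t + B \<Longrightarrow> P s' \<Longrightarrow> frame c s s' \<Longrightarrow> Q t' s'"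
  shows "wpt orc c s t Q"
proof -
  have "wpt orc c s 0 (\<lambda>t s'. (t \<le> B \<and> P s') \<and> frame c s s')"
    using assms(1) wpt_frame unfolding halts_def by blast
  then show ?thesis using assms(2) unfolding wpt_def by fastforce
qed

lemma halts_mono: "halts orc c s B P \<Longrightarrow> B \<le> B' \<Longrightarrow> (\<And>s'. P s' \<Longrightarrow> frame c s s' \<Longrightarrow> P' s') \<Longrightarrow> halts orc c s B' P'"
  unfolding halts_def[of _ _ _ B'] by (erule wpt_use) auto

abbreviation NV :: "nat \<Rightarrow> nexp" where "NV x \<equiv> NGet x (NConst 0)"
abbreviation RV :: "nat \<Rightarrow> rexp" where "RV x \<equiv> RGet x (NConst 0)"
abbreviation NS :: "nat \<Rightarrow> nexp \<Rightarrow> com" where "NS x e \<equiv> NSet x (NConst 0) e"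
abbreviation RS :: "nat \<Rightarrow> rexp \<Rightarrow> com" where "RS x e \<equiv> RSet x (NConst 0) e"

section \<open>Blocks and counting loops\<close>

fun blk :: "com list \<Rightarrow> com" where
  "blk [] = Skip"
| "blk [c] = c"
| "blk (c # d # cs) = Seq c (blk (d # cs))"

definition For :: "nat \<Rightarrow> nexp \<Rightarrow> com \<Rightarrow> com" where
  "For x b c = Seq (NS x (NConst 0)) (While (NLess (NV x) b) (Seq c (NS x (NAdd (NV x) (NConst 1)))))"

lemma mods_For [simp]: "nmods (For x b c) = insert x (nmods c)" "rmods (For x b c) = rmods c"
  by (auto simp: For_def)

primrec nreads :: "nexp \<Rightarrow> nat set" where
  "nreads (NConst k) = {}"
| "nreads (NGet a i) = insert a (nreads i)"
| "nreads (NAdd x y) = nreads x \<union> nreads y"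
| "nreads (NSub x y) = nreads x \<union> nreads y"
| "nreads (NMul x y) = nreads x \<union> nreads y"

lemma nval_cong: "(\<And>a. a \<in> nreads e \<Longrightarrow> nmem s a = nmem s' a) \<Longrightarrow> nval s e = nval s' e"
  by (induction e) auto

text \<open>The invariant sees the counter only through its index, hence must not depend on array \<open>x\<close>.\<close>

lemma halts_For:
  assumes x: "x \<notin> nmods c" and b: "nreads b \<inter> insert x (nmods c) = {}"
    and N: "nval s b = N"
    and run_inv: "\<And>i s v. I i s \<Longrightarrow> I i (nwrite x 0 v s)"
    and I0: "I 0 s"
    and body: "\<And>i s'. i < N \<Longrightarrow> I i s' \<Longrightarrow> nmem s' x 0 = i \<Longrightarrow> frame (For x b c) s s' \<Longrightarrow> halts orc c s' B (I (Suc i))"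
  shows "halts orc (For x b c) s (N * (B + 4) + 4) (I N)"
proof -
  let ?W = "While (NLess (NV x) b) (Seq c (NS x (NAdd (NV x) (NConst 1))))"
  \<comment> \<open>A round costs \<open>B + 4\<close>: the loop test, two passages through a
    \<open>Seq\<close>, and the increment of the counter.\<close>
  have loop: "wpt orc ?W s' t (\<lambda>t' s'. t' \<le> t + (N - i) * (B + 4) + 1 \<and> I N s')"
    if "i \<le> N" "I i s'" "nmem s' x 0 = i" "frame (For x b c) s s'" for i s' t
    using that
  proof (induction "N - i" arbitrary: i s' t)
    case 0
    then have [simp]: "i = N" by simp
    have "nval s' b = N"
      using nval_cong[of b s' s] frameD(1)[OF 0(5)] b N by (auto simp: disjoint_iff)
    then show ?case using 0 by (auto intro!: wpt_While wpt_Skip)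
  next
    case (Suc k)
    have bv: "nval s' b = N"
      using nval_cong[of b s' s] frameD(1)[OF Suc(6)] b N by (auto simp: disjoint_iff)
    have iN: "i < N" using Suc by simp
    have k: "N - i = Suc k" "N - Suc i = k" using Suc by auto
    have test: "bval s' (NLess (NV x) b)" using bv iN Suc(5) by simp
    have step: "wpt orc ?W (nwrite x (nval s'' (NConst 0)) (nval s'' (NAdd (NV x) (NConst 1))) s'') (t' + 1 + 1 + 1)
         (\<lambda>t' s'. t' \<le> t + (N - i) * (B + 4) + 1 \<and> I N s')"
      if a: "t' \<le> t + 1 + B" "I (Suc i) s''" "frame c s' s''" for t' s''
    proof -
      have c: "nmem s'' x 0 = i" using frameD(1)[OF a(3) x] Suc(5) by simp
      let ?s = "nwrite x 0 (Suc i) s''"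
      have fr: "frame (For x b c) s ?s"
        using Suc(6) a(3) by (auto simp: frame_def)
      have "wpt orc ?W ?s (t' + 3) (\<lambda>u s'. u \<le> t' + 3 + (N - Suc i) * (B + 4) + 1 \<and> I N s')"
        by (rule Suc(1)) (use k iN run_inv[OF a(2)] fr in auto)
      then show ?thesis
        using a(1) c by (auto simp: k numeral_3_eq_3 algebra_simps elim!: wpt_mono)
    qed
    show ?case
      apply (rule wpt_While)
      apply (simp only: test if_True)
      apply (intro wpt_Seq)
      apply (rule wpt_use[OF body[OF iN Suc(4,5,6)]])
      apply (rule wpt_NSet)
      by (rule step)
  qed
  show ?thesis unfolding halts_def For_def
    apply (intro wpt_Seq wpt_NSet)
    apply (rule wpt_mono[OF loop[of 0]])
    using I0 run_inv by (auto simp: frame_def)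
qed

section \<open>Digits and submodular functions\<close>

definition dig :: "nat \<Rightarrow> nat \<Rightarrow> nat \<Rightarrow> nat" where
  "dig b p i = p div b ^ i mod b"

lemma dig_less: "0 < b \<Longrightarrow> dig b p i < b"
  by (simp add: dig_def)

text \<open>Serves two encodings: a number below \<open>L ^ K\<close> is a choice of one phase per
  slot, and a number below \<open>6 ^ N\<close> is a list of \<open>N\<close> operations.\<close>

lemma dig_surj:
  assumes "\<And>i. i < k \<Longrightarrow> d i < b"
  shows "\<exists>p < b ^ k. \<forall>i<k. dig b p i = d i"
  using assms
proof (induction k arbitrary: d)
  case (Suc k)
  obtain p where p: "p < b ^ k" "\<And>i. i < k \<Longrightarrow> dig b p i = d (Suc i)"
    using Suc.IH[of "\<lambda>i. d (Suc i)"] Suc.prems by auto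
  have d0: "d 0 < b" using Suc.prems by simp
  let ?q = "d 0 + b * p"
  have "Suc p \<le> b ^ k" using p(1) by simp
  then have "b * Suc p \<le> b * b ^ k" by (rule mult_le_mono2)
  then have "?q < b ^ Suc k" using d0 by simp
  moreover have "dig b ?q i = d i" if "i < Suc k" for i
  proof (cases i)
    case 0
    then show ?thesis using d0 by (simp add: dig_def)
  next
    case (Suc j)
    have "?q div b = p" using d0 by simp
    then have "dig b ?q i = dig b p j"
      by (simp add: dig_def Suc div_mult2_eq)
    then show ?thesis using p(2) that Suc by simp
  qed
  ultimately show ?case by blast
qed auto

lemma dig_bij:
  "bij_betw (\<lambda>p. restrict (dig b p) {..<k}) {..<b ^ k} (PiE {..<k} (\<lambda>_. {..<b}))"
proof -
  let ?f = "\<lambda>p. restrict (dig b p) {..<k}" and ?P = "PiE {..<k} (\<lambda>_. {..<b})"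
  have "?f ` {..<b ^ k} \<subseteq> ?P"
  proof (rule image_subsetI)
    fix p assume p: "p \<in> {..<b ^ k}"
    have "dig b p i < b" if "i < k" for i
      using p that by (cases "b = 0") (auto simp: dig_less power_0_left)
    then show "?f p \<in> ?P" by (intro restrict_PiE_iff[THEN iffD2]) auto
  qed
  moreover have "?P \<subseteq> ?f ` {..<b ^ k}"
  proof
    fix \<phi> assume phi: "\<phi> \<in> ?P"
    then obtain p where "p < b ^ k" "\<forall>i<k. dig b p i = \<phi> i"
      using dig_surj[of k \<phi> b] by (auto simp: PiE_iff)
    then show "\<phi> \<in> ?f ` {..<b ^ k}"
      using phi by (intro image_eqI[of _ _ p]) (auto simp: PiE_iff extensional_def restrict_def)
  qed
  ultimately have im: "?f ` {..<b ^ k} = ?P" by blast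
  moreover have "card ?P = b ^ k" by (simp add: card_PiE)
  ultimately show ?thesis
    unfolding bij_betw_def using eq_card_imp_inj_on[of "{..<b ^ k}" ?f] by simp
qed

text \<open>Overwriting coordinate \<open>i\<close> by \<open>d\<close> maps the functions onto the
  slice \<open>\<phi> i = d\<close>, and each member of the slice has exactly \<open>b\<close>
  preimages, one for each former value.\<close>

lemma sum_PiE_update:
  fixes H :: "(nat \<Rightarrow> nat) \<Rightarrow> real"
  assumes i: "i < k" and d: "d < b"
  shows "(\<Sum>\<phi>\<in>PiE {..<k} (\<lambda>_. {..<b}). H (\<phi>(i := d)))
       = real b * (\<Sum>\<phi>\<in>{\<phi>\<in>PiE {..<k} (\<lambda>_. {..<b}). \<phi> i = d}. H \<phi>)"
proof -
  let ?P = "PiE {..<k} (\<lambda>_. {..<b})"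
  let ?s = "\<lambda>\<phi>. \<phi>(i := d)"
  have fin: "finite ?P" by (simp add: finite_PiE)
  have sub: "?s ` ?P \<subseteq> {\<phi>\<in>?P. \<phi> i = d}"
    using i d by (intro image_subsetI CollectI conjI PiE_I) (auto dest: PiE_mem PiE_arb)
  have card: "card {\<phi>\<in>?P. ?s \<phi> = \<psi>} = b" if psi: "\<psi> \<in> ?P" "\<psi> i = d" for \<psi>
  proof -
    have "{\<phi>\<in>?P. ?s \<phi> = \<psi>} = (\<lambda>e. \<psi>(i := e)) ` {..<b}"
    proof (intro set_eqI iffI)
      fix \<phi> assume "\<phi> \<in> {\<phi>\<in>?P. ?s \<phi> = \<psi>}"
      then have phi: "\<phi> \<in> ?P" "\<psi> = \<phi>(i := d)" by simp_all
      have "\<phi> = \<psi>(i := \<phi> i)" unfolding phi(2) by simp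
      moreover have "\<phi> i \<in> {..<b}" using PiE_mem[OF phi(1)] i by simp
      ultimately show "\<phi> \<in> (\<lambda>e. \<psi>(i := e)) ` {..<b}" by (rule image_eqI)
    next
      fix \<phi> assume "\<phi> \<in> (\<lambda>e. \<psi>(i := e)) ` {..<b}"
      then obtain e where e: "e < b" "\<phi> = \<psi>(i := e)" by (elim imageE) simp
      have "\<phi> \<in> ?P" unfolding e using e(1) i psi(1) by (intro PiE_I) (auto dest: PiE_mem PiE_arb)
      moreover have "?s \<phi> = \<psi>" using e(2) psi(2) by (simp add: fun_upd_idem)
      ultimately show "\<phi> \<in> {\<phi>\<in>?P. ?s \<phi> = \<psi>}" by blast
    qed
    moreover have "inj_on (\<lambda>e. \<psi>(i := e)) {..<b}"
      by (rule inj_onI) (drule fun_cong[of _ _ i], simp)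
    ultimately show ?thesis using card_image by fastforce
  qed
  have "(\<Sum>\<phi>\<in>?P. H (?s \<phi>)) = (\<Sum>\<psi>\<in>{\<phi>\<in>?P. \<phi> i = d}. \<Sum>\<phi>\<in>{\<phi>\<in>?P. ?s \<phi> = \<psi>}. H (?s \<phi>))"
    by (rule sum.group[OF fin _ sub, symmetric]) (use fin in simp)
  also have "\<dots> = (\<Sum>\<psi>\<in>{\<phi>\<in>?P. \<phi> i = d}. real b * H \<psi>)"
  proof (rule sum.cong[OF refl])
    fix \<psi> assume "\<psi> \<in> {\<phi>\<in>?P. \<phi> i = d}"
    then have psi: "\<psi> \<in> ?P" "\<psi> i = d" by auto
    have "(\<Sum>\<phi>\<in>{\<phi>\<in>?P. ?s \<phi> = \<psi>}. H (?s \<phi>)) = (\<Sum>\<phi>\<in>{\<phi>\<in>?P. ?s \<phi> = \<psi>}. H \<psi>)"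
      by (rule sum.cong) auto
    then show "(\<Sum>\<phi>\<in>{\<phi>\<in>?P. ?s \<phi> = \<psi>}. H (?s \<phi>)) = real b * H \<psi>"
      by (simp only: sum_constant card[OF psi])
  qed
  finally show ?thesis by (simp add: sum_distrib_left)
qed

text \<open>By \<open>le\<close>, pushing every number into the slice with digit \<open>d\<close>
  loses nothing, and the push covers the slice \<open>b\<close> times; so the slice carries at least
  a \<open>1 / b\<close> share of the sum. The hypothesis \<open>ext\<close> lets numbers be traded
  for functions on the first \<open>k\<close> digits.\<close>

lemma sum_dig_update:
  fixes H :: "(nat \<Rightarrow> nat) \<Rightarrow> real"
  assumes i: "i < k" and d: "d < b"
    and ext: "\<And>\<phi>. H (restrict \<phi> {..<k}) = H \<phi>"
    and le: "\<And>p. p < b ^ k \<Longrightarrow> H (dig b p) \<le> H ((dig b p)(i := d))"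
  shows "(\<Sum>p<b ^ k. H (dig b p)) \<le> real b * (\<Sum>p<b ^ k. if dig b p i = d then H (dig b p) else 0)"
proof -
  let ?P = "PiE {..<k} (\<lambda>_. {..<b})"
  let ?f = "\<lambda>p. restrict (dig b p) {..<k}"
  have r: "(restrict \<phi> {..<k})(i := d) = restrict (\<phi>(i := d)) {..<k}" for \<phi> :: "nat \<Rightarrow> nat"
    using i by (auto simp: fun_eq_iff)
  have fin: "finite ?P" by (simp add: finite_PiE)
  have "(\<Sum>p<b ^ k. H (dig b p)) \<le> (\<Sum>p<b ^ k. H ((?f p)(i := d)))"
    by (rule sum_mono) (simp only: r ext le lessThan_iff)
  also have "\<dots> = (\<Sum>\<phi>\<in>?P. H (\<phi>(i := d)))"
    by (rule sum.reindex_bij_betw[OF dig_bij])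
  also have "\<dots> = real b * (\<Sum>\<phi>\<in>?P. if \<phi> i = d then H \<phi> else 0)"
    by (simp add: sum_PiE_update[OF i d] sum.inter_filter[OF fin])
  also have "(\<Sum>\<phi>\<in>?P. if \<phi> i = d then H \<phi> else 0) = (\<Sum>p<b ^ k. if ?f p i = d then H (?f p) else 0)"
    by (rule sum.reindex_bij_betw[OF dig_bij, symmetric])
  also have "\<dots> = (\<Sum>p<b ^ k. if dig b p i = d then H (dig b p) else 0)"
    using i by (simp add: ext cong: if_cong)
  finally show ?thesis .
qed

section \<open>Monotone submodular functions and their distortions\<close>

locale setfun =
  fixes n :: nat and F :: "nat set \<Rightarrow> real" and w :: "nat \<Rightarrow> real"
  assumes mono: "A \<subseteq> B \<Longrightarrow> B \<subseteq> {..<n} \<Longrightarrow> F A \<le> F B"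
    and subm: "A \<subseteq> {..<n} \<Longrightarrow> B \<subseteq> {..<n} \<Longrightarrow> F (A \<union> B) + F (A \<inter> B) \<le> F A + F B"
    and nonneg: "A \<subseteq> {..<n} \<Longrightarrow> 0 \<le> F A"
    and w0: "x < n \<Longrightarrow> 0 \<le> w x" and w1: "x < n \<Longrightarrow> w x \<le> 1"
begin

definition ell :: "nat \<Rightarrow> real" where
  "ell x = F {..<n} - F ({..<n} - {x})"

text \<open>Equals \<open>D * g X + sum ell X\<close> for \<open>g = F - sum ell\<close>. Written as
  a convex combination of \<open>F\<close> and a modular function, it visibly inherits monotonicity
  and submodularity.\<close>

definition h :: "real \<Rightarrow> nat set \<Rightarrow> real" where
  "h D X = D * F X + (1 - D) * sum ell X"

lemma ell_nonneg: "0 \<le> ell x"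
  unfolding ell_def using mono[of "{..<n} - {x}" "{..<n}"] by auto

lemma F_dim:
  assumes "X \<subseteq> Y" "Y \<subseteq> {..<n}" "Z \<subseteq> {..<n}"
  shows "F (Y \<union> Z) - F Y \<le> F (X \<union> Z) - F X"
proof -
  have "F (Y \<union> (X \<union> Z)) + F (Y \<inter> (X \<union> Z)) \<le> F Y + F (X \<union> Z)"
    by (rule subm) (use assms in auto)
  moreover have "F X \<le> F (Y \<inter> (X \<union> Z))"
    by (rule mono) (use assms in auto)
  moreover have "Y \<union> (X \<union> Z) = Y \<union> Z" using assms by auto
  ultimately show ?thesis by simp
qed

lemma ell_le:
  assumes "X \<subseteq> {..<n}" "x < n" "x \<notin> X"
  shows "ell x \<le> F (insert x X) - F X"
  using F_dim[of X "{..<n} - {x}" "{x}"] assms by (auto simp: ell_def insert_absorb)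

lemma sum_ell_Un:
  assumes "Y \<subseteq> {..<n}" "Z \<subseteq> {..<n}"
  shows "sum ell (Y \<union> Z) = sum ell Y + sum ell (Z - Y)"
proof -
  have "finite Y" "finite Z" using assms finite_subset by blast+
  then show ?thesis
    using sum.union_disjoint[of Y "Z - Y" ell] by auto
qed

lemma ell_dim:
  assumes "X \<subseteq> Y" "Y \<subseteq> {..<n}" "Z \<subseteq> {..<n}"
  shows "sum ell (Y \<union> Z) - sum ell Y \<le> sum ell (X \<union> Z) - sum ell X"
proof -
  have "finite Z" using assms finite_subset by blast
  then have "sum ell (Z - Y) \<le> sum ell (Z - X)"
    by (intro sum_mono2) (use assms ell_nonneg in auto)
  then show ?thesis using sum_ell_Un[of X Z] sum_ell_Un[of Y Z] assms by auto
qed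

text \<open>Adding the elements of \<open>Y - X\<close> one at a time, each marginal is at least the
  one at the top. In other words, \<open>g\<close> is monotone.\<close>

lemma sum_ell_le:
  assumes "X \<subseteq> Y" "Y \<subseteq> {..<n}"
  shows "sum ell Y - sum ell X \<le> F Y - F X"
proof -
  have "sum ell Y - sum ell X \<le> F Y - F X" if "finite Z" "Z \<inter> X = {}" "Y = X \<union> Z" "Y \<subseteq> {..<n}" for Y Z
    using that
  proof (induction Z arbitrary: Y rule: finite_induct)
    case (insert z Z)
    have "sum ell (X \<union> Z) - sum ell X \<le> F (X \<union> Z) - F X"
      by (rule insert.IH) (use insert in auto)
    moreover have "ell z \<le> F (insert z (X \<union> Z)) - F (X \<union> Z)"
      by (rule ell_le) (use insert in auto)
    moreover have "sum ell (insert z (X \<union> Z)) = ell z + sum ell (X \<union> Z)"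
      by (rule sum.insert) (use insert finite_subset in auto)
    ultimately show ?case using insert by simp
  qed auto
  from this[of "Y - X" Y] show ?thesis
    using assms finite_subset by blast
qed

context
  fixes D :: real
  assumes D0: "0 \<le> D" and D1: "D \<le> 1"
begin

lemma h_mono: "X \<subseteq> Y \<Longrightarrow> Y \<subseteq> {..<n} \<Longrightarrow> h D X \<le> h D Y"
  unfolding h_def using mono[of X Y] D0 D1 ell_nonneg finite_subset[of Y "{..<n}"]
  by (intro add_mono mult_left_mono sum_mono2) auto

lemma h_dim:
  assumes "X \<subseteq> Y" "Y \<subseteq> {..<n}" "Z \<subseteq> {..<n}"
  shows "h D (Y \<union> Z) - h D Y \<le> h D (X \<union> Z) - h D X"
proof -
  have "D * (F (Y \<union> Z) - F Y) \<le> D * (F (X \<union> Z) - F X)"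
    by (rule mult_left_mono[OF F_dim[OF assms] D0])
  moreover have "(1 - D) * (sum ell (Y \<union> Z) - sum ell Y) \<le> (1 - D) * (sum ell (X \<union> Z) - sum ell X)"
    by (rule mult_left_mono[OF ell_dim[OF assms]]) (use D1 in simp)
  ultimately show ?thesis unfolding h_def by (simp add: algebra_simps)
qed

lemma h_dim1:
  assumes "X \<subseteq> Y" "Y \<subseteq> {..<n}" "x < n"
  shows "h D (insert x Y) - h D Y \<le> h D (insert x X) - h D X"
  using h_dim[of X Y "{x}"] assms by auto

lemma h_gain_nonneg: "X \<subseteq> {..<n} \<Longrightarrow> x < n \<Longrightarrow> 0 \<le> h D (insert x X) - h D X"
  using h_mono[of X "insert x X"] by auto

text \<open>No distortion pushes a marginal below \<open>ell x\<close>. This allows a share of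
  \<open>ell x\<close> to be set aside whenever a small element of the reference solution is
  picked.\<close>

lemma h_gain_ge:
  assumes "X \<subseteq> {..<n}" "x < n" "x \<notin> X"
  shows "ell x \<le> h D (insert x X) - h D X"
proof -
  have "h D (insert x X) - h D X = D * (F (insert x X) - F X) + (1 - D) * ell x"
    using assms finite_subset[of X "{..<n}"] by (simp add: h_def algebra_simps)
  moreover have "D * ell x \<le> D * (F (insert x X) - F X)"
    by (rule mult_left_mono[OF ell_le[OF assms] D0])
  ultimately show ?thesis by (simp add: algebra_simps)
qed

lemma h_diff_le:
  assumes "X \<subseteq> Y" "Y \<subseteq> {..<n}"
  shows "h D Y - h D X \<le> F Y - F X"
proof -
  have "(1 - D) * (sum ell Y - sum ell X) \<le> (1 - D) * (F Y - F X)"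
    by (rule mult_left_mono[OF sum_ell_le[OF assms]]) (use D1 in simp)
  then show ?thesis unfolding h_def by (simp add: algebra_simps)
qed

lemma h_diff_ge:
  assumes "X \<subseteq> Y" "Y \<subseteq> {..<n}"
  shows "D * (F Y - F X) \<le> h D Y - h D X"
proof -
  have "sum ell X \<le> sum ell Y"
    by (rule sum_mono2) (use assms ell_nonneg finite_subset[of Y "{..<n}"] in auto)
  then have "0 \<le> (1 - D) * (sum ell Y - sum ell X)" using D1 by simp
  then show ?thesis unfolding h_def by (simp add: algebra_simps)
qed

lemma h_subadd:
  assumes "finite Z" "X \<subseteq> {..<n}" "Z \<subseteq> {..<n}"
  shows "h D (X \<union> Z) - h D X \<le> (\<Sum>z\<in>Z. h D (insert z X) - h D X)"
  using assms
proof (induction Z rule: finite_induct)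
  case (insert z Z)
  have "h D (insert z (X \<union> Z)) - h D (X \<union> Z) \<le> h D (insert z X) - h D X"
    by (rule h_dim1) (use insert in auto)
  then show ?case using insert by auto
qed auto

end

end

section \<open>The abstract algorithm\<close>

text \<open>
  The contents of all candidate sets are kept in one array \<open>A\<close>, where the value \<open>x + 1\<close> stands for
  the element \<open>x\<close> and \<open>0\<close> for an empty cell. Cell \<open>x + 1\<close> is reserved for \<open>x\<close> as a committed element,
  cell \<open>n + 1 + (x + 1)\<close> for \<open>x\<close> as a small element; cells \<open>0\<close> and \<open>n + 1\<close> stay empty, so that writing
  the answer ``no element'' there is harmless. From \<open>2 (n + 1)\<close> on follow the slots, with \<open>L\<close> cells each.
  The candidate \<open>\<phi>\<close> reads cell \<open>\<phi> i\<close> of slot \<open>i\<close>; the candidates are numbered by the digits of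
  \<open>p < L\<^bsup>K\<^esup>\<close> in base \<open>L\<close>.
\<close>

definition items :: "nat \<Rightarrow> nat \<Rightarrow> nat \<Rightarrow> (nat \<Rightarrow> nat) \<Rightarrow> (nat \<Rightarrow> nat) \<Rightarrow> nat set" where
  "items n L K A \<phi> =
     {x. x < n \<and> (\<exists>c. (c < 2 * Suc n \<or> (\<exists>i<K. c = 2 * Suc n + i * L + \<phi> i)) \<and> A c = Suc x)}"

text \<open>A search for the least key, with the answer shifted by one so that 0 means that nothing
  qualifies. The recursion follows the program loop \<open>scan\<close>, so it serves as the loop
  invariant.\<close>

primrec scanf :: "(nat \<Rightarrow> bool) \<Rightarrow> (nat \<Rightarrow> real) \<Rightarrow> nat \<Rightarrow> nat" where
  "scanf c k 0 = 0"
| "scanf c k (Suc x) =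
     (let b = scanf c k x in if c x \<and> (b = 0 \<or> k x < k (b - 1)) then Suc x else b)"

lemma scanf_le: "scanf c k n \<le> n"
  by (induction n) (auto simp: Let_def intro: le_SucI)

lemma scanf_0: "scanf c k n = 0 \<Longrightarrow> x < n \<Longrightarrow> \<not> c x"
  by (induction n) (auto simp: Let_def less_Suc_eq split: if_splits)

lemma scanf_Suc: "scanf c k n = Suc x \<Longrightarrow> x < n \<and> c x \<and> (\<forall>y<n. c y \<longrightarrow> k x \<le> k y)"
proof (induction n arbitrary: x)
  case (Suc n)
  show ?case
  proof (cases "scanf c k n")
    case 0
    then have "\<forall>y<n. \<not> c y" using scanf_0 by blast
    then show ?thesis using Suc.prems 0 by (auto simp: less_Suc_eq split: if_splits)
  next
    case (Suc z)
    then have z: "z < n" "c z" "\<And>y. y < n \<Longrightarrow> c y \<Longrightarrow> k z \<le> k y" using Suc.IH by auto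
    show ?thesis
    proof (cases "c n \<and> k n < k z")
      case True
      then have "x = n" using Suc.prems Suc by simp
      then show ?thesis using True z(3) by (fastforce simp: less_Suc_eq)
    next
      case False
      then have "x = z" using Suc.prems Suc by (simp split: if_splits)
      then show ?thesis using False z by (auto simp: less_Suc_eq)
    qed
  qed
qed simp

lemma cells_upd:
  assumes "P c" "A c = 0 \<or> A c = Suc x" "x < n"
  shows "{y. y < n \<and> (\<exists>c'. P c' \<and> (A(c := Suc x)) c' = Suc y)} = insert x {y. y < n \<and> (\<exists>c'. P c' \<and> A c' = Suc y)}"
proof (intro set_eqI iffI)
  fix y assume "y \<in> {y. y < n \<and> (\<exists>c'. P c' \<and> (A(c := Suc x)) c' = Suc y)}"
  then obtain c' where "y < n" "P c'" "(A(c := Suc x)) c' = Suc y" by blast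
  then show "y \<in> insert x {y. y < n \<and> (\<exists>c'. P c' \<and> A c' = Suc y)}"
    by (cases "c' = c") auto
next
  fix y assume "y \<in> insert x {y. y < n \<and> (\<exists>c'. P c' \<and> A c' = Suc y)}"
  then consider "y = x" | c' where "y < n" "P c'" "A c' = Suc y" "y \<noteq> x" by blast
  then show "y \<in> {y. y < n \<and> (\<exists>c'. P c' \<and> (A(c := Suc x)) c' = Suc y)}"
  proof cases
    case 1
    then show ?thesis using assms by auto
  next
    case 2
    then have "c' \<noteq> c" using assms(2) by auto
    then show ?thesis using 2 by auto
  qed
qed

lemma cells_other:
  assumes "\<not> P c"
  shows "{y. y < n \<and> (\<exists>c'. P c' \<and> (A(c := v)) c' = Suc y)} = {y. y < n \<and> (\<exists>c'. P c' \<and> A c' = Suc y)}"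
  using assms by (metis fun_upd_other)

locale alg = setfun n F w for n :: nat and F :: "nat set \<Rightarrow> real" and w :: "nat \<Rightarrow> real" +
  fixes L K :: nat and U :: real
  assumes L1: "1 \<le> L"
begin

abbreviation its :: "(nat \<Rightarrow> nat) \<Rightarrow> nat \<Rightarrow> nat set" where
  "its A p \<equiv> items n L K A (dig L p)"

text \<open>
  \<open>V\<close>, \<open>gain\<close> and \<open>mg\<close> are sums over the \<open>L\<^bsup>K\<^esup>\<close> candidates rather than averages; \<open>unit\<close> and \<open>thr\<close> carry
  the factor \<open>L\<^bsup>K\<^esup>\<close> accordingly. \<open>U\<close> is an estimate of the optimum, correct up to a factor of 2.
\<close>

definition V :: "real \<Rightarrow> (nat \<Rightarrow> nat) \<Rightarrow> real" where
  "V D A = (\<Sum>p<L ^ K. h D (its A p))"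

definition gain :: "real \<Rightarrow> (nat \<Rightarrow> nat) \<Rightarrow> nat \<Rightarrow> nat \<Rightarrow> real" where
  "gain D A c x = V D (A(c := Suc x)) - V D A"

definition mg :: "real \<Rightarrow> (nat \<Rightarrow> nat) \<Rightarrow> nat \<Rightarrow> real" where
  "mg D A x = (\<Sum>p<L ^ K. h D (insert x (its A p)) - h D (its A p))"

definition scell :: "nat \<Rightarrow> nat" where "scell x = Suc n + Suc x"

definition fcell :: "nat \<Rightarrow> nat \<Rightarrow> nat" where "fcell i t = 2 * Suc n + i * L + t"

text \<open>The constants are set against the \<open>L\<close> phases: with
  \<open>K = 8 * L ^ 3\<close>, both \<open>K * unit\<close> and \<open>4 * thr\<close> equal
  \<open>U * L ^ K / L ^ 2\<close>. One lost unit per slot and one oversized small pick per phase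
  then cost only a multiple of \<open>U / L\<close> per candidate in all.\<close>

definition unit :: real where "unit = U * real (L ^ K) / (8 * real L ^ 5)"
definition thr :: real where "thr = U * real (L ^ K) / (4 * real L ^ 2)"
definition a0 :: real where "a0 = (real L / real (Suc L)) ^ L"

definition base :: "(nat \<Rightarrow> nat) \<Rightarrow> nat \<Rightarrow> nat" where
  "base A = (\<lambda>c. if c < Suc n then A c else 0)"

definition pickf :: "(nat \<Rightarrow> nat) \<Rightarrow> nat \<Rightarrow> nat \<Rightarrow> nat \<Rightarrow> real \<Rightarrow> nat" where
  "pickf A t i m D = scanf (\<lambda>x. \<not> gain D A (fcell i t) x < real m * unit) w n"

text \<open>Smallness is judged at the committed elements alone and with distortion
  \<open>a0\<close>, so it does not change between commits. The key is weight per gain, and the gain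
  is positive where it is used.\<close>

definition picks :: "(nat \<Rightarrow> nat) \<Rightarrow> real \<Rightarrow> nat" where
  "picks A D =
     scanf (\<lambda>x. gain a0 (base A) (scell x) x < thr \<and> 0 < gain D A (scell x) x)
       (\<lambda>x. w x / gain D A (scell x) x) n"

definition pstep :: "real \<Rightarrow> (nat \<Rightarrow> nat) \<times> real \<Rightarrow> (nat \<Rightarrow> nat) \<times> real" where
  "pstep D = (\<lambda>(A, acc). if acc < unit then
      (A(Suc n + picks A D := picks A D),
       acc + (if picks A D = 0 then 0 else gain D A (scell (picks A D - 1)) (picks A D - 1)))
     else (A, acc))"

definition chunk :: "real \<Rightarrow> (nat \<Rightarrow> nat) \<Rightarrow> nat \<Rightarrow> nat" where
  "chunk D A = fst ((pstep D ^^ n) (A, 0))"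

text \<open>
  The state consists of the cells, the phase \<open>t\<close>, the slot \<open>i\<close>, the guessed gain \<open>m\<close> in multiples of
  \<open>unit\<close>, and the distortion \<open>D\<close>. The operations are: 0 raise the guess, 1 go to the next slot,
  2 fill the slot, 3 add small elements worth about one \<open>unit\<close>, 4 go to the next phase,
  5 commit the element that would fill the slot and start again.
\<close>

definition ostep :: "nat \<Rightarrow> (nat \<Rightarrow> nat) \<times> nat \<times> nat \<times> nat \<times> real \<Rightarrow> (nat \<Rightarrow> nat) \<times> nat \<times> nat \<times> nat \<times> real" where
  "ostep c = (\<lambda>(A, t, i, m, D).
     if c = 0 then (A, t, i, Suc m, D)
     else if c = 1 then (A, t, Suc i, 0, D)
     else if c = 2 then (if i < K \<and> t < L then A(fcell i t := pickf A t i m D) else A, t, i, m, D)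
     else if c = 3 then (chunk D A, t, i, m, D)
     else if c = 4 then (A, Suc t, 0, 0, D * (real (Suc L) / real L))
     else (if i < K \<and> t < L then base (A(pickf A t i m D := pickf A t i m D)) else base A, 0, 0, 0, a0))"

lemma its_sub: "its A p \<subseteq> {..<n}"
  by (auto simp: items_def)

lemma items_scell:
  assumes "x < n" "c < 2 * Suc n" "A c = 0 \<or> A c = Suc x"
  shows "items n L K (A(c := Suc x)) \<phi> = insert x (items n L K A \<phi>)"
  unfolding items_def by (rule cells_upd) (use assms in auto)

lemma fcell_inj: "i < K \<Longrightarrow> j < K \<Longrightarrow> t < L \<Longrightarrow> t' < L \<Longrightarrow> fcell i t = fcell j t' \<longleftrightarrow> i = j \<and> t = t'"
proof
  assume a: "t < L" "t' < L" "fcell i t = fcell j t'"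
  then have e: "i * L + t = j * L + t'" by (simp add: fcell_def)
  have "(i * L + t) div L = i" "(i * L + t) mod L = t" "(j * L + t') div L = j" "(j * L + t') mod L = t'"
    using a by auto
  then show "i = j \<and> t = t'" using e by metis
qed simp

lemma dig_L: "dig L p i < L"
  using L1 by (simp add: dig_less)

lemma items_fcell:
  assumes "x < n" "i < K" "t < L" "A (fcell i t) = 0"
  shows "its (A(fcell i t := Suc x)) p = (if dig L p i = t then insert x (its A p) else its A p)"
proof -
  have e: "(\<exists>j<K. fcell i t = fcell j (dig L p j)) \<longleftrightarrow> dig L p i = t"
    using fcell_inj[OF assms(2) _ assms(3) dig_L] assms(2) by metis
  have i: "its B p = {y. y < n \<and> (\<exists>c. (c < 2 * Suc n \<or> (\<exists>j<K. c = fcell j (dig L p j))) \<and> B c = Suc y)}" for B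
    by (simp only: items_def fcell_def)
  show ?thesis
  proof (cases "dig L p i = t")
    case True
    then show ?thesis unfolding i using e assms by (subst if_P, simp) (intro cells_upd, auto)
  next
    case False
    moreover have "\<not> fcell i t < 2 * Suc n" by (simp add: fcell_def)
    ultimately show ?thesis unfolding i using e by (subst if_not_P, simp) (intro cells_other, auto)
  qed
qed

lemma gain_scell:
  assumes "x < n" "c < 2 * Suc n" "A c = 0 \<or> A c = Suc x"
  shows "gain D A c x = mg D A x"
  using assms by (simp add: gain_def V_def mg_def items_scell sum_subtractf)

lemma gain_fcell:
  assumes "x < n" "i < K" "t < L" "A (fcell i t) = 0"
  shows "gain D A (fcell i t) x =
    (\<Sum>p<L ^ K. if dig L p i = t then h D (insert x (its A p)) - h D (its A p) else 0)"
  unfolding gain_def V_def sum_subtractf[symmetric] items_fcell[of x i t A, OF assms]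
  by (rule sum.cong) auto

text \<open>The cell is empty, so redirecting slot \<open>i\<close> to it can only shrink a
  candidate and, by diminishing returns, only raise its marginal. The candidates that read the cell
  thus account for at least a \<open>1 / L\<close> share of the total gain.\<close>

lemma gain_fcell_ge:
  assumes "x < n" "i < K" "t < L" "A (fcell i t) = 0" and D: "0 \<le> D" "D \<le> 1"
  shows "mg D A x \<le> real L * gain D A (fcell i t) x"
proof -
  let ?H = "\<lambda>\<phi>. h D (insert x (items n L K A \<phi>)) - h D (items n L K A \<phi>)"
  have r: "items n L K A (restrict \<phi> {..<K}) = items n L K A \<phi>" for \<phi>
    unfolding items_def by (rule Collect_cong) auto
  have "(\<Sum>p<L ^ K. ?H (dig L p)) \<le> real L * (\<Sum>p<L ^ K. if dig L p i = t then ?H (dig L p) else 0)"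
  proof (rule sum_dig_update)
    fix p
    have "items n L K A ((dig L p)(i := t)) \<subseteq> its A p"
    proof
      fix y assume "y \<in> items n L K A ((dig L p)(i := t))"
      then obtain c where y: "y < n" "A c = Suc y"
        and c: "c < 2 * Suc n \<or> (\<exists>j<K. c = fcell j (((dig L p)(i := t)) j))"
        by (auto simp: items_def fcell_def)
      from c have "c < 2 * Suc n \<or> (\<exists>j<K. c = fcell j (dig L p j))"
        using y assms(4) by (auto split: if_splits)
      then show "y \<in> its A p" using y by (auto simp: items_def fcell_def)
    qed
    then show "?H (dig L p) \<le> ?H ((dig L p)(i := t))"
      using h_dim1[OF D _ its_sub assms(1)] by blast
  qed (use assms(2,3) in \<open>simp_all only: r\<close>)
  then show ?thesis by (simp only: mg_def gain_fcell[of x i t A D, OF assms(1-4)])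
qed

definition ext :: "(nat \<Rightarrow> nat) \<Rightarrow> (nat \<Rightarrow> nat) \<Rightarrow> bool" where
  "ext A B \<longleftrightarrow> (\<forall>c. A c = 0 \<or> A c = B c)"

lemma ext_refl: "ext A A" and ext_trans: "ext A B \<Longrightarrow> ext B C \<Longrightarrow> ext A C"
  by (auto simp: ext_def) (metis)

lemma ext_its: "ext A B \<Longrightarrow> its A p \<subseteq> its B p"
  by (auto simp: ext_def items_def) (metis Zero_not_Suc)+

context
  fixes D :: real
  assumes D: "0 \<le> D" "D \<le> 1"
begin

lemma mg_anti: "ext A B \<Longrightarrow> x < n \<Longrightarrow> mg D B x \<le> mg D A x"
  unfolding mg_def by (intro sum_mono h_dim1[OF D] ext_its its_sub)

lemma mg_nonneg: "x < n \<Longrightarrow> 0 \<le> mg D A x"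
  unfolding mg_def by (intro sum_nonneg h_gain_nonneg[OF D] its_sub)

lemma mg_ge_ell:
  assumes "x < n" "\<And>p. x \<notin> its A p"
  shows "real (L ^ K) * ell x \<le> mg D A x"
proof -
  have "(\<Sum>p<L ^ K. ell x) \<le> mg D A x"
    unfolding mg_def by (rule sum_mono) (rule h_gain_ge[OF D its_sub assms])
  then show ?thesis by simp
qed

lemma mg_zero: "(\<And>p. x \<in> its A p) \<Longrightarrow> mg D A x = 0"
  by (simp add: mg_def insert_absorb)

end

text \<open>From \<open>1 + x \<le> exp x\<close>: with \<open>x = 1 / L\<close> for the lower bound
  and \<open>x = - 1 / (L + 1)\<close> for the last one. The crude \<open>1 / 4\<close> comes back
  as the factor 4 in \<open>small_gain\<close>.\<close>

lemma a0_bounds: "1 / 4 \<le> a0" "a0 \<le> 1" "a0 \<le> (1 + 1 / real L) / exp 1"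
proof -
  have L: "0 < real L" using L1 by simp
  have q: "real L / real (Suc L) = 1 / (1 + 1 / real L)" using L by (simp add: field_simps)
  have "(1 + 1 / real L) ^ L \<le> exp (1 / real L) ^ L"
    by (rule power_mono) (use exp_ge_add_one_self L in auto)
  also have "\<dots> = exp 1" using L by (simp add: exp_of_nat_mult[symmetric])
  also have "\<dots> \<le> 4" using exp_le by simp
  finally have "(1 + 1 / real L) ^ L \<le> 4" .
  moreover have "0 < (1 + 1 / real L) ^ L" using L by (simp add: add_pos_pos)
  ultimately show "1 / 4 \<le> a0" unfolding a0_def q by (simp add: power_one_over field_simps)
  show "a0 \<le> 1" unfolding a0_def by (rule power_le_one) (use L in auto)
  have "real L / real (Suc L) = 1 + (- 1 / real (Suc L))" using L by (simp add: field_simps)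
  also have "\<dots> \<le> exp (- 1 / real (Suc L))" by (rule exp_ge_add_one_self)
  finally have "(real L / real (Suc L)) ^ Suc L \<le> exp (- 1 / real (Suc L)) ^ Suc L"
    by (rule power_mono) (use L in auto)
  also have "\<dots> = exp (- 1)"
    by (simp only: exp_of_nat_mult[symmetric]) simp
  finally have "a0 * (real L / real (Suc L)) \<le> exp (- 1)"
    by (simp add: a0_def mult.commute)
  then show "a0 \<le> (1 + 1 / real L) / exp 1"
    using L by (simp add: field_simps exp_minus)
qed

end

section \<open>Analysis of a run\<close>

lemma sum_Un_le:
  fixes f :: "'a \<Rightarrow> real"
  assumes "finite A" "finite B" "\<And>x. x \<in> A \<Longrightarrow> 0 \<le> f x"
  shows "sum f (A \<union> B) \<le> sum f A + sum f B"
proof -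
  have "sum f (A \<union> B) + sum f (A \<inter> B) = sum f A + sum f B"
    by (rule sum.union_inter[OF assms(1,2)])
  moreover have "0 \<le> sum f (A \<inter> B)" using assms(3) by (intro sum_nonneg) blast
  ultimately show ?thesis by simp
qed

context alg
begin

definition bs :: "nat set \<Rightarrow> nat \<Rightarrow> nat" where
  "bs S = (\<lambda>c. if \<exists>x\<in>S. c = Suc x then c else 0)"

lemma its_bs': "S \<subseteq> {..<n} \<Longrightarrow> its (bs S) p = S"
proof -
  assume S: "S \<subseteq> {..<n}"
  have "y \<in> its (bs S) p \<longleftrightarrow> y \<in> S" for y
  proof
    assume "y \<in> its (bs S) p"
    then obtain c where "bs S c = Suc y" unfolding items_def by blast
    then show "y \<in> S" by (auto simp: bs_def split: if_splits)
  next
    assume "y \<in> S"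
    then have "y < n" "bs S (Suc y) = Suc y" using S by (auto simp: bs_def)
    moreover have "Suc y < 2 * Suc n" using \<open>y < n\<close> by simp
    ultimately show "y \<in> its (bs S) p" unfolding items_def by blast
  qed
  then show ?thesis by blast
qed

definition large :: "nat set \<Rightarrow> nat \<Rightarrow> bool" where
  "large S x \<longleftrightarrow> \<not> gain a0 (bs S) (scell x) x < thr"

text \<open>Nondeterministic reachability: since the program runs through all lists of operations,
  the analysis may choose the operations freely and only has to count them.\<close>

definition steps :: "nat set \<Rightarrow> nat \<Rightarrow> (nat \<Rightarrow> nat) \<times> nat \<times> nat \<times> nat \<times> real \<Rightarrow> bool" where
  "steps S q \<sigma> \<longleftrightarrow> (\<exists>os. length os \<le> q \<and> (\<forall>c\<in>set os. c < 6) \<and> fold ostep os (bs S, 0, 0, 0, a0) = \<sigma>)"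

text \<open>A phase takes at most \<open>144 * L ^ 8\<close> operations for \<open>8 * L ^ 3\<close>
  slots at \<open>18 * L ^ 5\<close> each, and at most \<open>18 * L ^ 8\<close> for the small
  elements and the change of phase. Times \<open>L\<close> phases this is
  \<open>162 * L ^ 9\<close>, rounded up.\<close>

definition NB :: nat where "NB = 170 * L ^ 9"

lemma steps_0: "steps S q (bs S, 0, 0, 0, a0)"
  unfolding steps_def by (rule exI[of _ "[]"]) simp

lemma steps_Suc: "steps S q \<sigma> \<Longrightarrow> c < 6 \<Longrightarrow> ostep c \<sigma> = \<sigma>' \<Longrightarrow> steps S (Suc q) \<sigma>'"
  unfolding steps_def
proof (elim exE conjE)
  fix os assume "length os \<le> q" "\<forall>c\<in>set os. c < 6" "fold ostep os (bs S, 0, 0, 0, a0) = \<sigma>" "c < 6" "ostep c \<sigma> = \<sigma>'"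
  then show "\<exists>os. length os \<le> Suc q \<and> (\<forall>c\<in>set os. c < 6) \<and> fold ostep os (bs S, 0, 0, 0, a0) = \<sigma>'"
    by (intro exI[of _ "os @ [c]"]) auto
qed

lemma steps_mono: "steps S q \<sigma> \<Longrightarrow> q \<le> q' \<Longrightarrow> steps S q' \<sigma>"
  unfolding steps_def using le_trans by blast

lemma steps_incr: "steps S q (A, t, i, m, D) \<Longrightarrow> steps S (q + j) (A, t, i, m + j, D)"
proof (induction j)
  case (Suc j)
  then show ?case using steps_Suc[of S "q + j" "(A, t, i, m + j, D)" 0] by (simp add: ostep_def)
qed simp

lemma steps_chunk: "steps S q (A, t, i, m, D) \<Longrightarrow> steps S (q + j) ((chunk D ^^ j) A, t, i, m, D)"
proof (induction j)
  case (Suc j)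
  then show ?case using steps_Suc[of S "q + j" "((chunk D ^^ j) A, t, i, m, D)" 3] by (simp add: ostep_def)
qed simp

definition a :: "nat \<Rightarrow> real" where "a t = a0 * (real (Suc L) / real L) ^ t"

lemma a_0: "a 0 = a0" and a_Suc: "a (Suc t) = a t * (real (Suc L) / real L)"
  by (simp_all add: a_def)

lemma a_Suc_diff: "a (Suc t) - a t = a t / real L"
  using L1 by (simp add: a_Suc field_simps)

lemma a_L: "a L = 1"
  using L1 by (simp add: a_def a0_def power_mult_distrib[symmetric])

lemma a_nonneg: "0 \<le> a t"
  using a0_bounds(1) by (simp add: a_def)

lemma a_mono: "t \<le> t' \<Longrightarrow> a t \<le> a t'"
proof (rule lift_Suc_mono_le[of a])
  show "a t \<le> a (Suc t)" for t
    using a_Suc_diff[of t] a_nonneg[of t] by (simp add: divide_nonneg_nonneg algebra_simps)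
qed

lemma a_le_1: "t \<le> L \<Longrightarrow> a t \<le> 1"
  using a_mono[of t L] a_L by simp

end

text \<open>
  The situation after the last commit: \<open>few\<close> bounds the number of slots needed, and \<open>nocom\<close> says
  that no continuation would ever fill a slot with an element of \<open>Os\<close>.
\<close>

locale slot_run = alg n F w L K U
  for n :: nat and F :: "nat set \<Rightarrow> real" and w :: "nat \<Rightarrow> real" and L K :: nat and U :: real +
  fixes S0 Os :: "nat set"
  assumes U0: "0 < U"
    and feasU: "X \<subseteq> {..<n} \<Longrightarrow> sum w X \<le> 1 \<Longrightarrow> F X \<le> 2 * U"
    and S0_Os: "S0 \<subseteq> Os" and Os: "Os \<subseteq> {..<n}" and wOs: "sum w Os \<le> 1"
    and K8: "K = 8 * L ^ 3"
    and few: "card {x \<in> Os - S0. large S0 x} \<le> K"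
    and nocom: "steps S0 NB (A, t, i, m, D) \<Longrightarrow> i < K \<Longrightarrow> t < L \<Longrightarrow> 0 < m \<Longrightarrow> pickf A t i m D = Suc x
      \<Longrightarrow> base A = bs S0 \<Longrightarrow> A (fcell i t) = 0 \<Longrightarrow> 0 \<le> D \<Longrightarrow> D \<le> 1 \<Longrightarrow> x \<notin> Os - S0"
begin

section \<open>Large and small elements of the reference solution, and the invariant of a
  run\<close>

definition Lg :: "nat set" where "Lg = {x \<in> Os - S0. large S0 x}"
definition Sm :: "nat set" where "Sm = {x \<in> Os - S0. \<not> large S0 x}"
definition k :: nat where "k = card Lg"
definition lab :: "nat \<Rightarrow> nat" where "lab = (SOME f. bij_betw f {..<k} Lg)"

abbreviation NF :: real where "NF \<equiv> real (L ^ K)"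

definition Sset :: "(nat \<Rightarrow> nat) \<Rightarrow> nat set" where
  "Sset A = {x. x < n \<and> A (scell x) = Suc x}"

text \<open>That slots avoid \<open>Os\<close> makes the missing part of \<open>Os\<close> common to
  all candidates; that slot \<open>j\<close> holds nothing heavier than its owner
  \<open>lab j\<close> keeps them feasible. The last clause says that cells still to come, ordered
  by phase and then by slot, are empty, as \<open>gain_fcell_ge\<close> requires.\<close>

definition run_inv :: "(nat \<Rightarrow> nat) \<Rightarrow> nat \<Rightarrow> nat \<Rightarrow> bool" where
  "run_inv A t i \<longleftrightarrow> base A = bs S0 \<and> A (Suc n) = 0 \<and> (\<forall>x<n. A (scell x) = 0 \<or> A (scell x) = Suc x)
     \<and> Sset A \<inter> (S0 \<union> Lg) = {}
     \<and> (\<forall>j<K. \<forall>t'<L. A (fcell j t') = 0 \<or> (\<exists>x<n. A (fcell j t') = Suc x \<and> j < k \<and> w x \<le> w (lab j) \<and> x \<notin> Os))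
     \<and> (\<forall>j<K. \<forall>t'<L. t < t' \<or> t' = t \<and> i \<le> j \<longrightarrow> A (fcell j t') = 0)"

text \<open>
  The small elements of \<open>Os\<close> that were picked themselves release their own weight; for the others only
  the fraction \<open>\<theta>\<close>, the remaining time, is still reserved.
\<close>

definition wt :: "real \<Rightarrow> (nat \<Rightarrow> nat) \<Rightarrow> bool" where
  "wt \<theta> A \<longleftrightarrow> sum w (Sset A) + \<theta> * sum w (Sm - Sset A) \<le> sum w Sm"

lemma fin: "finite Os" "finite S0" "finite Lg" "finite Sm"
  using Os S0_Os finite_subset[of _ "{..<n}"] by (auto simp: Lg_def Sm_def)

lemma sub_n: "S0 \<subseteq> {..<n}" "Lg \<subseteq> {..<n}" "Sm \<subseteq> {..<n}" "Sset A \<subseteq> {..<n}"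
  using Os S0_Os by (auto simp: Lg_def Sm_def Sset_def)

lemma finS: "finite (Sset A)"
  using sub_n(4) finite_subset by blast

lemma lab: "bij_betw lab {..<k} Lg"
proof -
  have "\<exists>f. bij_betw f {..<k} Lg"
    using fin(3) ex_bij_betw_nat_finite[of Lg] by (auto simp: k_def lessThan_atLeast0)
  then show ?thesis unfolding lab_def by (rule someI_ex)
qed

lemma lab_Lg: "i < k \<Longrightarrow> lab i \<in> Lg"
  using lab by (auto simp: bij_betw_def)

lemma lab_n: "i < k \<Longrightarrow> lab i < n"
  using lab_Lg sub_n by blast

lemma k_le: "k \<le> K"
  using few by (simp add: k_def Lg_def)

lemma Os_split: "Os = S0 \<union> Lg \<union> Sm" "Lg \<inter> Sm = {}" "S0 \<inter> Lg = {}" "S0 \<inter> Sm = {}"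
  using S0_Os by (auto simp: Lg_def Sm_def)

lemma w_Os: "sum w Os = sum w S0 + sum w Lg + sum w Sm"
proof -
  have "sum w Os = sum w ((S0 \<union> Lg) \<union> Sm)" using Os_split(1) by (rule arg_cong)
  also have "\<dots> = sum w (S0 \<union> Lg) + sum w Sm"
    by (rule sum.union_disjoint) (use fin Os_split(2,4) in auto)
  also have "sum w (S0 \<union> Lg) = sum w S0 + sum w Lg"
    by (rule sum.union_disjoint) (use fin Os_split(3) in auto)
  finally show ?thesis .
qed

lemma unit_pos: "0 < unit" and thr_pos: "0 < thr"
  using U0 L1 by (simp_all add: unit_def thr_def)

lemma fcell_ge: "2 * Suc n \<le> fcell j t"
  by (simp add: fcell_def)

lemma its_iff:
  assumes "run_inv A t i"
  shows "y \<in> its A p \<longleftrightarrow> y \<in> S0 \<union> Sset A \<or> y < n \<and> (\<exists>j<K. A (fcell j (dig L p j)) = Suc y)"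
proof -
  have b: "A c = bs S0 c" if "c < Suc n" for c
    
  proof -
    have "base A = bs S0" using assms by (simp add: run_inv_def)
    then have "base A c = bs S0 c" by simp
    then show ?thesis using that by (simp add: base_def)
  qed
  have 1: "(\<exists>c<2 * Suc n. A c = Suc y) \<longleftrightarrow> y \<in> S0 \<union> Sset A" if y: "y < n"
  proof
    assume "\<exists>c<2 * Suc n. A c = Suc y"
    then obtain c where c: "c < 2 * Suc n" "A c = Suc y" by blast
    consider "c < Suc n" | "c = Suc n" | x where "c = scell x" "x < n"
    proof -
      have "c = scell (c - Suc (Suc n)) \<and> c - Suc (Suc n) < n" if "Suc n < c"
        using that c(1) by (auto simp: scell_def)
      then show ?thesis using that by (metis linorder_neqE_nat)
    qed
    then show "y \<in> S0 \<union> Sset A"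
    proof cases
      case 1
      then show ?thesis using b[of c] c(2) by (auto simp: bs_def split: if_splits)
    next
      case 2
      then show ?thesis using assms c(2) by (simp add: run_inv_def)
    next
      case 3
      then have "A (scell x) = 0 \<or> A (scell x) = Suc x" using assms by (simp add: run_inv_def)
      then show ?thesis using 3 c(2) y by (auto simp: Sset_def)
    qed
  next
    assume "y \<in> S0 \<union> Sset A"
    then consider "y \<in> S0" | "A (scell y) = Suc y" by (auto simp: Sset_def)
    then show "\<exists>c<2 * Suc n. A c = Suc y"
    proof cases
      case 1
      then show ?thesis using b[of "Suc y"] y by (intro exI[of _ "Suc y"]) (auto simp: bs_def)
    next
      case 2
      then show ?thesis using y by (intro exI[of _ "scell y"]) (auto simp: scell_def)
    qed
  qed
  have "y \<in> its A p \<longleftrightarrow> y < n \<and> ((\<exists>c<2 * Suc n. A c = Suc y) \<or> (\<exists>j<K. A (fcell j (dig L p j)) = Suc y))"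
    unfolding items_def fcell_def mem_Collect_eq by blast
  then show ?thesis using 1 sub_n by blast
qed

text \<open>Slots avoid \<open>Os\<close>, so what a candidate lacks of \<open>Os\<close> does not
  depend on the candidate. This is what lets \<open>Psi\<close> account for it by one term, and what
  the commits are for.\<close>

lemma its_Os:
  assumes "run_inv A t i"
  shows "Os - its A p = Lg \<union> (Sm - Sset A)"
proof (intro set_eqI)
  fix y
  have "\<not> (\<exists>j<K. A (fcell j (dig L p j)) = Suc y)" if "y \<in> Os"
  proof
    assume "\<exists>j<K. A (fcell j (dig L p j)) = Suc y"
    then obtain j where "j < K" "A (fcell j (dig L p j)) = Suc y" by blast
    then show False using assms that dig_L unfolding run_inv_def by (metis Zero_not_Suc nat.inject)
  qed
  then show "y \<in> Os - its A p \<longleftrightarrow> y \<in> Lg \<union> (Sm - Sset A)"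
    using its_iff[OF assms, of y p] Os_split assms by (auto simp: run_inv_def)
qed

text \<open>A candidate takes at most one element per slot, each paid for by the weight of a
  different large element of \<open>Os\<close>; the small elements are paid for through
  \<open>wt\<close>.\<close>

lemma its_weight:
  assumes "run_inv A t i" "wt \<theta> A" "0 \<le> \<theta>"
  shows "sum w (its A p) \<le> 1"
proof -
  let ?J = "{j. j < K \<and> A (fcell j (dig L p j)) \<noteq> 0}"
  let ?g = "\<lambda>j. A (fcell j (dig L p j)) - 1"
  have J: "j < k \<and> ?g j < n \<and> w (?g j) \<le> w (lab j)" if "j \<in> ?J" for j
    using assms(1) that dig_L[of p j] unfolding run_inv_def by force
  have "its A p \<subseteq> S0 \<union> Sset A \<union> ?g ` ?J"
  proof
    fix y assume "y \<in> its A p"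
    then consider "y \<in> S0 \<union> Sset A" | j where "j < K" "A (fcell j (dig L p j)) = Suc y"
      using its_iff[OF assms(1)] by blast
    then show "y \<in> S0 \<union> Sset A \<union> ?g ` ?J"
    proof cases
      case 2
      then have "y = ?g j" "j \<in> ?J" by auto
      then show ?thesis by blast
    qed blast
  qed
  moreover have gn: "?g ` ?J \<subseteq> {..<n}" using J by auto
  moreover have f: "finite (S0 \<union> Sset A \<union> ?g ` ?J)" using fin finS by simp
  ultimately have "sum w (its A p) \<le> sum w (S0 \<union> Sset A \<union> ?g ` ?J)"
    using sub_n w0 by (intro sum_mono2) blast+
  also have "\<dots> \<le> sum w (S0 \<union> Sset A) + sum w (?g ` ?J)"
    by (rule sum_Un_le) (use f in \<open>auto intro!: w0 dest: subsetD[OF sub_n(1)] subsetD[OF sub_n(4)]\<close>)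
  also have "\<dots> \<le> sum w S0 + sum w (Sset A) + (\<Sum>j\<in>?J. w (lab j))"
  proof (intro add_mono)
    show "sum w (S0 \<union> Sset A) \<le> sum w S0 + sum w (Sset A)"
      by (rule sum_Un_le) (use fin finS in \<open>auto intro!: w0 dest: subsetD[OF sub_n(1)]\<close>)
    have "sum w (?g ` ?J) \<le> (\<Sum>j\<in>?J. w (?g j))"
      by (rule sum_image_le[where f = "?g" and g = w, unfolded o_def]) (use J w0 in auto)
    also have "\<dots> \<le> (\<Sum>j\<in>?J. w (lab j))"
      by (rule sum_mono) (use J in auto)
    finally show "sum w (?g ` ?J) \<le> (\<Sum>j\<in>?J. w (lab j))" .
  qed
  also have "(\<Sum>j\<in>?J. w (lab j)) \<le> (\<Sum>j<k. w (lab j))"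
    by (rule sum_mono2) (use J lab_n w0 in auto)
  also have "(\<Sum>j<k. w (lab j)) = sum w Lg"
    by (rule sum.reindex_bij_betw[OF lab])
  finally have "sum w (its A p) \<le> sum w S0 + sum w (Sset A) + sum w Lg" by simp
  moreover have "0 \<le> \<theta> * sum w (Sm - Sset A)"
    using sub_n w0 assms(3) by (intro mult_nonneg_nonneg sum_nonneg) auto
  ultimately show ?thesis using assms(2) w_Os wOs by (simp add: wt_def)
qed

lemma h_le_F: "0 \<le> D \<Longrightarrow> D \<le> 1 \<Longrightarrow> X \<subseteq> {..<n} \<Longrightarrow> h D X \<le> F X"
  using h_diff_le[of D "{}" X] nonneg[of "{}"] mult_left_le_one_le[of "F {}" D] by (simp add: h_def)

lemma h_nonneg: "0 \<le> D \<Longrightarrow> D \<le> 1 \<Longrightarrow> X \<subseteq> {..<n} \<Longrightarrow> 0 \<le> h D X"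
  unfolding h_def using nonneg ell_nonneg by (simp add: sum_nonneg)

text \<open>A feasible set is worth at most \<open>2 * U\<close>, so the values of feasible
  candidates add up to at most \<open>16 * L ^ 5\<close> units. This caps both the guesses for the
  slots and the number of chunks in a phase.\<close>

lemma NF_unit: "2 * U * NF = 16 * real L ^ 5 * unit"
  using L1 by (simp add: unit_def field_simps)

lemma sum_2U: "(\<Sum>p<L ^ K. 2 * U) = 16 * real L ^ 5 * unit"
proof -
  have "(\<Sum>p<L ^ K. 2 * U) = NF * (2 * U)" by simp
  also have "\<dots> = 2 * U * NF" by (rule mult.commute)
  finally show ?thesis by (simp only: NF_unit)
qed

lemma V_le:
  assumes "run_inv A t i" "wt \<theta> A" "0 \<le> \<theta>" "0 \<le> D" "D \<le> 1"
  shows "V D A \<le> 16 * real L ^ 5 * unit"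
proof -
  have "V D A \<le> (\<Sum>p<L ^ K. 2 * U)"
    unfolding V_def using its_weight[OF assms(1-3)] assms its_sub
    by (intro sum_mono order_trans[OF h_le_F] feasU) auto
  then show ?thesis by (simp only: sum_2U)
qed

lemma V_nonneg: "0 \<le> D \<Longrightarrow> D \<le> 1 \<Longrightarrow> 0 \<le> V D A"
  unfolding V_def by (intro sum_nonneg h_nonneg its_sub)

section \<open>Large elements: the slots of one phase\<close>

lemma base_in: "run_inv A t i \<Longrightarrow> x \<in> S0 \<union> Sset A \<Longrightarrow> x \<in> its A p"
  using its_iff by blast

text \<open>The right guess is the gain of \<open>lab i\<close>, rounded down to units. Then
  \<open>lab i\<close> itself qualifies, so the lightest qualifying element is no heavier, and
  rounding costs less than one unit. With guess 0 the slot is simply left empty. The operations are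
  at most \<open>16 * L ^ 5\<close> increments, the filling, and the move to the next slot.\<close>

lemma fill:
  assumes run_inv: "run_inv A t i" and st: "steps S0 q (A, t, i, 0, D)" and q: "q + 18 * L ^ 5 \<le> NB"
    and t: "t < L" and i: "i < k" and D: "0 \<le> D" "D \<le> 1"
  shows "\<exists>A'. steps S0 (q + 18 * L ^ 5) (A', t, Suc i, 0, D) \<and> run_inv A' t (Suc i) \<and> ext A A' \<and> Sset A' = Sset A
    \<and> V D A + (mg D A (lab i) / real L - unit) \<le> V D A'"
proof -
  define r where "r = gain D A (fcell i t) (lab i)"
  define m where "m = nat \<lfloor>r / unit\<rfloor>"
  have iK: "i < K" using i k_le by simp
  have o: "lab i < n" "lab i \<in> Lg" using lab_Lg[OF i] sub_n by auto
  have z: "A (fcell i t) = 0" using run_inv iK t by (simp add: run_inv_def)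
  have rg: "mg D A (lab i) / real L \<le> r"
    using gain_fcell_ge[of "lab i" i t A D, OF o(1) iK t z D] L1 by (simp add: r_def field_simps)
  have "0 \<le> mg D A (lab i) / real L" using mg_nonneg[OF D o(1)] by simp
  with rg have r0: "0 \<le> r" by simp
  have "r \<le> (\<Sum>p<L ^ K. 2 * U)"
    unfolding r_def gain_fcell[of "lab i" i t A D, OF o(1) iK t z]
  proof (rule sum_mono)
    fix p
    have "h D (insert (lab i) (its A p)) - h D (its A p) \<le> h D (insert (lab i) {}) - h D {}"
      by (rule h_dim1[OF D]) (use its_sub o in auto)
    also have "\<dots> \<le> F {lab i}" using h_le_F[OF D, of "{lab i}"] h_nonneg[OF D, of "{}"] o by auto
    also have "\<dots> \<le> 2 * U" by (rule feasU) (use o w1 in auto)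
    finally show "(if dig L p i = t then h D (insert (lab i) (its A p)) - h D (its A p) else 0) \<le> 2 * U"
      using U0 by simp
  qed
  then have "r \<le> 16 * real L ^ 5 * unit" by (simp only: sum_2U)
  then have "r / unit \<le> 16 * real L ^ 5" using unit_pos by (simp add: field_simps)
  then have mL: "m \<le> 16 * L ^ 5"
    unfolding m_def by (metis floor_of_nat floor_mono nat_int nat_mono of_nat_mult of_nat_numeral of_nat_power)
  have mr: "real m * unit \<le> r" "r < (real m + 1) * unit"
  proof -
    have "real m = of_int \<lfloor>r / unit\<rfloor>" using r0 unit_pos by (simp add: m_def)
    then have "real m \<le> r / unit" "r / unit < real m + 1" by linarith+
    then show "real m * unit \<le> r" "r < (real m + 1) * unit" using unit_pos by (simp_all add: field_simps)
  qed
  have L5: "1 \<le> L ^ 5" using L1 by simp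
  have st': "steps S0 (q + m) (A, t, i, m, D)" using steps_incr[OF st, of m] by simp
  show ?thesis
  proof (cases "m = 0")
    case True
    have "steps S0 (Suc q) (A, t, Suc i, 0, D)"
      using steps_Suc[OF st, of 1] by (simp add: ostep_def)
    then have "steps S0 (q + 18 * L ^ 5) (A, t, Suc i, 0, D)"
      by (rule steps_mono) (use L5 in simp)
    moreover have "run_inv A t (Suc i)" using run_inv by (auto simp: run_inv_def)
    moreover have "V D A + (mg D A (lab i) / real L - unit) \<le> V D A" using rg mr(2) True by simp
    ultimately show ?thesis using ext_refl by blast
  next
    case False
    let ?c = "\<lambda>x. \<not> gain D A (fcell i t) x < real m * unit"
    have "?c (lab i)" using mr(1) by (simp add: r_def)
    then have "pickf A t i m D \<noteq> 0" using scanf_0[of ?c w n "lab i"] o(1) unfolding pickf_def by blast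
    then obtain x where x: "pickf A t i m D = Suc x" by (metis not0_implies_Suc)
    then have xp: "x < n" "?c x" "w x \<le> w (lab i)"
      using scanf_Suc[of ?c w n x] \<open>?c (lab i)\<close> o(1) unfolding pickf_def by blast+
    have "x \<notin> Os - S0"
      by (rule nocom[OF steps_mono[OF st'] iK t _ x _ z D]) (use q mL False run_inv in \<open>auto simp: run_inv_def\<close>)
    \<comment> \<open>An element present in every candidate has gain 0, but the guess demands at
      least one unit.\<close>
    moreover have "x \<notin> S0"
    proof
      assume "x \<in> S0"
      then have "insert x (its A p) = its A p" for p using base_in[OF run_inv] by blast
      then have "gain D A (fcell i t) x = 0" unfolding gain_fcell[of x i t A D, OF xp(1) iK t z] by (intro sum.neutral) simp
      then show False using xp(2) False unit_pos by simp
    qed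
    ultimately have xO: "x \<notin> Os" by blast
    let ?A = "A(fcell i t := Suc x)"
    have s1: "steps S0 (Suc (Suc (q + m))) (?A, t, Suc i, 0, D)"
      by (rule steps_Suc[OF steps_Suc[OF st', of 2 "(?A, t, i, m, D)"], of 1]) (use x iK t in \<open>auto simp: ostep_def\<close>)
    have "steps S0 (q + 18 * L ^ 5) (?A, t, Suc i, 0, D)"
      by (rule steps_mono[OF s1]) (use L5 mL in simp)
    moreover have SA: "Sset ?A = Sset A"
      using fcell_ge[of i t] by (auto simp: Sset_def scell_def)
    moreover have "run_inv ?A t (Suc i)"
    proof -
      have "base ?A = base A" "?A (Suc n) = A (Suc n)" "\<And>y. y < n \<Longrightarrow> ?A (scell y) = A (scell y)"
        using fcell_ge[of i t] by (auto simp: base_def scell_def)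
      moreover have "\<forall>j<K. \<forall>t'<L. ?A (fcell j t') = 0 \<or>
          (\<exists>x<n. ?A (fcell j t') = Suc x \<and> j < k \<and> w x \<le> w (lab j) \<and> x \<notin> Os)"
      proof (intro allI impI)
        fix j t' assume "j < K" "t' < L"
        then show "?A (fcell j t') = 0 \<or> (\<exists>x<n. ?A (fcell j t') = Suc x \<and> j < k \<and> w x \<le> w (lab j) \<and> x \<notin> Os)"
          using fcell_inj[of j i t' t] iK t xp xO i run_inv by (cases "j = i \<and> t' = t") (auto simp: run_inv_def)
      qed
      moreover have "\<forall>j<K. \<forall>t'<L. t < t' \<or> t' = t \<and> Suc i \<le> j \<longrightarrow> ?A (fcell j t') = 0"
        using fcell_inj[OF _ iK _ t] run_inv by (auto simp: run_inv_def)
      ultimately show ?thesis using run_inv SA unfolding run_inv_def by metis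
    qed
    moreover have "ext A ?A" using z by (auto simp: ext_def)
    moreover have "V D ?A = V D A + gain D A (fcell i t) x" by (simp add: gain_def)
    then have "V D A + (mg D A (lab i) / real L - unit) \<le> V D ?A"
      using rg mr xp(2) by (simp add: algebra_simps)
    ultimately show ?thesis by blast
  qed
qed

text \<open>The gains are measured at the final \<open>A'\<close>, where by \<open>mg_anti\<close>
  they are no larger than when the slots were filled; so all slots refer to one and the same
  state.\<close>

lemma slots:
  assumes run_inv: "run_inv A t 0" and st: "steps S0 q (A, t, 0, 0, D)" and q: "q + 144 * L ^ 8 \<le> NB"
    and t: "t < L" and D: "0 \<le> D" "D \<le> 1" and j: "j \<le> k"
  shows "\<exists>A'. steps S0 (q + j * (18 * L ^ 5)) (A', t, j, 0, D) \<and> run_inv A' t j \<and> ext A A' \<and> Sset A' = Sset A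
    \<and> V D A + (\<Sum>i<j. mg D A' (lab i) / real L - unit) \<le> V D A'"
  using j
proof (induction j)
  case 0
  then show ?case using run_inv st ext_refl by (intro exI[of _ A]) simp
next
  case (Suc j)
  then obtain A' where A': "steps S0 (q + j * (18 * L ^ 5)) (A', t, j, 0, D)" "run_inv A' t j" "ext A A'" "Sset A' = Sset A"
    "V D A + (\<Sum>i<j. mg D A' (lab i) / real L - unit) \<le> V D A'" by auto
  have "Suc j \<le> 8 * L ^ 3" using Suc k_le K8 by simp
  then have "Suc j * (18 * L ^ 5) \<le> 8 * L ^ 3 * (18 * L ^ 5)" by (rule mult_le_mono1)
  also have "\<dots> = 144 * L ^ 8" by (simp add: power_add[symmetric])
  finally have "q + j * (18 * L ^ 5) + 18 * L ^ 5 \<le> NB" using q by simp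
  from fill[OF A'(2,1) this t _ D] Suc.prems obtain A'' where A'':
    "steps S0 (q + j * (18 * L ^ 5) + 18 * L ^ 5) (A'', t, Suc j, 0, D)" "run_inv A'' t (Suc j)" "ext A' A''"
    "Sset A'' = Sset A'" "V D A' + (mg D A' (lab j) / real L - unit) \<le> V D A''" by auto
  have le: "mg D A'' (lab i) / real L \<le> mg D A' (lab i) / real L" if "i < Suc j" for i
    by (intro divide_right_mono mg_anti[OF D A''(3)]) (use that Suc.prems lab_n in auto)
  have "V D A + (\<Sum>i<Suc j. mg D A'' (lab i) / real L - unit) \<le> V D A + (\<Sum>i<Suc j. mg D A' (lab i) / real L - unit)"
    by (intro add_left_mono sum_mono diff_right_mono le) simp
  also have "\<dots> \<le> V D A''" using A'(5) A''(5) by simp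
  finally show ?case using A'' A' ext_trans[OF A'(3) A''(3)]
    by (intro exI[of _ A'']) (simp add: algebra_simps)
qed

end

section \<open>Small elements: greedy picks by density\<close>

context slot_run
begin

lemma its_bs: "its (bs S0) p = S0"
  by (rule its_bs'[OF sub_n(1)])

text \<open>Smallness was tested at \<open>S0\<close> with distortion \<open>a0\<close>. Diminishing
  returns carry it over to larger candidates, and \<open>a0 \<ge> 1 / 4\<close> to every other
  distortion at the price of a factor 4.\<close>

lemma small_gain:
  assumes "x < n" "gain a0 (bs S0) (scell x) x < thr" "\<And>p. S0 \<subseteq> its A p" "0 \<le> D" "D \<le> 1"
  shows "mg D A x \<le> 4 * thr"
proof (cases "x \<in> S0")
  case True
  then have "mg D A x = 0" using assms(3) mg_zero[OF assms(4,5)] by blast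
  then show ?thesis using thr_pos by simp
next
  case False
  let ?\<delta> = "F (insert x S0) - F S0"
  have a0: "0 \<le> a0" "a0 \<le> 1" "1 \<le> 4 * a0" using a0_bounds by auto
  have "bs S0 (scell x) = 0"
    using sub_n by (auto simp: bs_def scell_def)
  then have "gain a0 (bs S0) (scell x) x = mg a0 (bs S0) x"
    using assms(1) by (intro gain_scell) (auto simp: scell_def)
  also have "\<dots> = NF * (h a0 (insert x S0) - h a0 S0)"
    by (simp add: mg_def its_bs)
  finally have "NF * (h a0 (insert x S0) - h a0 S0) < thr" using assms(2) by simp
  moreover have "NF * (a0 * ?\<delta>) \<le> NF * (h a0 (insert x S0) - h a0 S0)"
    by (rule mult_left_mono[OF h_diff_ge[OF a0(1,2)]]) (use sub_n assms(1) in auto)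
  ultimately have *: "a0 * (NF * ?\<delta>) < thr" by (simp add: algebra_simps)
  have "0 \<le> ?\<delta>" using mono[of S0 "insert x S0"] sub_n assms(1) by auto
  then have "0 \<le> NF * ?\<delta>" by simp
  then have "1 * (NF * ?\<delta>) \<le> 4 * a0 * (NF * ?\<delta>)" using a0(3) by (intro mult_right_mono)
  with * have d: "NF * ?\<delta> \<le> 4 * thr" by simp
  have "mg D A x \<le> (\<Sum>p<L ^ K. ?\<delta>)"
    unfolding mg_def
  proof (rule sum_mono)
    fix p
    have "h D (insert x (its A p)) - h D (its A p) \<le> h D (insert x S0) - h D S0"
      by (rule h_dim1[OF assms(4,5) assms(3) its_sub assms(1)])
    also have "\<dots> \<le> ?\<delta>"
      by (rule h_diff_le[OF assms(4,5)]) (use sub_n assms(1) in auto)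
    finally show "h D (insert x (its A p)) - h D (its A p) \<le> ?\<delta>" .
  qed
  then show ?thesis using d by simp
qed

definition Yset :: "(nat \<Rightarrow> nat) \<Rightarrow> (nat \<Rightarrow> nat) \<Rightarrow> nat set" where
  "Yset A B = (Sset B - Sset A) \<inter> Sm"

definition Xset :: "(nat \<Rightarrow> nat) \<Rightarrow> (nat \<Rightarrow> nat) \<Rightarrow> nat set" where
  "Xset A B = (Sset B - Sset A) - Sm"

text \<open>Gain of the small items picked so far, with a part \<open>\<theta>\<close> of the linear value of the picked optimal
  items set aside.\<close>

definition net :: "real \<Rightarrow> real \<Rightarrow> (nat \<Rightarrow> nat) \<Rightarrow> (nat \<Rightarrow> nat) \<Rightarrow> real" where
  "net D \<theta> A B = V D B - V D A - \<theta> * NF * sum ell (Yset A B)"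

text \<open>The inequality compares densities: net gain per charged weight is at least the density
  of any small element of \<open>Os\<close> still missing. Picks from \<open>Os\<close> are charged
  only \<open>1 - \<theta>\<close> of their weight, since \<open>wt\<close> had already reserved the
  share \<open>\<theta>\<close>.\<close>

definition pick_inv :: "real \<Rightarrow> real \<Rightarrow> nat \<Rightarrow> (nat \<Rightarrow> nat) \<Rightarrow> (nat \<Rightarrow> nat) \<Rightarrow> bool" where
  "pick_inv D \<theta> t A B \<longleftrightarrow> run_inv B t k \<and> ext A B \<and> 0 \<le> net D \<theta> A B
     \<and> (\<forall>y\<in>Sm - Sset B. (sum w (Xset A B) + (1 - \<theta>) * sum w (Yset A B)) * mg D B y \<le> net D \<theta> A B * w y)"

lemma ext_Sset: "ext A B \<Longrightarrow> Sset A \<subseteq> Sset B"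
  by (auto simp: ext_def Sset_def) (metis Zero_not_Suc)

lemma pick_inv_refl: "run_inv A t k \<Longrightarrow> pick_inv D \<theta> t A A"
  by (simp add: pick_inv_def ext_refl net_def Yset_def Xset_def)

context
  fixes D \<theta> :: real and t :: nat and A :: "nat \<Rightarrow> nat"
  assumes D: "0 \<le> D" "D \<le> 1" and th: "0 \<le> \<theta>" "\<theta> \<le> 1"
begin

text \<open>The pick has the best density among the eligible elements, so it adds net gain and
  charged weight in at least the ratio offered by any missing \<open>y\<close>. Marginals of the
  others only fall, hence the density inequality survives.\<close>

lemma pick:
  assumes J: "pick_inv D \<theta> t A B" and x: "picks B D = Suc x"
  defines "B' \<equiv> B(Suc n + picks B D := picks B D)"
  shows "pick_inv D \<theta> t A B'" "Sset B' = insert x (Sset B)" "x \<notin> Sset B" "V D B' - V D B = gain D B (scell x) x"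
    "0 < V D B' - V D B" "V D B' - V D B \<le> 4 * thr" "ext B B'"
proof -
  have run_inv: "run_inv B t k" using J by (simp add: pick_inv_def)
  have bB: "base B = bs S0" using run_inv by (simp add: run_inv_def)
  let ?c = "\<lambda>x. gain a0 (base B) (scell x) x < thr \<and> 0 < gain D B (scell x) x"
  have xp: "x < n" "gain a0 (bs S0) (scell x) x < thr" "0 < gain D B (scell x) x"
    and best: "\<And>y. y < n \<Longrightarrow> ?c y \<Longrightarrow> w x / gain D B (scell x) x \<le> w y / gain D B (scell y) y"
    using scanf_Suc[of ?c "\<lambda>x. w x / gain D B (scell x) x" n x] x bB by (auto simp: picks_def)
  have gm: "gain D B (scell y) y = mg D B y" if "y < n" for y
    by (rule gain_scell) (use that run_inv in \<open>auto simp: run_inv_def scell_def\<close>)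
  have B': "B' = B(scell x := Suc x)" by (simp add: B'_def x scell_def)
  show V: "V D B' - V D B = gain D B (scell x) x" by (simp add: B' gain_def)
  then have Vm: "V D B' - V D B = mg D B x" by (simp add: gm xp(1))
  show "0 < V D B' - V D B" using V xp(3) by simp
  then have mpos: "0 < mg D B x" using Vm by simp
  have xn: "x \<notin> S0 \<union> Sset B"
  proof
    assume "x \<in> S0 \<union> Sset B"
    then have "mg D B x = 0" using base_in[OF run_inv] by (intro mg_zero[OF D])
    then show False using mpos by simp
  qed
  then show "x \<notin> Sset B" by simp
  then have "B (scell x) \<noteq> Suc x" using xp(1) by (simp add: Sset_def)
  then have z: "B (scell x) = 0" using run_inv xp(1) by (auto simp: run_inv_def)
  show e: "ext B B'" using z by (auto simp: ext_def B')
  have Sx: "Sset B' = insert x (Sset B)"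
    using xp(1) by (auto simp: Sset_def B' scell_def)
  then show "Sset B' = insert x (Sset B)" .
  show "V D B' - V D B \<le> 4 * thr"
    unfolding Vm by (rule small_gain[OF xp(1,2) _ D]) (use base_in[OF run_inv] in blast)
  have xL: "x \<notin> Lg" using xp(2) by (simp add: Lg_def large_def)
  have fc: "fcell j t' \<noteq> scell x" for j t'
    using fcell_ge[of j t'] xp(1) by (simp add: scell_def)
  have run_inv': "run_inv B' t k"
  proof -
    have "base B' = base B" by (auto simp: base_def B' scell_def)
    moreover have "B' (Suc n) = B (Suc n)" by (simp add: B' scell_def)
    moreover have "\<forall>y<n. B' (scell y) = 0 \<or> B' (scell y) = Suc y"
      using run_inv by (auto simp: B' scell_def run_inv_def)
    moreover have "Sset B' \<inter> (S0 \<union> Lg) = {}" using run_inv xn xL by (auto simp: Sx run_inv_def)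
    moreover have "B' (fcell j t') = B (fcell j t')" for j t' using fc by (simp add: B')
    ultimately show ?thesis using run_inv by (simp add: run_inv_def)
  qed
  have ext: "ext A B" using J by (simp add: pick_inv_def)
  have xA: "x \<notin> Sset A" using ext_Sset[OF ext] xn by blast
  have xits: "x \<notin> its B p" if "x \<in> Sm" for p
    using its_Os[OF run_inv, of p] that xn by blast
  let ?c = "sum w (Xset A B) + (1 - \<theta>) * sum w (Yset A B)"
  let ?c' = "sum w (Xset A B') + (1 - \<theta>) * sum w (Yset A B')"
  have c0: "0 \<le> ?c" unfolding Xset_def Yset_def
    using th by (intro add_nonneg_nonneg mult_nonneg_nonneg sum_nonneg w0) (auto simp: Sset_def)
  \<comment> \<open>The share of the pick that counts in this phase, in weight and in gain alike.
    For a pick from \<open>Os\<close> the amount \<open>\<theta> * ell x\<close> is set aside per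
    candidate; as the gain is at least \<open>ell x\<close>, the share \<open>1 - \<theta>\<close>
    of the gain remains.\<close>
  define \<rho> where "\<rho> = (if x \<in> Sm then 1 - \<theta> else 1)"
  have rho: "0 \<le> \<rho>" using th by (simp add: \<rho>_def)
  have fX: "finite (Xset A B)" "finite (Yset A B)" using finS by (auto simp: Xset_def Yset_def)
  have cc: "?c' = ?c + \<rho> * w x"
  proof (cases "x \<in> Sm")
    case True
    then have "Xset A B' = Xset A B" "Yset A B' = insert x (Yset A B)" "x \<notin> Yset A B"
      using xA xn by (auto simp: Xset_def Yset_def Sx)
    then show ?thesis using True fX by (simp add: \<rho>_def algebra_simps)
  next
    case False
    then have "Xset A B' = insert x (Xset A B)" "Yset A B' = Yset A B" "x \<notin> Xset A B"
      using xA xn by (auto simp: Xset_def Yset_def Sx)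
    then show ?thesis using False fX by (simp add: \<rho>_def)
  qed
  have net: "net D \<theta> A B + \<rho> * mg D B x \<le> net D \<theta> A B'"
  proof (cases "x \<in> Sm")
    case True
    then have Y: "Yset A B' = insert x (Yset A B)" "x \<notin> Yset A B"
      using xA xn by (auto simp: Yset_def Sx)
    have "NF * ell x \<le> mg D B x" by (rule mg_ge_ell[OF D xp(1) xits[OF True]])
    then have "\<theta> * (NF * ell x) \<le> \<theta> * mg D B x" using th by (intro mult_left_mono)
    then show ?thesis using True Y fX Vm by (simp add: net_def \<rho>_def algebra_simps)
  next
    case False
    then have Y: "Yset A B' = Yset A B" by (auto simp: Yset_def Sx)
    then show ?thesis using False Vm by (simp add: net_def \<rho>_def)
  qed
  have "?c' * mg D B' y \<le> net D \<theta> A B' * w y" if y: "y \<in> Sm - Sset B'" for y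
  proof -
    have on: "y < n" "y \<in> Sm - Sset B" using y sub_n Sx by auto
    have wo: "0 \<le> w y" "0 \<le> w x" using w0 on xp by auto
    have 1: "w x * mg D B y \<le> mg D B x * w y"
    proof (cases "0 < mg D B y")
      case True
      have "gain a0 (base B) (scell y) y < thr" using on(2) bB by (auto simp: Sm_def large_def)
      then have "w x / mg D B x \<le> w y / mg D B y"
        using best[of y] on(1) True by (simp add: gm xp(1))
      then show ?thesis using True mpos by (simp add: field_simps)
    next
      case False
      then have "w x * mg D B y \<le> 0" using wo by (intro mult_nonneg_nonpos) auto
      then show ?thesis using mpos wo by (meson mult_nonneg_nonneg less_imp_le order_trans)
    qed
    have "?c' * mg D B' y \<le> ?c' * mg D B y"
      by (rule mult_left_mono[OF mg_anti[OF D e on(1)]]) (use c0 rho wo in \<open>simp add: cc\<close>)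
    also have "\<dots> = ?c * mg D B y + \<rho> * (w x * mg D B y)"
      by (simp only: cc distrib_right mult.assoc)
    also have "\<dots> \<le> net D \<theta> A B * w y + \<rho> * (mg D B x * w y)"
      by (intro add_mono mult_left_mono 1 rho) (use J on(2) in \<open>simp add: pick_inv_def\<close>)
    also have "\<dots> = (net D \<theta> A B + \<rho> * mg D B x) * w y" by (simp add: algebra_simps)
    also have "\<dots> \<le> net D \<theta> A B' * w y" by (rule mult_right_mono[OF net wo(1)])
    finally show ?thesis .
  qed
  moreover have "0 \<le> net D \<theta> A B'"
  proof -
    have "0 \<le> net D \<theta> A B" using J by (simp add: pick_inv_def)
    moreover have "0 \<le> \<rho> * mg D B x" using rho mpos by simp
    ultimately show ?thesis using net by linarith
  qed
  ultimately show "pick_inv D \<theta> t A B'" using run_inv' ext_trans[OF ext e] by (simp add: pick_inv_def)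
qed

text \<open>The counting alternative records that an unfinished chunk has picked at least
  \<open>j\<close> different elements after \<open>j\<close> rounds. The last conjunct bounds the
  one pick by which a chunk may overshoot.\<close>

lemma psteps:
  assumes J: "pick_inv D \<theta> t A B"
  defines "P \<equiv> \<lambda>j. (pstep D ^^ j) (B, 0)"
  shows "pick_inv D \<theta> t A (fst (P j)) \<and> ext B (fst (P j)) \<and> snd (P j) = V D (fst (P j)) - V D B
    \<and> (unit \<le> snd (P j) \<or> picks (fst (P j)) D = 0 \<or> j \<le> card (Sset (fst (P j))))
    \<and> (fst (P (Suc j)) = fst (P j) \<or> snd (P j) < unit \<and> V D (fst (P (Suc j))) - V D (fst (P j)) \<le> 4 * thr)"
proof (induction j)
  have nxt: "fst (P (Suc j)) = fst (P j) \<and> snd (P (Suc j)) = snd (P j)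
      \<and> (unit \<le> snd (P j) \<or> picks (fst (P j)) D = 0)
    \<or> snd (P j) < unit \<and> (\<exists>x. picks (fst (P j)) D = Suc x) \<and>
       fst (P (Suc j)) = (fst (P j))(Suc n + picks (fst (P j)) D := picks (fst (P j)) D) \<and>
       snd (P (Suc j)) = snd (P j) + gain D (fst (P j)) (scell (picks (fst (P j)) D - 1)) (picks (fst (P j)) D - 1)"
    if "pick_inv D \<theta> t A (fst (P j))" for j
  proof -
    have z: "(fst (P j)) (Suc n) = 0" using that by (simp add: pick_inv_def run_inv_def)
    then have z': "(fst (P j))(Suc n := 0) = fst (P j)" by (metis fun_upd_triv)
    have "P (Suc j) = pstep D (P j)" by (simp add: P_def)
    then show ?thesis using z' by (cases "picks (fst (P j)) D") (auto simp: pstep_def split_beta)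
  qed
  {
    case 0
    have P0: "P 0 = (B, 0)" by (simp add: P_def)
    show ?case using nxt[of 0] J pick(5,6)[OF J] unfolding P0 by (auto simp: ext_refl)
  next
    case (Suc j)
    then have Jj: "pick_inv D \<theta> t A (fst (P j))" and ej: "ext B (fst (P j))" and aj: "snd (P j) = V D (fst (P j)) - V D B"
      and cj: "unit \<le> snd (P j) \<or> picks (fst (P j)) D = 0 \<or> j \<le> card (Sset (fst (P j)))" by auto
    have main: "pick_inv D \<theta> t A (fst (P (Suc j))) \<and> ext B (fst (P (Suc j))) \<and> snd (P (Suc j)) = V D (fst (P (Suc j))) - V D B
      \<and> (unit \<le> snd (P (Suc j)) \<or> picks (fst (P (Suc j))) D = 0 \<or> Suc j \<le> card (Sset (fst (P (Suc j)))))"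
      using nxt[OF Jj]
    proof (elim disjE conjE exE)
      assume "fst (P (Suc j)) = fst (P j)" "snd (P (Suc j)) = snd (P j)" "unit \<le> snd (P j)"
      then show ?thesis using Jj ej aj by simp
    next
      assume "fst (P (Suc j)) = fst (P j)" "snd (P (Suc j)) = snd (P j)" "picks (fst (P j)) D = 0"
      then show ?thesis using Jj ej aj by simp
    next
      fix x assume a: "snd (P j) < unit" "picks (fst (P j)) D = Suc x"
        "fst (P (Suc j)) = (fst (P j))(Suc n + picks (fst (P j)) D := picks (fst (P j)) D)"
        "snd (P (Suc j)) = snd (P j) + gain D (fst (P j)) (scell (picks (fst (P j)) D - 1)) (picks (fst (P j)) D - 1)"
      note p = pick[OF Jj a(2), folded a(3)]
      have "j \<le> card (Sset (fst (P j)))" using cj a by auto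
      then have "Suc j \<le> card (Sset (fst (P (Suc j))))" using p(2,3) finS by simp
      then show ?thesis using p ext_trans[OF ej p(7)] a aj by simp
    qed
    then have "fst (P (Suc (Suc j))) = fst (P (Suc j)) \<or>
       snd (P (Suc j)) < unit \<and> V D (fst (P (Suc (Suc j)))) - V D (fst (P (Suc j))) \<le> 4 * thr"
      using nxt[of "Suc j"] pick(6)[of "fst (P (Suc j))"] by auto
    with main show ?case by blast
  }
qed

text \<open>If \<open>n\<close> rounds neither collected a unit nor ran out of candidates for
  picking, all \<open>n\<close> elements would have been picked, and yet \<open>picks\<close> would
  still offer a new one.\<close>

lemma chunk:
  assumes J: "pick_inv D \<theta> t A B"
  shows "pick_inv D \<theta> t A (chunk D B)" "ext B (chunk D B)"
    "unit \<le> V D (chunk D B) - V D B \<or> picks (chunk D B) D = 0"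
proof -
  note p = psteps[OF J, of n, folded chunk_def]
  show J': "pick_inv D \<theta> t A (chunk D B)" "ext B (chunk D B)" using p by simp_all
  show "unit \<le> V D (chunk D B) - V D B \<or> picks (chunk D B) D = 0"
  proof (rule disjCI)
    assume ne: "picks (chunk D B) D \<noteq> 0"
    show "unit \<le> V D (chunk D B) - V D B"
    proof (rule ccontr)
      assume "\<not> ?thesis"
      moreover have "snd ((pstep D ^^ n) (B, 0)) = V D (chunk D B) - V D B"
        "unit \<le> snd ((pstep D ^^ n) (B, 0)) \<or> picks (chunk D B) D = 0 \<or> n \<le> card (Sset (chunk D B))"
        using p by blast+
      ultimately have "n \<le> card (Sset (chunk D B))" using ne by auto
      then have "Sset (chunk D B) = {..<n}"
        using sub_n(4)[of "chunk D B"] by (intro card_seteq) auto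
      moreover obtain x where x: "picks (chunk D B) D = Suc x" using ne not0_implies_Suc by blast
      moreover have "x < n" using scanf_Suc[of _ _ n x] x unfolding picks_def by blast
      ultimately show False using pick(3)[OF J'(1) x] by simp
    qed
  qed
qed

text \<open>The weight budget may run out inside a chunk. The state \<open>B'\<close> right after
  the crossing pick serves only as a witness for the density comparison; the run itself keeps the
  feasible \<open>B\<close>, whose value is lower by at most \<open>unit + 4 * thr\<close>.\<close>

lemma chunk_cross:
  assumes J: "pick_inv D \<theta> t A B" and w1: "wt \<theta>' B" and w2: "\<not> wt \<theta>' (chunk D B)"
  shows "\<exists>B'. pick_inv D \<theta> t A B' \<and> ext B B' \<and> \<not> wt \<theta>' B' \<and> V D B' - V D B \<le> unit + 4 * thr"
proof -
  let ?P = "\<lambda>j. (pstep D ^^ j) (B, 0)"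
  have "\<exists>j. wt \<theta>' (fst (?P j)) \<and> \<not> wt \<theta>' (fst (?P (Suc j)))"
  proof (rule ccontr)
    assume "\<not> ?thesis"
    then have "wt \<theta>' (fst (?P j))" for j
    proof (induction j)
      case 0
      then show ?case using w1 by simp
    qed blast
    then show False using w2 by (simp add: chunk_def)
  qed
  then obtain j where j: "wt \<theta>' (fst (?P j))" "\<not> wt \<theta>' (fst (?P (Suc j)))" by blast
  then have ne: "fst (?P (Suc j)) \<noteq> fst (?P j)" by auto
  have Pj: "fst (?P (Suc j)) = fst (?P j) \<or> snd (?P j) < unit \<and> V D (fst (?P (Suc j))) - V D (fst (?P j)) \<le> 4 * thr"
    "snd (?P j) = V D (fst (?P j)) - V D B"
    using psteps[OF J, of j] by blast+
  have PS: "pick_inv D \<theta> t A (fst (?P (Suc j)))" "ext B (fst (?P (Suc j)))"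
    using psteps[OF J, of "Suc j"] by blast+
  have "V D (fst (?P (Suc j))) - V D B \<le> unit + 4 * thr"
    using Pj ne by auto
  then show ?thesis using PS j(2) by blast
qed

text \<open>At the moment when the weight budget of the phase is exhausted, the picked items have paid for a
  fraction \<open>1 / L\<close> of the remaining small items of the optimum.\<close>

lemma stop:
  assumes J: "pick_inv D \<theta> t A B" and wA: "wt \<theta> A"
    and B: "\<not> wt (\<theta> - 1 / real L) B \<or> picks B D = 0"
  shows "(\<Sum>y\<in>Sm - Sset B. mg D B y) \<le> real L * net D \<theta> A B"
proof (cases "picks B D = 0")
  case True
  have run_inv: "run_inv B t k" and bB: "base B = bs S0" using J by (auto simp: pick_inv_def run_inv_def)
  have "mg D B y \<le> 0" if "y \<in> Sm - Sset B" for y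
  proof -
    have y: "y < n" using that sub_n by auto
    have "gain D B (scell y) y = mg D B y"
      by (rule gain_scell) (use y run_inv in \<open>auto simp: run_inv_def scell_def\<close>)
    moreover have "gain a0 (base B) (scell y) y < thr"
      using that bB by (auto simp: Sm_def large_def)
    ultimately show ?thesis
      using scanf_0[OF True[unfolded picks_def] y] by simp
  qed
  then have "(\<Sum>y\<in>Sm - Sset B. mg D B y) \<le> 0" by (rule sum_nonpos)
  moreover have "0 \<le> real L * net D \<theta> A B" using J by (simp add: pick_inv_def)
  ultimately show ?thesis by linarith
next
  case False
  let ?R = "Sm - Sset B"
  let ?c = "sum w (Xset A B) + (1 - \<theta>) * sum w (Yset A B)"
  have sub: "Sset A \<subseteq> Sset B" using J ext_Sset by (simp add: pick_inv_def)
  have fX: "finite (Xset A B)" "finite (Yset A B)" "finite ?R" using finS fin by (auto simp: Xset_def Yset_def)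
  have "Sset B = Sset A \<union> (Xset A B \<union> Yset A B)" using sub by (auto simp: Xset_def Yset_def)
  moreover have "sum w (Sset A \<union> (Xset A B \<union> Yset A B)) = sum w (Sset A) + sum w (Xset A B \<union> Yset A B)"
    by (rule sum.union_disjoint) (use fX finS in \<open>auto simp: Xset_def Yset_def\<close>)
  moreover have "sum w (Xset A B \<union> Yset A B) = sum w (Xset A B) + sum w (Yset A B)"
    by (rule sum.union_disjoint) (use fX finS in \<open>auto simp: Xset_def Yset_def\<close>)
  ultimately have SB: "sum w (Sset B) = sum w (Sset A) + sum w (Xset A B) + sum w (Yset A B)" by simp
  have "Sm - Sset A = ?R \<union> Yset A B" using sub by (auto simp: Yset_def)
  moreover have "sum w (?R \<union> Yset A B) = sum w ?R + sum w (Yset A B)"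
    by (rule sum.union_disjoint) (use fX in \<open>auto simp: Yset_def\<close>)
  ultimately have RA: "sum w (Sm - Sset A) = sum w ?R + sum w (Yset A B)" by simp
  \<comment> \<open>The budget holds at \<open>A\<close> with \<open>\<theta>\<close> and fails at
    \<open>B\<close> with \<open>\<theta> - 1 / L\<close>. Subtracting the two shows that the
    charged weight exceeds \<open>1 / L\<close> of the weight still missing.\<close>
  have "sum w (Sset A) + \<theta> * sum w (Sm - Sset A) < sum w (Sset B) + (\<theta> - 1 / real L) * sum w ?R"
    using wA B False by (simp add: wt_def)
  then have c: "sum w ?R / real L < ?c" unfolding SB RA by (simp add: algebra_simps)
  have wR: "0 \<le> sum w ?R" using sub_n w0 by (intro sum_nonneg) auto
  have Rn: "y < n" if "y \<in> ?R" for y using that sub_n by auto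
  have H: "?c * (\<Sum>y\<in>?R. mg D B y) \<le> net D \<theta> A B * sum w ?R"
    unfolding sum_distrib_left[of ?c] sum_distrib_left[of "net D \<theta> A B"]
    using J by (intro sum_mono) (simp add: pick_inv_def)
  have m0: "0 \<le> (\<Sum>y\<in>?R. mg D B y)" using Rn mg_nonneg[OF D] by (intro sum_nonneg) auto
  show ?thesis
  \<comment> \<open>If the missing elements weigh nothing, their weight cannot be cancelled; but
    then the charged weight is positive and \<open>H\<close> makes their total gain at most
    0.\<close>
  proof (cases "sum w ?R = 0")
    case True
    then have "?c * (\<Sum>y\<in>?R. mg D B y) \<le> 0" "0 < ?c" using H c by auto
    then have "(\<Sum>y\<in>?R. mg D B y) \<le> 0" by (simp add: mult_le_0_iff)
    moreover have "0 \<le> real L * net D \<theta> A B" using J by (simp add: pick_inv_def)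
    ultimately show ?thesis by linarith
  next
    case False
    then have pos: "0 < sum w ?R" using wR by simp
    have "sum w ?R / real L * (\<Sum>y\<in>?R. mg D B y) \<le> ?c * (\<Sum>y\<in>?R. mg D B y)"
      using c m0 by (intro mult_right_mono) auto
    with H have "sum w ?R / real L * (\<Sum>y\<in>?R. mg D B y) \<le> sum w ?R * net D \<theta> A B" by (simp add: mult.commute)
    then have "sum w ?R * (\<Sum>y\<in>?R. mg D B y) \<le> sum w ?R * (real L * net D \<theta> A B)"
      using L1 by (simp add: field_simps)
    then show ?thesis using pos by simp
  qed
qed

text \<open>A chunk that neither crosses the budget nor runs dry adds a unit to \<open>V\<close>,
  which \<open>V_le\<close> caps. So the number of chunks is a bounded guess, expressed by repeating
  operation 3.\<close>

lemma chunks: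
  assumes run_inv: "run_inv A t k" and wA: "wt \<theta>' A" and th': "0 \<le> \<theta>'"
  shows "\<exists>v B B'. v \<le> 16 * L ^ 5 + 1 \<and> B = (chunk D ^^ v) A \<and> pick_inv D \<theta> t A B \<and> wt \<theta>' B \<and>
    pick_inv D \<theta> t A B' \<and> ext B B' \<and> V D B' - V D B \<le> unit + 4 * thr \<and> (\<not> wt \<theta>' B' \<or> picks B' D = 0)"
    (is "\<exists>v B B'. ?P v B B'")
proof (rule ccontr)
  assume no: "\<not> ?thesis"
  let ?B = "\<lambda>v. (chunk D ^^ v) A"
  have "pick_inv D \<theta> t A (?B v) \<and> wt \<theta>' (?B v) \<and> real v * unit \<le> V D (?B v) - V D A" if "v \<le> 16 * L ^ 5 + 1" for v
    using that
  proof (induction v)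
    case 0
    then show ?case using pick_inv_refl[OF run_inv] wA by simp
  next
    case (Suc v)
    then have Jv: "pick_inv D \<theta> t A (?B v)" and wv: "wt \<theta>' (?B v)" and Vv: "real v * unit \<le> V D (?B v) - V D A" by auto
    have BS: "?B (Suc v) = chunk D (?B v)" by simp
    have JS: "pick_inv D \<theta> t A (?B (Suc v))" unfolding BS by (rule chunk(1)[OF Jv])
    have w: "wt \<theta>' (?B (Suc v))"
    proof (rule ccontr)
      assume "\<not> ?thesis"
      then obtain B' where "pick_inv D \<theta> t A B'" "ext (?B v) B'" "\<not> wt \<theta>' B'" "V D B' - V D (?B v) \<le> unit + 4 * thr"
        using chunk_cross[OF Jv wv] BS by auto
      then have "?P v (?B v) B'" using Suc.prems Jv wv by simp
      then show False using no by blast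
    qed
    have "picks (?B (Suc v)) D \<noteq> 0"
    proof
      assume "picks (?B (Suc v)) D = 0"
      then have "?P (Suc v) (?B (Suc v)) (?B (Suc v))"
        using Suc.prems JS w ext_refl unit_pos thr_pos by simp
      then show False using no by blast
    qed
    then have "unit \<le> V D (?B (Suc v)) - V D (?B v)" using chunk(3)[OF Jv] BS by auto
    then show ?case using JS w Vv by (simp add: algebra_simps)
  qed
  from this[of "16 * L ^ 5 + 1"] have J1: "run_inv (?B (16 * L ^ 5 + 1)) t k" "wt \<theta>' (?B (16 * L ^ 5 + 1))"
    "real (16 * L ^ 5 + 1) * unit \<le> V D (?B (16 * L ^ 5 + 1)) - V D A" by (auto simp only: pick_inv_def)
  have "V D (?B (16 * L ^ 5 + 1)) \<le> 16 * real L ^ 5 * unit"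
    by (rule V_le[OF J1(1,2) th' D])
  then show False using J1(3) V_nonneg[OF D, of A] unit_pos by (simp add: algebra_simps)
qed

end

end

section \<open>Growth of the potential over the phases\<close>

context slot_run
begin

text \<open>
  The potential of the analysis: the distorted value, plus the linear value of the missing part
  of \<open>Os\<close> discounted by the remaining time. It starts at \<open>\<ell>(Os)\<close> at least, grows by
  \<open>a t / L\<close> times \<open>g(Os)\<close> in phase \<open>t\<close>, and ends as the value of the candidates.
\<close>

definition Psi :: "nat \<Rightarrow> (nat \<Rightarrow> nat) \<Rightarrow> real" where
  "Psi t A = V (a t) A - a t * NF * F {} + (1 - real t / real L) * NF * sum ell (Lg \<union> (Sm - Sset A))"

definition gpart :: "nat set \<Rightarrow> real" where "gpart X = F X - sum ell X"

lemma h_gpart: "h D X = D * gpart X + sum ell X"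
  by (simp add: h_def gpart_def algebra_simps)

lemma V_a_Suc: "V (a (Suc t)) B = V (a t) B + a t / real L * (\<Sum>p<L ^ K. gpart (its B p))"
proof -
  have "h (a (Suc t)) X = h (a t) X + a t / real L * gpart X" for X
    using a_Suc_diff[of t] by (simp add: h_gpart algebra_simps)
  then show ?thesis by (simp add: V_def sum.distrib sum_distrib_left)
qed

lemma gpart_mono: "X \<subseteq> Y \<Longrightarrow> Y \<subseteq> {..<n} \<Longrightarrow> gpart X \<le> gpart Y"
  using sum_ell_le[of X Y] by (simp add: gpart_def)

definition gap :: "real \<Rightarrow> (nat \<Rightarrow> nat) \<Rightarrow> real" where
  "gap D B = (\<Sum>p<L ^ K. h D (its B p \<union> Os) - h D (its B p))"

text \<open>One side of the usual sandwich: \<open>gpart\<close> is monotone, so adding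
  \<open>Os\<close> lifts it at least to \<open>gpart Os\<close>, while the linear part grows by
  exactly what is missing. \<open>gap_le\<close> is the other side, by subadditivity.\<close>

lemma gap_ge:
  assumes "run_inv B t i" "0 \<le> D"
  shows "D * (NF * gpart Os - (\<Sum>p<L ^ K. gpart (its B p))) + NF * sum ell (Lg \<union> (Sm - Sset B)) \<le> gap D B"
proof -
  have "(\<Sum>p<L ^ K. D * (gpart Os - gpart (its B p)) + sum ell (Lg \<union> (Sm - Sset B))) \<le> gap D B"
    unfolding gap_def
  proof (rule sum_mono)
    fix p
    have "gpart Os \<le> gpart (its B p \<union> Os)" by (rule gpart_mono) (use its_sub Os in auto)
    then have "D * (gpart Os - gpart (its B p)) \<le> D * (gpart (its B p \<union> Os) - gpart (its B p))"
      using assms(2) by (intro mult_left_mono) auto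
    moreover have "sum ell (its B p \<union> Os) = sum ell (its B p) + sum ell (Lg \<union> (Sm - Sset B))"
      using sum_ell_Un[OF its_sub Os, of B p] its_Os[OF assms(1)] by simp
    ultimately show "D * (gpart Os - gpart (its B p)) + sum ell (Lg \<union> (Sm - Sset B))
        \<le> h D (its B p \<union> Os) - h D (its B p)"
      by (simp add: h_gpart algebra_simps)
  qed
  then show ?thesis by (simp add: sum.distrib sum_subtractf sum_distrib_left[symmetric] right_diff_distrib algebra_simps)
qed

lemma gap_le:
  assumes "run_inv B t i" "0 \<le> D" "D \<le> 1"
  shows "gap D B \<le> (\<Sum>y\<in>Lg. mg D B y) + (\<Sum>y\<in>Sm - Sset B. mg D B y)"
proof -
  let ?R = "Lg \<union> (Sm - Sset B)"
  have fR: "finite ?R" using fin by simp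
  have "gap D B \<le> (\<Sum>p<L ^ K. \<Sum>y\<in>?R. h D (insert y (its B p)) - h D (its B p))"
    unfolding gap_def
  proof (rule sum_mono)
    fix p
    have "its B p \<union> Os = its B p \<union> ?R" using its_Os[OF assms(1), of p] by blast
    moreover have "h D (its B p \<union> ?R) - h D (its B p) \<le> (\<Sum>y\<in>?R. h D (insert y (its B p)) - h D (its B p))"
      by (rule h_subadd[OF assms(2,3) fR its_sub]) (use sub_n in auto)
    ultimately show "h D (its B p \<union> Os) - h D (its B p) \<le> (\<Sum>y\<in>?R. h D (insert y (its B p)) - h D (its B p))"
      by simp
  qed
  also have "\<dots> = (\<Sum>y\<in>?R. mg D B y)"
    unfolding mg_def by (rule sum.swap)
  also have "\<dots> = (\<Sum>y\<in>Lg. mg D B y) + (\<Sum>y\<in>Sm - Sset B. mg D B y)"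
    by (rule sum.union_disjoint) (use fin Os_split in auto)
  finally show ?thesis .
qed

text \<open>Carries the estimate of the gap from the witness \<open>B'\<close> back to the state
  \<open>B\<close> of the run.\<close>

lemma gap_ext:
  assumes "ext B B'" "0 \<le> D" "D \<le> 1"
  shows "gap D B \<le> gap D B' + (V D B' - V D B)"
proof -
  have "(\<Sum>p<L ^ K. h D (its B p \<union> Os)) \<le> (\<Sum>p<L ^ K. h D (its B' p \<union> Os))"
    by (intro sum_mono h_mono[OF assms(2,3)]) (use ext_its[OF assms(1)] its_sub Os in auto)
  then show ?thesis by (simp add: gap_def V_def sum_subtractf)
qed

text \<open>One unit per slot for the rounded guesses; the overshoot of the crossing pick enters
  twice, through the value and through the gap.\<close>

definition err :: real where "err = real K * unit + 2 * (unit + 4 * thr)"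

text \<open>Large elements through \<open>slots\<close> and small ones through \<open>stop\<close>
  together gain \<open>1 / L\<close> of the gap, up to \<open>err\<close>. In the lower bound of the
  gap the current value of \<open>gpart\<close> counts negatively; it is returned by
  \<open>V_a_Suc\<close> when the distortion rises.\<close>

lemma phase:
  assumes run_inv: "run_inv A t 0" and wA: "wt (1 - real t / real L) A" and st: "steps S0 q (A, t, 0, 0, a t)"
    and q: "q + 162 * L ^ 8 \<le> NB" and t: "t < L"
  shows "\<exists>B. run_inv B (Suc t) 0 \<and> wt (1 - real (Suc t) / real L) B \<and> steps S0 (q + 162 * L ^ 8) (B, Suc t, 0, 0, a (Suc t))
    \<and> Psi t A + a t / real L * NF * (gpart Os - F {}) - err \<le> Psi (Suc t) B"
proof -
  define D where "D = a t"
  define \<theta> where "\<theta> = 1 - real t / real L"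
  have D: "0 \<le> D" "D \<le> 1" using a_nonneg a_le_1 t by (auto simp: D_def)
  have th: "0 \<le> \<theta>" "\<theta> \<le> 1" using t by (auto simp: \<theta>_def field_simps)
  have th': "1 - real (Suc t) / real L = \<theta> - 1 / real L" by (simp add: \<theta>_def add_divide_distrib)
  have th'0: "0 \<le> \<theta> - 1 / real L" using t L1 by (simp add: th'[symmetric])
  obtain A1 where A1: "steps S0 (q + k * (18 * L ^ 5)) (A1, t, k, 0, D)" "run_inv A1 t k" "ext A A1" "Sset A1 = Sset A"
    and V1: "V D A + (\<Sum>i<k. mg D A1 (lab i) / real L - unit) \<le> V D A1"
    using slots[OF run_inv st _ t, of k] D q by (auto simp: D_def)
  have wA1: "wt \<theta> A1" "wt (\<theta> - 1 / real L) A1"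
  proof -
    show "wt \<theta> A1" using wA A1(4) by (simp add: wt_def \<theta>_def)
    moreover have "(\<theta> - 1 / real L) * sum w (Sm - Sset A1) \<le> \<theta> * sum w (Sm - Sset A1)"
      using sub_n w0 by (intro mult_right_mono sum_nonneg) auto
    ultimately show "wt (\<theta> - 1 / real L) A1" by (simp add: wt_def)
  qed
  obtain v B B' where v: "v \<le> 16 * L ^ 5 + 1" "B = (chunk D ^^ v) A1" and JB: "pick_inv D \<theta> t A1 B" and wB: "wt (\<theta> - 1 / real L) B"
    and JB': "pick_inv D \<theta> t A1 B'" and e: "ext B B'" and VB': "V D B' - V D B \<le> unit + 4 * thr"
    and fin': "\<not> wt (\<theta> - 1 / real L) B' \<or> picks B' D = 0"
    using chunks[OF D th A1(2) wA1(2) th'0] by blast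
  have invB: "run_inv B t k" and invB': "run_inv B' t k" and eB': "ext A1 B'" using JB JB' by (auto simp: pick_inv_def)
  have kK: "real k * unit \<le> real K * unit" using k_le unit_pos by simp
  have "k * (18 * L ^ 5) \<le> 8 * L ^ 3 * (18 * L ^ 5)" using k_le K8 by (intro mult_le_mono1) simp
  also have "\<dots> = 144 * L ^ 8" by (simp add: power_add[symmetric])
  finally have "k * (18 * L ^ 5) \<le> 144 * L ^ 8" .
  moreover have "L ^ 5 \<le> L ^ 8" "1 \<le> L ^ 8" using L1 by (auto intro: power_increasing)
  ultimately have cnt: "Suc (q + k * (18 * L ^ 5) + v) \<le> q + 162 * L ^ 8" using v(1) by linarith
  have "steps S0 (q + k * (18 * L ^ 5) + v) (B, t, k, 0, D)"
    using steps_chunk[OF A1(1), of v] v(2) by simp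
  then have "steps S0 (Suc (q + k * (18 * L ^ 5) + v)) (B, Suc t, 0, 0, a (Suc t))"
    by (rule steps_Suc[of _ _ _ 4]) (simp_all add: ostep_def a_Suc D_def)
  then have stB: "steps S0 (q + 162 * L ^ 8) (B, Suc t, 0, 0, a (Suc t))"
    by (rule steps_mono[OF _ cnt])
  have invS: "run_inv B (Suc t) 0" using invB by (auto simp: run_inv_def)
  have S1: "(\<Sum>y\<in>Lg. mg D B' y) \<le> (\<Sum>i<k. mg D A1 (lab i))"
  proof -
    have "(\<Sum>y\<in>Lg. mg D B' y) = (\<Sum>i<k. mg D B' (lab i))"
      by (rule sum.reindex_bij_betw[OF lab, symmetric])
    also have "\<dots> \<le> (\<Sum>i<k. mg D A1 (lab i))"
      by (intro sum_mono mg_anti[OF D eB']) (use lab_n in auto)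
    finally show ?thesis .
  qed
  have S2: "(\<Sum>y\<in>Sm - Sset B'. mg D B' y) \<le> real L * net D \<theta> A1 B'"
    by (rule stop[OF D th JB' wA1(1) fin'])
  have Lp: "0 < real L" using L1 by simp
  have "(\<Sum>i<k. mg D A1 (lab i)) / real L \<le> V D A1 - V D A + real k * unit"
    using V1 by (simp add: sum_subtractf sum_divide_distrib[symmetric])
  then have "(\<Sum>i<k. mg D A1 (lab i)) \<le> real L * (V D A1 - V D A + real k * unit)"
    using Lp by (simp add: field_simps)
  then have "gap D B' \<le> real L * (V D A1 - V D A + real k * unit) + real L * net D \<theta> A1 B'"
    using gap_le[OF invB' D] S1 S2 by linarith
  then have G': "gap D B' \<le> real L * (V D B' - V D A + real K * unit - \<theta> * NF * sum ell (Yset A1 B'))"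
    using mult_left_mono[OF kK, of "real L"] by (simp add: net_def algebra_simps)
  have YY: "sum ell (Yset A1 B) \<le> sum ell (Yset A1 B')"
    by (rule sum_mono2) (use finS ext_Sset[OF e] ell_nonneg in \<open>auto simp: Yset_def\<close>)
  have "\<theta> * NF * sum ell (Yset A1 B) \<le> \<theta> * NF * sum ell (Yset A1 B')"
    using th by (intro mult_left_mono[OF YY]) simp
  then have "V D B' - V D A + real K * unit - \<theta> * NF * sum ell (Yset A1 B')
      \<le> V D B - V D A + real K * unit + (unit + 4 * thr) - \<theta> * NF * sum ell (Yset A1 B)"
    using VB' by simp
  then have "real L * (V D B' - V D A + real K * unit - \<theta> * NF * sum ell (Yset A1 B'))
      \<le> real L * (V D B - V D A + real K * unit + (unit + 4 * thr) - \<theta> * NF * sum ell (Yset A1 B))"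
    using Lp by (intro mult_left_mono) auto
  then have "gap D B \<le> real L * (V D B - V D A + real K * unit + (unit + 4 * thr) - \<theta> * NF * sum ell (Yset A1 B)) + (unit + 4 * thr)"
    using gap_ext[OF e D] VB' G' by linarith
  also have "\<dots> \<le> real L * (V D B - V D A + err - \<theta> * NF * sum ell (Yset A1 B))"
  proof -
    have "1 * (unit + 4 * thr) \<le> real L * (unit + 4 * thr)"
      using L1 unit_pos thr_pos by (intro mult_right_mono) auto
    then show ?thesis by (simp add: err_def algebra_simps)
  qed
  finally have G: "gap D B \<le> real L * (V D B - V D A + err - \<theta> * NF * sum ell (Yset A1 B))" .
  define eR where "eR = NF * sum ell (Lg \<union> (Sm - Sset B))"
  define eY where "eY = NF * sum ell (Yset A1 B)"
  define sg where "sg = (\<Sum>p<L ^ K. gpart (its B p))"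
  have split: "NF * sum ell (Lg \<union> (Sm - Sset A)) = eR + eY"
  proof -
    have "Sset A \<subseteq> Sset B" using ext_Sset[of A1 B] JB A1(4) by (simp add: pick_inv_def)
    then have "Lg \<union> (Sm - Sset A) = (Lg \<union> (Sm - Sset B)) \<union> Yset A1 B" using A1(4) by (auto simp: Yset_def)
    moreover have "sum ell ((Lg \<union> (Sm - Sset B)) \<union> Yset A1 B) = sum ell (Lg \<union> (Sm - Sset B)) + sum ell (Yset A1 B)"
      by (rule sum.union_disjoint) (use fin finS Os_split in \<open>auto simp: Yset_def\<close>)
    ultimately show ?thesis by (simp add: eR_def eY_def algebra_simps)
  qed
  have "D * (NF * gpart Os - sg) + eR \<le> gap D B" using gap_ge[OF invB D(1)] by (simp add: eR_def sg_def)
  with G have "D * (NF * gpart Os - sg) + eR \<le> real L * (V D B - V D A + err - \<theta> * eY)" by (simp add: eY_def algebra_simps)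
  \<comment> \<open>In \<open>Psi\<close>, the term \<open>eR / L\<close> pays for the elapsed time
    on what is still missing, and \<open>\<theta> * eY\<close> for the elements of \<open>Os\<close>
    that this phase removed from the missing part.\<close>
  then have M: "D / real L * (NF * gpart Os - sg) + eR / real L \<le> V D B - V D A + err - \<theta> * eY"
    using Lp by (simp add: field_simps)
  have VS: "V (a (Suc t)) B = V D B + D / real L * sg" using V_a_Suc by (simp add: D_def sg_def)
  have aS: "a (Suc t) = D + D / real L" using a_Suc_diff[of t] by (simp add: D_def)
  have "Psi (Suc t) B = V D B + D / real L * sg - (D + D / real L) * NF * F {} + (\<theta> - 1 / real L) * eR"
    unfolding Psi_def VS eR_def th' by (simp only: aS mult.assoc)
  moreover have "Psi t A = V D A - D * NF * F {} + \<theta> * (eR + eY)"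
    using split by (simp add: Psi_def D_def \<theta>_def)
  ultimately have "Psi t A + a t / real L * NF * (gpart Os - F {}) - err \<le> Psi (Suc t) B"
    using M by (simp add: D_def[symmetric] algebra_simps diff_divide_distrib)
  then show ?thesis using invS stB wB th' by auto
qed

lemma phases:
  assumes "t \<le> L"
  shows "\<exists>A. run_inv A t 0 \<and> wt (1 - real t / real L) A \<and> steps S0 (t * (162 * L ^ 8)) (A, t, 0, 0, a t)
    \<and> Psi 0 (bs S0) + (a t - a0) * NF * (gpart Os - F {}) - real t * err \<le> Psi t A"
  using assms
proof (induction t)
  case 0
  have S: "Sset (bs S0) = {}" using sub_n by (auto simp: Sset_def bs_def scell_def)
  have z: "bs S0 c = 0" if "n < c" for c using that sub_n by (auto simp: bs_def)
  have "run_inv (bs S0) 0 0"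
  proof -
    have "base (bs S0) = bs S0" using z by (auto simp: base_def fun_eq_iff)
    moreover have "bs S0 (Suc n) = 0" "\<forall>x<n. bs S0 (scell x) = 0" using z by (simp_all add: scell_def)
    moreover have "bs S0 (fcell j t') = 0" for j t'
      by (rule z) (simp add: fcell_def)
    ultimately show ?thesis by (simp add: run_inv_def S)
  qed
  moreover have "wt 1 (bs S0)" by (simp add: wt_def S)
  ultimately show ?case using steps_0 by (intro exI[of _ "bs S0"]) (simp add: a_0)
next
  case (Suc t)
  then obtain A where A: "run_inv A t 0" "wt (1 - real t / real L) A" "steps S0 (t * (162 * L ^ 8)) (A, t, 0, 0, a t)"
    "Psi 0 (bs S0) + (a t - a0) * NF * (gpart Os - F {}) - real t * err \<le> Psi t A" by auto
  have "t * (162 * L ^ 8) + 162 * L ^ 8 = Suc t * (162 * L ^ 8)" by simp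
  also have "\<dots> \<le> L * (162 * L ^ 8)" using Suc.prems by (intro mult_le_mono1)
  also have "\<dots> = 162 * L ^ 9" using power_add[of L 1 8] by simp
  finally have "t * (162 * L ^ 8) + 162 * L ^ 8 \<le> NB" by (simp add: NB_def)
  from phase[OF A(1-3) this] Suc.prems obtain B where B: "run_inv B (Suc t) 0" "wt (1 - real (Suc t) / real L) B"
    "steps S0 (t * (162 * L ^ 8) + 162 * L ^ 8) (B, Suc t, 0, 0, a (Suc t))"
    "Psi t A + a t / real L * NF * (gpart Os - F {}) - err \<le> Psi (Suc t) B" by auto
  have "Psi 0 (bs S0) + (a (Suc t) - a0) * NF * (gpart Os - F {}) - real (Suc t) * err \<le> Psi (Suc t) B"
    using A(4) B(4) by (simp add: a_Suc_diff[symmetric] algebra_simps)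
  then show ?case using B by (intro exI[of _ B]) (simp add: add.commute)
qed

lemma err_le: "real L * err \<le> 4 * U * NF / real L"
proof -
  have L: "1 \<le> real L" using L1 by simp
  define M where "M = U * NF"
  have M0: "0 \<le> M" using U0 by (simp add: M_def)
  have p5: "real L ^ 5 = real L ^ 3 * real L ^ 2" using power_add[of "real L" 3 2] by simp
  have kk: "real K = 8 * real L ^ 3" using K8 by simp
  have "real K * unit = M / real L ^ 2"
  proof -
    have "real K * unit = 8 * real L ^ 3 * M / (8 * (real L ^ 3 * real L ^ 2))"
      by (simp only: kk unit_def M_def p5 times_divide_eq_right)
    also have "\<dots> = M / real L ^ 2"
    proof -
      have "x \<noteq> 0 \<Longrightarrow> 8 * x * M / (8 * (x * y)) = M / y" for x y :: real by simp
      moreover have "real L ^ 3 \<noteq> 0" using L by simp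
      ultimately show ?thesis by blast
    qed
    finally show ?thesis .
  qed
  moreover have "4 * thr = M / real L ^ 2" by (simp add: thr_def M_def)
  moreover have "unit \<le> M / real L ^ 2 / 8"
  proof -
    have "real L ^ 2 \<le> real L ^ 5" using L by (intro power_increasing) auto
    then have "M / (8 * real L ^ 5) \<le> M / (8 * real L ^ 2)"
      using L M0 by (intro divide_left_mono mult_pos_pos) auto
    then show ?thesis by (simp add: unit_def M_def)
  qed
  moreover have "0 \<le> M / real L ^ 2" using M0 by simp
  moreover have "r = Q \<Longrightarrow> 4 * v = Q \<Longrightarrow> u \<le> Q / 8 \<Longrightarrow> 0 \<le> Q \<Longrightarrow> r + 2 * (u + 4 * v) \<le> 4 * Q" for r Q u v :: real
    by simp
  ultimately have "err \<le> 4 * (M / real L ^ 2)" unfolding err_def by blast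
  then have "real L * err \<le> real L * (4 * (M / real L ^ 2))" using L by (intro mult_left_mono) auto
  also have "\<dots> = 4 * M / real L" using L by (simp add: power2_eq_square)
  finally show ?thesis by (simp add: M_def mult.assoc)
qed

text \<open>At \<open>t = L\<close> the distortion is 1 and no time remains, so \<open>Psi\<close>
  is the sum of \<open>F - F {}\<close> over the candidates, and some candidate reaches the average.
  At the start, \<open>S0\<close> contributes at least its linear value because
  \<open>gpart S0 \<ge> F {}\<close>.\<close>

lemma result:
  shows "\<exists>A t i m D p. steps S0 NB (A, t, i, m, D) \<and> p < L ^ K \<and> sum w (its A p) \<le> 1
    \<and> F Os - a0 * (F Os - F {} - sum ell Os) - 4 * U / real L \<le> F (its A p)"
proof -
  obtain A where A: "run_inv A L 0" "wt (1 - real L / real L) A" "steps S0 (L * (162 * L ^ 8)) (A, L, 0, 0, a L)"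
    "Psi 0 (bs S0) + (a L - a0) * NF * (gpart Os - F {}) - real L * err \<le> Psi L A"
    using phases[of L] by auto
  have "L * (162 * L ^ 8) = 162 * L ^ 9" using power_add[of L 1 8] by simp
  then have st: "steps S0 NB (A, L, 0, 0, a L)" using steps_mono[OF A(3), of NB] by (simp add: NB_def)
  have Lp: "0 < real L" using L1 by simp
  define m where "m = F Os - a0 * (F Os - F {} - sum ell Os) - 4 * U / real L"
  have S: "Sset (bs S0) = {}" using sub_n by (auto simp: Sset_def bs_def scell_def)
  have "sum ell Os = sum ell S0 + sum ell (Lg \<union> Sm)"
  proof -
    have "Os = S0 \<union> (Lg \<union> Sm)" "(Lg \<union> Sm) - S0 = Lg \<union> Sm" using Os_split by auto
    then show ?thesis using sum_ell_Un[of S0 "Lg \<union> Sm"] sub_n by (metis Un_least)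
  qed
  moreover have "Psi 0 (bs S0) = NF * (a0 * (gpart S0 - F {}) + sum ell S0 + sum ell (Lg \<union> Sm))"
    by (simp add: Psi_def a_0 S V_def its_bs h_gpart algebra_simps)
  moreover have "0 \<le> a0 * (gpart S0 - F {})"
    using gpart_mono[of "{}" S0] sub_n a0_bounds by (intro mult_nonneg_nonneg) (auto simp: gpart_def)
  then have "NF * (sum ell S0 + sum ell (Lg \<union> Sm)) \<le> NF * (a0 * (gpart S0 - F {}) + sum ell S0 + sum ell (Lg \<union> Sm))"
    by (intro mult_left_mono) auto
  ultimately have P0: "NF * sum ell Os \<le> Psi 0 (bs S0)" by simp
  have "Psi L A = (\<Sum>p<L ^ K. F (its A p) - F {})"
    using Lp by (simp add: Psi_def a_L V_def h_def sum_subtractf)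
  then have "NF * sum ell Os + (1 - a0) * NF * (gpart Os - F {}) - 4 * U * NF / real L
      \<le> (\<Sum>p<L ^ K. F (its A p) - F {})"
    using A(4) P0 err_le by (simp add: a_L)
  also have "NF * sum ell Os + (1 - a0) * NF * (gpart Os - F {}) - 4 * U * NF / real L = NF * (m - F {})"
    by (simp add: m_def gpart_def algebra_simps)
  finally have sum: "(\<Sum>p<L ^ K. m) \<le> (\<Sum>p<L ^ K. F (its A p))"
    by (simp add: sum_subtractf algebra_simps)
  have "\<exists>p<L ^ K. m \<le> F (its A p)"
  proof (rule ccontr)
    assume "\<not> ?thesis"
    then have "(\<Sum>p<L ^ K. F (its A p)) < (\<Sum>p<L ^ K. m)"
      using L1 by (intro sum_strict_mono) (auto simp: not_le lessThan_empty_iff)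
    then show False using sum by simp
  qed
  then obtain p where p: "p < L ^ K" "m \<le> F (its A p)" by blast
  have "sum w (its A p) \<le> 1" by (rule its_weight[OF A(1,2)]) (use Lp in simp)
  then show ?thesis using st p unfolding m_def by blast
qed

end

section \<open>Exchange argument: a near-optimal solution that fits the run\<close>

context alg
begin

text \<open>\<open>sum_dig_update\<close> applied to the constants \<open>c\<close> and
  \<open>- c\<close> gives both inequalities.\<close>

lemma dig_count:
  assumes "i < K" "t < L"
  shows "(\<Sum>p<L ^ K. if dig L p i = t then c else 0) = real (L ^ K) / real L * c"
proof -
  have "(\<Sum>p<L ^ K. c) \<le> real L * (\<Sum>p<L ^ K. if dig L p i = t then c else 0)" for c :: real
    using sum_dig_update[of i K t L "\<lambda>_. c"] assms by simp
  note le = this[of c] this[of "- c"]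
  have "(\<Sum>p<L ^ K. if dig L p i = t then - c else 0) = - (\<Sum>p<L ^ K. if dig L p i = t then c else 0)"
    unfolding sum_negf[symmetric] by (rule sum.cong) auto
  with le have "(\<Sum>p<L ^ K. c) = real L * (\<Sum>p<L ^ K. if dig L p i = t then c else 0)"
    by simp
  then show ?thesis using L1 by (simp add: field_simps)
qed

text \<open>When elements are removed one after another, diminishing returns make each removal cost
  at least as much as it would cost at the full set.\<close>

lemma sum_removal_le:
  assumes "finite Q" "Q \<subseteq> X" "X \<subseteq> {..<n}"
  shows "(\<Sum>y\<in>Q. F X - F (X - {y})) \<le> F X - F (X - Q)"
  using assms
proof (induction Q rule: finite_induct)
  case (insert q Q)
  have "F (X - {q} \<union> {q}) - F (X - {q}) \<le> F (X - insert q Q \<union> {q}) - F (X - insert q Q)"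
    by (rule F_dim) (use insert in auto)
  moreover have "X - {q} \<union> {q} = X" "X - insert q Q \<union> {q} = X - Q" using insert by auto
  ultimately show ?case using insert by simp
qed simp

lemma steps_trans:
  assumes "steps S q (bs S', 0, 0, 0, a0)" "steps S' q' \<sigma>"
  shows "steps S (q + q') \<sigma>"
proof -
  obtain os os' where "length os \<le> q" "\<forall>c\<in>set os. c < 6" "fold ostep os (bs S, 0, 0, 0, a0) = (bs S', 0, 0, 0, a0)"
    "length os' \<le> q'" "\<forall>c\<in>set os'. c < 6" "fold ostep os' (bs S', 0, 0, 0, a0) = \<sigma>"
    using assms unfolding steps_def by blast
  then show ?thesis unfolding steps_def by (intro exI[of _ "os @ os'"]) auto
qed

lemma base_sub:
  assumes "S \<subseteq> {..<n}" "base A = bs S"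
  shows "S \<subseteq> its A p"
proof
  fix y assume y: "y \<in> S"
  then have "bs S (Suc y) = Suc y" "y < n" using assms(1) by (auto simp: bs_def)
  then have "A (Suc y) = Suc y" using fun_cong[OF assms(2), of "Suc y"] by (simp add: base_def)
  moreover have "Suc y < 2 * Suc n" using \<open>y < n\<close> by simp
  ultimately show "y \<in> its A p" using \<open>y < n\<close> unfolding items_def by blast
qed

lemma commit:
  assumes "S \<subseteq> {..<n}" "x < n" "base A = bs S" "i < K" "t < L" "pickf A t i m D = Suc x"
  shows "ostep 5 (A, t, i, m, D) = (bs (insert x S), 0, 0, 0, a0)"
proof -
  have "base (A(Suc x := Suc x)) c = bs (insert x S) c" for c
    using fun_cong[OF assms(3), of c] assms(1,2) by (auto simp: base_def bs_def split: if_splits)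
  then show ?thesis using assms(4-6) by (simp add: ostep_def fun_eq_iff)
qed

text \<open>
  Take a sequence of commits of maximal length, each of which raises \<open>F\<close> by at least \<open>d\<close> and loses
  at most the fraction \<open>1 / L\<close> of that raise in \<open>Os\<close>. If too many large elements were left, committing
  the lightest element of large gain, in exchange for the least valuable of them, would prolong the
  sequence; so would committing an element of \<open>Os\<close> that is about to fill a slot.
\<close>

lemma near_opt:
  assumes U0: "0 < U" and K8: "K = 8 * L ^ 3"
    and feasU: "\<And>X. X \<subseteq> {..<n} \<Longrightarrow> sum w X \<le> 1 \<Longrightarrow> F X \<le> 2 * U"
    and Opt: "Opt \<subseteq> {..<n}" "sum w Opt \<le> 1"
  shows "\<exists>Os A t i m D p. Os \<subseteq> {..<n} \<and> sum w Os \<le> 1 \<and> F Opt - 2 * U / real L \<le> F Os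
    \<and> steps {} (3400 * L ^ 14) (A, t, i, m, D) \<and> p < L ^ K \<and> sum w (its A p) \<le> 1
    \<and> F Os - a0 * (F Os - F {} - sum ell Os) - 4 * U / real L \<le> F (its A p)"
proof -
  \<comment> \<open>One \<open>unit\<close> per candidate. A commit raises \<open>F\<close> by at
    least \<open>d\<close>, and feasible sets are worth at most
    \<open>2 * U = 16 * L ^ 5 * d\<close>; this bounds the number of commits.\<close>
  define d where "d = U / (8 * real L ^ 5)"
  have Lr: "1 \<le> real L" using L1 by simp
  have d0: "0 < d" using U0 Lr by (simp add: d_def)
  have NF0: "0 < real (L ^ K)" using L1 by simp
  have unit_d: "unit = real (L ^ K) * d" by (simp add: unit_def d_def)
  have u0: "0 < unit" using d0 NF0 by (simp add: unit_d)
  \<comment> \<open>\<open>c\<close> counts the commits. Each is charged \<open>Suc NB\<close>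
    operations: a run up to the element in question, and the commit itself.\<close>
  define P where "P c S0 Os \<longleftrightarrow> S0 \<subseteq> Os \<and> Os \<subseteq> {..<n} \<and> sum w Os \<le> 1 \<and> F Opt - (F S0 - F {}) / real L \<le> F Os
      \<and> F {} + real c * d \<le> F S0 \<and> steps {} (c * Suc NB) (bs S0, 0, 0, 0, a0)" for c S0 Os
  have feas_sub: "F X \<le> 2 * U" if "X \<subseteq> Y" "Y \<subseteq> {..<n}" "sum w Y \<le> 1" for X Y
    using mono[OF that(1,2)] feasU[OF that(2,3)] by simp
  have bound: "c \<le> 16 * L ^ 5" if "P c S0 Os" for c S0 Os
  proof -
    have "real c * d \<le> 2 * U" using that feas_sub[of S0 Os] nonneg[of "{}"] by (auto simp: P_def)
    also have "\<dots> = 16 * real L ^ 5 * d" using Lr by (simp add: d_def)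
    finally have "real c \<le> 16 * real L ^ 5" using d0 by simp
    then have "real c \<le> real (16 * L ^ 5)" by simp
    then show ?thesis by (simp only: of_nat_le_iff)
  qed
  have "P 0 {} Opt" using Opt steps_0 by (simp add: P_def)
  then have "\<exists>S0 Os. P 0 S0 Os" by blast
  then obtain c where c: "\<exists>S0 Os. P c S0 Os" and cmax: "\<And>c'. \<exists>S0 Os. P c' S0 Os \<Longrightarrow> c' \<le> c"
    using bound ex_has_greatest_nat[of "\<lambda>c. \<exists>S0 Os. P c S0 Os" 0 id "Suc (16 * L ^ 5)"] by (auto simp: less_Suc_eq_le)
  then obtain S0 Os where Pc: "P c S0 Os" by blast
  have S0: "S0 \<subseteq> Os" "Os \<subseteq> {..<n}" "S0 \<subseteq> {..<n}" "sum w Os \<le> 1" "F Opt - (F S0 - F {}) / real L \<le> F Os"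
    "F {} + real c * d \<le> F S0" "steps {} (c * Suc NB) (bs S0, 0, 0, 0, a0)"
    using Pc by (auto simp: P_def)
  have finOs: "finite Os" using S0(2) finite_subset by blast
  have a0: "0 \<le> a0" "a0 \<le> 1" using a0_bounds by auto
  have no_more: False
    if x: "x < n" "d \<le> F (insert x S0) - F S0" and Os': "insert x S0 \<subseteq> Os'" "Os' \<subseteq> {..<n}" "sum w Os' \<le> 1"
      "F Os - (F (insert x S0) - F S0) / real L \<le> F Os'" and st: "steps S0 NB (A, t, i, m, D)"
      and pk: "i < K" "t < L" "pickf A t i m D = Suc x" "base A = bs S0" for x Os' A t i m D
  proof -
    have "steps S0 (Suc NB) (bs (insert x S0), 0, 0, 0, a0)"
      by (rule steps_Suc[OF st _ commit[OF S0(3) x(1) pk(4,1,2,3)]]) simp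
    then have "steps {} (Suc c * Suc NB) (bs (insert x S0), 0, 0, 0, a0)"
      using steps_mono[OF steps_trans[OF S0(7)], of "Suc NB" _ "Suc c * Suc NB"] by simp
    moreover have "F Opt - (F (insert x S0) - F {}) / real L \<le> F Os'"
      using Os'(4) S0(5) by (simp add: diff_divide_distrib)
    ultimately have "P (Suc c) (insert x S0) Os'"
      using Os' x(2) S0(6) by (simp add: P_def algebra_simps)
    then show False using cmax[of "Suc c"] by auto
  qed
  have few: "card {x \<in> Os - S0. large S0 x} \<le> K"
  proof (rule ccontr)
    let ?Q = "{x \<in> Os - S0. large S0 x}"
    assume "\<not> ?thesis"
    then have Q: "K < card ?Q" by simp
    have K1: "0 < K" using K8 L1 by simp
    have fQ: "finite ?Q" using finOs by simp
    \<comment> \<open>This guess is worth exactly \<open>thr / L\<close>, which every large element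
      gains in an empty cell by \<open>gain_fcell_ge\<close>.\<close>
    let ?m = "2 * L ^ 2"
    have mu: "real ?m * unit = thr / real L"
    proof -
      have p5: "real L ^ 5 = real L ^ 2 * (real L ^ 2 * real L)"
        using power_add[of "real L" 4 1] by simp
      have gen: "x \<noteq> 0 \<Longrightarrow> l \<noteq> 0 \<Longrightarrow> 2 * x * (M / (8 * (x * (x * l)))) = M / (4 * x) / l" for x l M :: real
        by (simp add: field_simps)
      show ?thesis
        unfolding unit_def thr_def p5 of_nat_mult of_nat_numeral of_nat_power
        by (rule gen) (use Lr in auto)
    qed
    have z: "bs S0 (fcell 0 0) = 0" using S0(3) by (auto simp: bs_def fcell_def)
    have zs: "bs S0 (scell y) = 0" for y using S0(3) by (auto simp: bs_def scell_def)
    have L0: "0 < L" using L1 by simp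
    let ?g = "gain a0 (bs S0) (fcell 0 0)"
    let ?c = "\<lambda>x. \<not> ?g x < real ?m * unit"
    have cQ: "?c y" "y < n" if "y \<in> ?Q" for y
    proof -
      show y: "y < n" using that S0 by auto
      have "thr \<le> gain a0 (bs S0) (scell y) y" using that by (simp add: large_def)
      also have "\<dots> = mg a0 (bs S0) y" by (rule gain_scell) (use y zs in \<open>auto simp: scell_def\<close>)
      also have "\<dots> \<le> real L * ?g y" by (rule gain_fcell_ge[of y 0 0 "bs S0" a0, OF y K1 L0 z a0])
      finally have "thr / real L \<le> ?g y" using Lr by (simp add: field_simps)
      then show "?c y" unfolding mu not_less .
    qed
    have "?Q \<noteq> {}" using Q by (metis card.empty not_less_zero)
    then obtain y0 where "y0 \<in> ?Q" by blast
    then have "pickf (bs S0) 0 0 ?m a0 \<noteq> 0"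
      using cQ[of y0] scanf_0[of ?c w n y0] unfolding pickf_def by blast
    then obtain x where x: "pickf (bs S0) 0 0 ?m a0 = Suc x" by (metis not0_implies_Suc)
    then have xp: "x < n" "?c x" "\<And>y. y < n \<Longrightarrow> ?c y \<Longrightarrow> w x \<le> w y"
      using scanf_Suc[of ?c w n x] unfolding pickf_def by blast+
    have "?g x = real (L ^ K) / real L * (h a0 (insert x S0) - h a0 S0)"
      using gain_fcell[of x 0 0 "bs S0" a0, OF xp(1) K1 L0 z] dig_count[OF K1 L0] by (simp only: its_bs'[OF S0(3)])
    moreover have "thr / real L \<le> ?g x" using xp(2) unfolding mu not_less .
    ultimately have "thr \<le> real (L ^ K) * (h a0 (insert x S0) - h a0 S0)" using Lr by (simp add: field_simps)
    then have "real (L ^ K) * (U / (4 * real L ^ 2)) \<le> real (L ^ K) * (h a0 (insert x S0) - h a0 S0)"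
      by (simp add: thr_def mult.commute)
    then have "U / (4 * real L ^ 2) \<le> h a0 (insert x S0) - h a0 S0"
      using NF0 by (simp only: mult_le_cancel_left_pos)
    also have "\<dots> \<le> F (insert x S0) - F S0" by (rule h_diff_le[OF a0]) (use S0(3) xp(1) in auto)
    finally have \<delta>: "U / (4 * real L ^ 2) \<le> F (insert x S0) - F S0" .
    have "d \<le> U / (4 * real L ^ 2)"
    proof -
      have "real L ^ 2 \<le> real L ^ 5" using Lr by (intro power_increasing) auto
      moreover have "0 \<le> real L ^ 5" by simp
      ultimately have "4 * real L ^ 2 \<le> 8 * real L ^ 5" by linarith
      then show ?thesis unfolding d_def using Lr U0 by (intro divide_left_mono) auto
    qed
    with \<delta> have dx: "d \<le> F (insert x S0) - F S0" by simp
    have xS: "x \<notin> S0" using dx d0 by (auto simp: insert_absorb)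
    have st: "steps S0 NB (bs S0, 0, 0, ?m, a0)"
    proof (rule steps_mono)
      show "steps S0 (0 + ?m) (bs S0, 0, 0, ?m, a0)" using steps_incr[OF steps_0, of S0 0 ?m] by simp
      have "L ^ 2 \<le> L ^ 9" using L1 by (intro power_increasing) auto
      then show "0 + ?m \<le> NB" by (simp add: NB_def)
    qed
    have bb: "base (bs S0) = bs S0" using S0(3) by (auto simp: base_def bs_def fun_eq_iff)
    show False
    proof (cases "x \<in> Os")
      case True
      have "0 \<le> (F (insert x S0) - F S0) / real L" using dx d0 by simp
      then show False
        using no_more[OF xp(1) dx _ S0(2,4) _ st K1 L0 x bb] True S0(1) by simp
    next
      case False
      have "\<exists>y\<in>?Q. F Os - F (Os - {y}) \<le> 2 * U / real K"
      proof (rule ccontr)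
        assume "\<not> ?thesis"
        then have gt: "2 * U / real K < F Os - F (Os - {y})" if "y \<in> ?Q" for y
          using that by (meson not_le)
        have "real K * (2 * U / real K) \<le> real (card ?Q) * (2 * U / real K)"
          using Q U0 by (intro mult_right_mono) auto
        also have "\<dots> = (\<Sum>y\<in>?Q. 2 * U / real K)" by simp
        also have "\<dots> < (\<Sum>y\<in>?Q. F Os - F (Os - {y}))"
          by (rule sum_strict_mono[OF fQ]) (use gt \<open>y0 \<in> ?Q\<close> in auto)
        also have "\<dots> \<le> F Os - F (Os - ?Q)" by (rule sum_removal_le[OF fQ]) (use S0 in auto)
        also have "\<dots> \<le> 2 * U"
        proof -
          have "Os - ?Q \<subseteq> {..<n}" using S0(2) by blast
          then show ?thesis using feasU[OF S0(2,4)] nonneg[of "Os - ?Q"] by linarith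
        qed
        finally show False using K1 by simp
      qed
      then obtain y where y: "y \<in> ?Q" "F Os - F (Os - {y}) \<le> 2 * U / real K" by blast
      \<comment> \<open>The origin of \<open>K = 8 * L ^ 3\<close>: the loss in \<open>Os\<close>
        becomes at most \<open>1 / L\<close> of the raise that \<open>x\<close> is known to
        bring.\<close>
      have "2 * U / real K = U / (4 * real L ^ 2) / real L"
      proof -
        have "real K = 8 * real L ^ 3" using K8 by simp
        then have "2 * U / real K = U / (4 * real L ^ 3)" by simp
        also have "real L ^ 3 = real L ^ 2 * real L" by (simp add: power2_eq_square power3_eq_cube)
        finally show ?thesis by simp
      qed
      also have "\<dots> \<le> (F (insert x S0) - F S0) / real L" using \<delta> by (intro divide_right_mono) auto
      finally have loss: "F Os - (F (insert x S0) - F S0) / real L \<le> F (Os - {y})" using y(2) by simp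
      let ?Os = "insert x (Os - {y})"
      have "F (Os - {y}) \<le> F ?Os" by (rule mono) (use S0(2) xp(1) in auto)
      moreover have "sum w ?Os \<le> 1"
      proof -
        have "sum w ?Os = w x + sum w (Os - {y})" using finOs False by simp
        also have "sum w (Os - {y}) = sum w Os - w y" using finOs y(1) by (simp add: sum_diff1)
        finally show ?thesis using xp(3)[OF cQ(2,1)[OF y(1)]] S0(4) by simp
      qed
      moreover have "insert x S0 \<subseteq> ?Os" "?Os \<subseteq> {..<n}" using S0(1,2) y(1) xp(1) by auto
      ultimately show False using no_more[OF xp(1) dx _ _ _ _ st K1 L0 x bb, of ?Os] loss by simp
    qed
  qed
  \<comment> \<open>A positive guess demands a total gain of one unit, while each candidate
    contributes at most the gain of \<open>x\<close> over \<open>S0\<close>. So committing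
    \<open>x\<close> raises \<open>F\<close> by \<open>d\<close>, and costs nothing since
    \<open>x\<close> already lies in \<open>Os\<close>.\<close>
  have nocom: "x \<notin> Os - S0"
    if st: "steps S0 NB (A, t, i, m, D)" and it: "i < K" "t < L" "0 < m" and pk: "pickf A t i m D = Suc x"
      and A: "base A = bs S0" "A (fcell i t) = 0" and D: "0 \<le> D" "D \<le> 1" for A t i m D x
  proof
    assume xO: "x \<in> Os - S0"
    have xp: "x < n" "\<not> gain D A (fcell i t) x < real m * unit"
      using scanf_Suc[OF pk[unfolded pickf_def]] by blast+
    have "1 * unit \<le> real m * unit" using it(3) u0 by (intro mult_right_mono) auto
    then have "unit \<le> gain D A (fcell i t) x" using xp(2) by simp
    also have "\<dots> \<le> (\<Sum>p<L ^ K. F (insert x S0) - F S0)"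
      unfolding gain_fcell[of x i t A D, OF xp(1) it(1,2) A(2)]
    proof (rule sum_mono)
      fix p
      have "h D (insert x (its A p)) - h D (its A p) \<le> h D (insert x S0) - h D S0"
        by (rule h_dim1[OF D base_sub[OF S0(3) A(1)] its_sub xp(1)])
      also have "\<dots> \<le> F (insert x S0) - F S0"
        by (rule h_diff_le[OF D]) (use S0(3) xp(1) in auto)
      finally have "h D (insert x (its A p)) - h D (its A p) \<le> F (insert x S0) - F S0" .
      moreover have "F S0 \<le> F (insert x S0)" by (rule mono) (use S0(3) xp(1) in auto)
      ultimately show "(if dig L p i = t then h D (insert x (its A p)) - h D (its A p) else 0) \<le> F (insert x S0) - F S0"
        by simp
    qed
    finally have dx: "d \<le> F (insert x S0) - F S0" using NF0 by (simp add: unit_d)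
    then have "0 \<le> (F (insert x S0) - F S0) / real L" using d0 by simp
    then show False using no_more[OF xp(1) dx _ S0(2,4) _ st it(1,2) pk A(1)] xO S0(1) by simp
  qed
  interpret slot_run n F w L K U S0 Os
    by unfold_locales (use U0 feasU S0 K8 few nocom in auto)
  obtain A t i m D p where R: "steps S0 NB (A, t, i, m, D)" "p < L ^ K" "sum w (its A p) \<le> 1"
    "F Os - a0 * (F Os - F {} - sum ell Os) - 4 * U / real L \<le> F (its A p)"
    using result by blast
  \<comment> \<open>At most \<open>16 * L ^ 5\<close> commits at \<open>171 * L ^ 9\<close>
    operations each, then one complete run: \<open>2736 + 170\<close> is below 3400.\<close>
  have "c * Suc NB + NB \<le> 3400 * L ^ 14"
  proof -
    have "c * Suc NB \<le> 16 * L ^ 5 * (171 * L ^ 9)"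
    proof (rule mult_le_mono)
      show "c \<le> 16 * L ^ 5" by (rule bound[OF Pc])
      have "1 \<le> L ^ 9" using L1 by simp
      then show "Suc NB \<le> 171 * L ^ 9" by (simp add: NB_def)
    qed
    also have "\<dots> = 2736 * L ^ 14" by (simp add: power_add[symmetric])
    moreover have "L ^ 9 \<le> L ^ 14" using L1 by (intro power_increasing) auto
    ultimately show ?thesis by (simp add: NB_def)
  qed
  then have "steps {} (3400 * L ^ 14) (A, t, i, m, D)"
    using steps_mono[OF steps_trans[OF S0(7) R(1)]] by blast
  moreover have "F Opt - 2 * U / real L \<le> F Os"
  proof -
    have "(F S0 - F {}) / real L \<le> 2 * U / real L"
      using feas_sub[OF S0(1,2,4)] nonneg[of "{}"] Lr by (intro divide_right_mono) auto
    then show ?thesis using S0(5) by simp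
  qed
  ultimately show ?thesis using R S0(2,4) by blast
qed

end

section \<open>The program\<close>

lemma halts_weaken: "halts orc c s B P \<Longrightarrow> B \<le> B' \<Longrightarrow> (\<And>s'. P s' \<Longrightarrow> P' s') \<Longrightarrow> halts orc c s B' P'"
  by (rule halts_mono)

lemma halts_with_frame: "halts orc c s B P \<Longrightarrow> halts orc c s B (\<lambda>s'. P s' \<and> frame c s s')"
  by (erule halts_mono) auto

lemma halts_Seq:
  assumes "halts orc c s B1 P" "\<And>s1. P s1 \<Longrightarrow> frame c s s1 \<Longrightarrow> halts orc d s1 B2 Q" "B1 + B2 + 1 \<le> B"
  shows "halts orc (Seq c d) s B Q"
  unfolding halts_def
  by (rule wpt_Seq, rule wpt_use[OF assms(1)], rule wpt_use[OF assms(2)]) (use assms(3) in auto)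

lemma halts_NSet: "P (nwrite a (nval s i) (nval s x) s) \<Longrightarrow> halts orc (NSet a i x) s 1 P"
  unfolding halts_def by (rule wpt_NSet) simp

lemma halts_RSet: "P (rwrite a (nval s i) (rval s x) s) \<Longrightarrow> halts orc (RSet a i x) s 1 P"
  unfolding halts_def by (rule wpt_RSet) simp

lemma halts_Skip: "P s \<Longrightarrow> halts orc Skip s 0 P"
  unfolding halts_def by (rule wpt_Skip) simp

lemma halts_Cond:
  assumes "bval s b \<Longrightarrow> halts orc c s B P" "\<not> bval s b \<Longrightarrow> halts orc d s B P"
  shows "halts orc (Cond b c d) s (B + 1) P"
  unfolding halts_def by (rule wpt_Cond) (auto intro!: wpt_use assms)

lemma halts_Cond_Skip:
  assumes "bval s b \<Longrightarrow> halts orc c s B P" "\<not> bval s b \<Longrightarrow> P s"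
  shows "halts orc (Cond b c Skip) s (B + 1) P"
  by (rule halts_Cond) (use assms halts_weaken[OF halts_Skip] in auto)

lemma halts_NSeq: "halts orc d (nwrite a (nval s i) (nval s x) s) B Q \<Longrightarrow> halts orc (Seq (NSet a i x) d) s (B + 2) Q"
  by (rule halts_Seq[where P = "\<lambda>s'. s' = nwrite a (nval s i) (nval s x) s"]) (auto intro: halts_NSet)

lemma halts_RSeq: "halts orc d (rwrite a (nval s i) (rval s x) s) B Q \<Longrightarrow> halts orc (Seq (RSet a i x) d) s (B + 2) Q"
  by (rule halts_Seq[where P = "\<lambda>s'. s' = rwrite a (nval s i) (rval s x) s"]) (auto intro: halts_RSet)

lemma halts_NSeq_eq:
  assumes "nval s i = j" "nval s x = v" "halts orc d (nwrite a j v s) B Q"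
  shows "halts orc (Seq (NSet a i x) d) s (B + 2) Q"
  using halts_NSeq assms by blast

lemma halts_RSeq_eq:
  assumes "nval s i = j" "rval s x = v" "halts orc d (rwrite a j v s) B Q"
  shows "halts orc (Seq (RSet a i x) d) s (B + 2) Q"
  using halts_RSeq assms by blast

section \<open>Division and digits of natural numbers\<close>

text \<open>
  Arrays of naturals: 2 the set to be evaluated, 3 the cells \<open>A\<close>, 4 \<open>L\<close>, 5 \<open>K\<close>, 6 \<open>L\<^bsup>K\<^esup>\<close>, 7 the number
  of operations, 8 the number of guesses, 9 the index of \<open>U\<close>, 10 the guess, 11 the position in
  the guess, 12 the operation, 13 \<open>t\<close>, 14 \<open>i\<close>, 15 \<open>m\<close>, 16--22 division and digits, 23 the candidate,
  26 the scanned element, 28 the selected element; the others are counters and scratch.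
  Arrays of reals: 2 \<open>\<ell>\<close>, 3--5 value, \<open>\<ell>\<close> and weight of the evaluated set, 6 the best value so far,
  7--8 \<open>V\<close>, 9 \<open>D\<close>, 10 \<open>U L\<^bsup>K\<^esup>\<close>, 11 \<open>thr\<close>, 12 \<open>unit\<close>, 13 gain collected by operation 3, 14 gains,
  15 and 20 key and gain of the selected element, 16 gains at the start of the phases, 17 the maximum of
  \<open>f\<close> on singletons, 18 \<open>f(E)\<close>, 19 \<open>a0\<close>.
\<close>

definition divc :: com where
  "divc = blk [NS 19 (NConst 0),
    For 20 (NV 16) (Cond (BNot (NLess (NV 16) (NMul (NAdd (NV 19) (NConst 1)) (NV 17))))
      (NS 19 (NAdd (NV 19) (NConst 1))) Skip)]"

lemma mods_div [simp]: "nmods divc = {19, 20}" "rmods divc = {}"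
  by (auto simp: divc_def)

text \<open>The quotient does not exceed the dividend, so that many rounds suffice; the candidate
  quotient stops rising once it is exact.\<close>

lemma halts_div:
  assumes Y: "0 < nmem s 17 0" and W: "nmem s 16 0 \<le> W" "1 \<le> W"
  shows "halts orc divc s (12 * W) (\<lambda>s'. nmem s' 19 0 = nmem s 16 0 div nmem s 17 0)"
proof -
  let ?X = "nmem s 16 0" and ?Y = "nmem s 17 0"
  let ?b = "Cond (BNot (NLess (NV 16) (NMul (NAdd (NV 19) (NConst 1)) (NV 17)))) (NS 19 (NAdd (NV 19) (NConst 1))) Skip"
  have loop: "halts orc (For 20 (NV 16) ?b) s0 (?X * (2 + 4) + 4) (\<lambda>s'. nmem s' 19 0 = min ?X (?X div ?Y))"
    if s0: "s0 = nwrite 19 0 0 s" for s0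
  proof (rule halts_For[where I = "\<lambda>i s'. nmem s' 19 0 = min i (?X div ?Y)"])
    fix i s' assume I: "i < ?X" "nmem s' 19 0 = min i (?X div ?Y)" "frame (For 20 (NV 16) ?b) s0 s'"
    have e: "nmem s' 16 = nmem s 16" "nmem s' 17 = nmem s 17"
      using frameD(1)[OF I(3), of 16] frameD(1)[OF I(3), of 17] by (simp_all add: s0)
    have c: "Suc q * ?Y \<le> ?X \<longleftrightarrow> q < ?X div ?Y" for q
      using less_eq_div_iff_mult_less_eq[OF Y, of "Suc q" ?X] by auto
    have "bval s' (BNot (NLess (NV 16) (NMul (NAdd (NV 19) (NConst 1)) (NV 17)))) \<longleftrightarrow> i < ?X div ?Y"
      using c[of "min i (?X div ?Y)"] by (auto simp: e I(2) not_less min_def)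
    then show "halts orc ?b s' 2 (\<lambda>s'. nmem s' 19 0 = min (Suc i) (?X div ?Y))"
      using I(2) by (intro halts_weaken[OF halts_Cond_Skip[where B = 1]] halts_NSet) auto
  qed (auto simp: s0)
  have "halts orc divc s (?X * (2 + 4) + 4 + 2) (\<lambda>s'. nmem s' 19 0 = min ?X (?X div ?Y))"
    unfolding divc_def blk.simps by (rule halts_NSeq) (rule loop, simp)
  then show ?thesis
    by (rule halts_weaken) (use W in \<open>auto simp: min_def not_le intro: le_antisym\<close>)
qed

definition digc :: com where
  "digc = blk [For 21 (NV 18) (blk [divc, NS 16 (NV 19)]), divc,
    NS 22 (NSub (NV 16) (NMul (NV 17) (NV 19)))]"

lemma mods_dig [simp]: "nmods digc = {16, 19, 20, 21, 22}" "rmods digc = {}"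
  by (auto simp: digc_def)

lemma halts_dig:
  assumes Y: "0 < nmem s 17 0" and W: "nmem s 16 0 \<le> W" "nmem s 18 0 \<le> W" "1 \<le> W"
  shows "halts orc digc s (60 * W ^ 2) (\<lambda>s'. nmem s' 22 0 = dig (nmem s 17 0) (nmem s 16 0) (nmem s 18 0))"
proof -
  let ?X = "nmem s 16 0" and ?Y = "nmem s 17 0" and ?n = "nmem s 18 0"
  let ?b = "Seq divc (NS 16 (NV 19))"
  have loop: "halts orc (For 21 (NV 18) ?b) s (?n * ((12 * W + 2) + 4) + 4) (\<lambda>s'. nmem s' 16 0 = ?X div ?Y ^ ?n)"
  proof (rule halts_For[where I = "\<lambda>i s'. nmem s' 16 0 = ?X div ?Y ^ i"])
    fix i s' assume I: "nmem s' 16 0 = ?X div ?Y ^ i" "frame (For 21 (NV 18) ?b) s s'"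
    have e: "nmem s' 17 = nmem s 17" using frameD(1)[OF I(2), of 17] by simp
    have "?X div ?Y ^ i \<le> W" using W(1) div_le_dividend le_trans by blast
    then have "halts orc divc s' (12 * W) (\<lambda>s'. nmem s' 19 0 = ?X div ?Y ^ i div ?Y)"
      using halts_div[of s' W orc] Y W by (simp add: e I(1))
    then show "halts orc ?b s' (12 * W + 2) (\<lambda>s'. nmem s' 16 0 = ?X div ?Y ^ Suc i)"
      by (rule halts_Seq[where ?B2.0 = 1], intro halts_NSet) (auto simp: div_mult2_eq[symmetric] mult.commute)
  qed auto
  have "halts orc digc s (?n * ((12 * W + 2) + 4) + 4 + (12 * W + 2) + 1)
     (\<lambda>s'. nmem s' 22 0 = dig ?Y ?X ?n)"
    unfolding digc_def blk.simps
  proof (rule halts_Seq[OF loop _ le_refl])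
    fix s1 assume s1: "nmem s1 16 0 = ?X div ?Y ^ ?n" "frame (For 21 (NV 18) ?b) s s1"
    have e: "nmem s1 17 = nmem s 17" using frameD(1)[OF s1(2), of 17] by simp
    have "?X div ?Y ^ ?n \<le> W" using W(1) div_le_dividend le_trans by blast
    then have "halts orc divc s1 (12 * W) (\<lambda>s'. nmem s' 19 0 = ?X div ?Y ^ ?n div ?Y)"
      using halts_div[of s1 W orc] Y W by (simp add: e s1(1))
    then show "halts orc (Seq divc (NS 22 (NSub (NV 16) (NMul (NV 17) (NV 19))))) s1 (12 * W + 2) (\<lambda>s'. nmem s' 22 0 = dig ?Y ?X ?n)"
    proof (rule halts_Seq[where ?B2.0 = 1], intro halts_NSet)
      fix s2 assume s2: "nmem s2 19 0 = ?X div ?Y ^ ?n div ?Y" "frame divc s1 s2"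
      have "nmem s2 16 = nmem s1 16" "nmem s2 17 = nmem s1 17"
        using frameD(1)[OF s2(2), of 16] frameD(1)[OF s2(2), of 17] by simp_all
      then show "nmem (nwrite 22 (nval s2 (NConst 0)) (nval s2 (NSub (NV 16) (NMul (NV 17) (NV 19)))) s2) 22 0 = dig ?Y ?X ?n"
        by (simp add: s1(1) s2(1) e dig_def minus_mult_div_eq_mod)
    qed simp
  qed
  moreover have "?n * ((12 * W + 2) + 4) + 4 + (12 * W + 2) + 1 \<le> 60 * W ^ 2"
  proof -
    have "?n * ((12 * W + 2) + 4) \<le> W * (18 * W)" by (rule mult_le_mono[OF W(2)]) (use W in simp)
    moreover have "W \<le> W * W" "1 \<le> W * W" using W(3) by auto
    ultimately show ?thesis unfolding power2_eq_square by linarith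
  qed
  ultimately show ?thesis by (rule halts_weaken)
qed

text \<open>\<open>W\<close> is a common bound for \<open>K\<close>, \<open>L\<close> and the number
  of candidates, later also for \<open>N\<close> and \<open>6 ^ N\<close>; with it all running times
  become polynomials in \<open>n\<close> and \<open>W\<close>.\<close>

locale prog = alg n F w L K U
  for n :: nat and F :: "nat set \<Rightarrow> real" and w :: "nat \<Rightarrow> real" and L K :: nat and U :: real +
  fixes orc :: "(nat \<Rightarrow> nat) \<Rightarrow> real" and W :: nat
  assumes orc: "orc v = F {x. x < n \<and> v x \<noteq> 0}"
    and n1: "1 \<le> n" and W1: "1 \<le> W" and KW: "K \<le> W" and LW: "L \<le> W" and NFW: "L ^ K \<le> W"
begin

definition ok0 :: "state \<Rightarrow> bool" where
  "ok0 s \<longleftrightarrow> nmem s 0 0 = n \<and> nmem s 4 0 = L \<and> nmem s 5 0 = K \<and> (\<forall>x<n. rmem s 1 x = w x)"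

definition out :: "state \<Rightarrow> nat set" where
  "out s = {x. x < n \<and> nmem s 1 x \<noteq> 0}"

text \<open>With \<open>\<le>\<close> for the recorded value the property already holds initially,
  for the value 0 and the empty set.\<close>

definition feas :: "state \<Rightarrow> bool" where
  "feas s \<longleftrightarrow> sum w (out s) \<le> 1 \<and> rmem s 6 0 \<le> F (out s)"

end

section \<open>Evaluation of one candidate\<close>

abbreviation NC :: "nat \<Rightarrow> nexp" where "NC \<equiv> NConst"
abbreviation "nN1 \<equiv> NAdd (NV 0) (NC 1)"
abbreviation "n2N1 \<equiv> NMul (NC 2) nN1"

definition "mark e = Cond (NLess (NC 0) (NGet 3 e)) (NSet 2 (NSub (NGet 3 e) (NC 1)) (NC 1)) Skip"

text \<open>
  Every set that is evaluated is also compared with the best feasible set found so far.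
\<close>

definition "load1 = For 24 (NV 0) (NSet 2 (NV 24) (NC 0))"
definition "load2 = For 24 n2N1 (mark (NV 24))"
definition "load3 = For 24 (NV 5) (blk [NS 16 (NV 23), NS 17 (NV 4), NS 18 (NV 24), digc,
    NS 25 (NAdd n2N1 (NAdd (NMul (NV 24) (NV 4)) (NV 22))), mark (NV 25)])"
definition "load4 = For 24 (NV 0) (Cond (NLess (NC 0) (NGet 2 (NV 24)))
    (blk [RS 4 (RAdd (RV 4) (RGet 2 (NV 24))), RS 5 (RAdd (RV 5) (RGet 1 (NV 24)))]) Skip)"
definition "load5 = Cond (BAnd (BNot (RLess (RNat (NC 1)) (RV 5))) (RLess (RV 6) (RV 3)))
    (blk [RS 6 (RV 3), For 24 (NV 0) (NSet 1 (NV 24) (NGet 2 (NV 24)))]) Skip"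

definition load :: com where
  "load = blk [load1, load2, load3, Query 2 3 (NC 0), RS 4 (RNat (NC 0)), RS 5 (RNat (NC 0)), load4, load5]"

lemma mods_mark [simp]: "nmods (mark e) = {2}" "rmods (mark e) = {}"
  by (auto simp: mark_def)

lemma mods_load [simp]:
  "nmods load1 = {2, 24}" "rmods load1 = {}" "nmods load2 = {2, 24}" "rmods load2 = {}"
  "nmods load3 = {2, 16, 17, 18, 19, 20, 21, 22, 24, 25}" "rmods load3 = {}"
  "nmods load4 = {24}" "rmods load4 = {4, 5}" "nmods load5 = {1, 24}" "rmods load5 = {6}"
  "nmods load = {1, 2, 16, 17, 18, 19, 20, 21, 22, 24, 25}" "rmods load = {3, 4, 5, 6}"
  by (auto simp: load_def load1_def load2_def load3_def load4_def load5_def)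

context prog
begin

lemma halts_mark:
  assumes "nval s e = c"
  shows "halts orc (mark e) s 2 (\<lambda>s'. nmem s' 2 = (if nmem s 3 c = 0 then nmem s 2 else (nmem s 2)(nmem s 3 c - 1 := 1)))"
  unfolding mark_def
  by (rule halts_weaken[OF halts_Cond_Skip[where B = 1]], rule halts_NSet) (use assms in auto)

lemma halts_load1: "ok0 s \<Longrightarrow> halts orc load1 s (n * (1 + 4) + 4) (\<lambda>s'. \<forall>x<n. nmem s' 2 x = 0)"
  unfolding load1_def
  by (rule halts_For[where I = "\<lambda>i s'. \<forall>x<i. nmem s' 2 x = 0"])
     (auto simp: ok0_def less_Suc_eq intro!: halts_NSet[unfolded One_nat_def])

lemma halts_load2:
  assumes "ok0 s" "\<forall>x<n. nmem s 2 x = 0"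
  shows "halts orc load2 s (2 * Suc n * (2 + 4) + 4)
     (\<lambda>s'. \<forall>x<n. nmem s' 2 x = (if \<exists>c<2 * Suc n. nmem s 3 c = Suc x then 1 else 0))"
  unfolding load2_def
proof (rule halts_For[where I = "\<lambda>i s'. \<forall>x<n. nmem s' 2 x = (if \<exists>c<i. nmem s 3 c = Suc x then 1 else 0)"])
  fix i s' assume I: "\<forall>x<n. nmem s' 2 x = (if \<exists>c<i. nmem s 3 c = Suc x then 1 else 0)" "nmem s' 24 0 = i"
    "frame (For 24 n2N1 (mark (NV 24))) s s'"
  have e: "nmem s' 3 = nmem s 3" using frameD(1)[OF I(3), of 3] by (simp add: mark_def)
  have "halts orc (mark (NV 24)) s' 2
     (\<lambda>s''. nmem s'' 2 = (if nmem s' 3 i = 0 then nmem s' 2 else (nmem s' 2)(nmem s' 3 i - 1 := 1)))"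
    by (rule halts_mark) (simp add: I(2))
  then show "halts orc (mark (NV 24)) s' 2
     (\<lambda>s'. \<forall>x<n. nmem s' 2 x = (if \<exists>c<Suc i. nmem s 3 c = Suc x then 1 else 0))"
    by (rule halts_weaken) (use I(1) e in \<open>auto simp: less_Suc_eq split: if_splits\<close>)
qed (use assms in \<open>auto simp: ok0_def mark_def\<close>)

lemma halts_load3:
  assumes s: "ok0 s" and p: "nmem s 23 0 \<le> W"
    and Q: "\<forall>x<n. nmem s 2 x = (if \<exists>c<2 * Suc n. nmem s 3 c = Suc x then 1 else 0)"
  shows "halts orc load3 s (K * ((60 * W ^ 2 + 20) + 4) + 4)
     (\<lambda>s'. \<forall>x<n. nmem s' 2 x = (if x \<in> its (nmem s 3) (nmem s 23 0) then 1 else 0))"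
proof -
  let ?p = "nmem s 23 0" and ?A = "nmem s 3"
  let ?b = "blk [NS 16 (NV 23), NS 17 (NV 4), NS 18 (NV 24), digc,
    NS 25 (NAdd n2N1 (NAdd (NMul (NV 24) (NV 4)) (NV 22))), mark (NV 25)]"
  let ?I = "\<lambda>i s'. \<forall>x<n. nmem s' 2 x =
     (if (\<exists>c<2 * Suc n. ?A c = Suc x) \<or> (\<exists>j<i. ?A (fcell j (dig L ?p j)) = Suc x) then 1 else 0)"
  have mods: "nmods ?b = {2, 16, 17, 18, 19, 20, 21, 22, 25}" "rmods ?b = {}" by (auto simp: mark_def)
  have "halts orc (For 24 (NV 5) ?b) s (K * ((60 * W ^ 2 + 20) + 4) + 4) (?I K)"
  proof (rule halts_For[where I = ?I])
    fix i s' assume I: "i < K" "?I i s'" "nmem s' 24 0 = i" "frame (For 24 (NV 5) ?b) s s'"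
    have e: "nmem s' 0 0 = n" "nmem s' 3 = ?A" "nmem s' 4 0 = L" "nmem s' 23 0 = ?p"
      using frameD(1)[OF I(4), of 0] frameD(1)[OF I(4), of 3] frameD(1)[OF I(4), of 4] frameD(1)[OF I(4), of 23] s
      by (simp_all add: mods ok0_def)
    let ?s1 = "nwrite 18 0 i (nwrite 17 0 L (nwrite 16 0 ?p s'))"
    have d: "halts orc digc ?s1 (60 * W ^ 2) (\<lambda>s'. nmem s' 22 0 = dig L ?p i)"
      using halts_dig[of ?s1 W orc] L1 p I(1) KW W1 by simp
    have T: "halts orc (Seq digc (Seq (NS 25 (NAdd n2N1 (NAdd (NMul (NV 24) (NV 4)) (NV 22)))) (mark (NV 25)))) ?s1
      (60 * W ^ 2 + (2 + 2) + 1) (?I (Suc i))"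
    proof (rule halts_Seq[OF halts_with_frame[OF d] _ le_refl])
      fix s2 assume s2: "nmem s2 22 0 = dig L ?p i \<and> frame digc ?s1 s2"
      then have f: "frame digc ?s1 s2" by simp
      have e2: "nmem s2 0 0 = n" "nmem s2 3 = ?A" "nmem s2 4 0 = L" "nmem s2 2 = nmem s' 2" "nmem s2 24 0 = i"
        using frameD(1)[OF f, of 0] frameD(1)[OF f, of 3] frameD(1)[OF f, of 4] frameD(1)[OF f, of 2]
          frameD(1)[OF f, of 24] e I(3) by simp_all
      let ?s3 = "nwrite 25 0 (fcell i (dig L ?p i)) s2"
      have m: "halts orc (mark (NV 25)) ?s3 2 (\<lambda>s''. nmem s'' 2 =
         (if ?A (fcell i (dig L ?p i)) = 0 then nmem s' 2 else (nmem s' 2)(?A (fcell i (dig L ?p i)) - 1 := 1)))"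
        by (rule halts_weaken[OF halts_mark[of ?s3 "NV 25" "fcell i (dig L ?p i)"]]) (use e2 in \<open>auto split: if_splits\<close>)
      have "halts orc (mark (NV 25)) ?s3 2 (?I (Suc i))"
        by (rule halts_weaken[OF m]) (use I(2) in \<open>auto simp: less_Suc_eq split: if_splits\<close>)
      then show "halts orc (Seq (NS 25 (NAdd n2N1 (NAdd (NMul (NV 24) (NV 4)) (NV 22)))) (mark (NV 25))) s2 (2 + 2) (?I (Suc i))"
        using e2 s2 by (intro halts_NSeq) (simp add: fcell_def algebra_simps)
    qed
    have "halts orc ?b s' ((60 * W ^ 2 + (2 + 2) + 1) + 2 + 2 + 2) (?I (Suc i))"
      unfolding blk.simps
      by (rule halts_NSeq_eq[where j = 0 and v = ?p], simp, simp add: e, rule halts_NSeq_eq[where j = 0 and v = L],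
          simp, simp add: e, rule halts_NSeq_eq[where j = 0 and v = i], simp, simp add: I(3), rule T)
    then show "halts orc ?b s' (60 * W ^ 2 + 20) (?I (Suc i))" by (rule halts_weaken) simp_all
  qed (use Q s in \<open>auto simp: mods ok0_def\<close>)
  then show ?thesis unfolding load3_def
    by (rule halts_weaken) (auto simp: items_def fcell_def)
qed

end

section \<open>Sums over all candidates, and the search for an element\<close>

definition evalc :: com where
  "evalc = blk [RS 7 (RNat (NC 0)), For 23 (NV 6) (blk [load,
     RS 7 (RAdd (RV 7) (RAdd (RMul (RV 9) (RV 3)) (RMul (RSub (RNat (NC 1)) (RV 9)) (RV 4))))])]"

lemma mods_eval [simp]:
  "nmods evalc = {1, 2, 16, 17, 18, 19, 20, 21, 22, 23, 24, 25}" "rmods evalc = {3, 4, 5, 6, 7}"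
  by (auto simp: evalc_def)

text \<open>For each trial the cell is overwritten and the sum evaluated afresh; the old content,
  saved in array 27, is restored before the condition is tested. Array 3 is therefore unchanged in
  the end, although \<open>nmods\<close> lists it.\<close>

definition scan :: "nat \<Rightarrow> nexp \<Rightarrow> bexp \<Rightarrow> rexp \<Rightarrow> com" where
  "scan r ce cd ke = blk [evalc, RS 8 (RV 7), NS 28 (NC 0), RS 20 (RNat (NC 0)),
     For 26 (NV 0) (blk [NS 27 (NGet 3 ce), NSet 3 ce (NAdd (NV 26) (NC 1)), evalc, NSet 3 ce (NV 27),
       RSet r (NV 26) (RSub (RV 7) (RV 8)),
       Cond (BAnd cd (BNot (BAnd (NLess (NC 0) (NV 28)) (BNot (RLess ke (RV 15))))))
         (blk [NS 28 (NAdd (NV 26) (NC 1)), RS 15 ke, RS 20 (RGet r (NV 26))]) Skip])]"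

lemma mods_scan [simp]:
  "nmods (scan r ce cd ke) = {1, 2, 3, 16, 17, 18, 19, 20, 21, 22, 23, 24, 25, 26, 27, 28}"
  "rmods (scan r ce cd ke) = {3, 4, 5, 6, 7, 8, 15, 20, r}"
  by (auto simp: scan_def)

context prog
begin

lemma ok0_frame: "ok0 s \<Longrightarrow> frame c s s' \<Longrightarrow> {0, 4, 5} \<inter> nmods c = {} \<Longrightarrow> 1 \<notin> rmods c \<Longrightarrow> ok0 s'"
  by (auto simp: ok0_def frame_def)

lemma feas_frame: "feas s \<Longrightarrow> frame c s s' \<Longrightarrow> 1 \<notin> nmods c \<Longrightarrow> 6 \<notin> rmods c \<Longrightarrow> feas s'"
  by (auto simp: feas_def out_def frame_def)

lemma halts_load4:
  assumes s: "ok0 s" "rmem s 4 0 = 0" "rmem s 5 0 = 0" and T: "T \<subseteq> {..<n}"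
    and Q: "\<forall>x<n. nmem s 2 x = (if x \<in> T then 1 else 0)"
  shows "halts orc load4 s (n * (4 + 4) + 4) (\<lambda>s'. rmem s' 4 0 = (\<Sum>x\<in>T. rmem s 2 x) \<and> rmem s' 5 0 = sum w T)"
proof -
  let ?b = "Cond (NLess (NC 0) (NGet 2 (NV 24)))
    (blk [RS 4 (RAdd (RV 4) (RGet 2 (NV 24))), RS 5 (RAdd (RV 5) (RGet 1 (NV 24)))]) Skip"
  let ?I = "\<lambda>i s'. rmem s' 4 0 = (\<Sum>x\<in>T \<inter> {..<i}. rmem s 2 x) \<and> rmem s' 5 0 = sum w (T \<inter> {..<i})"
  have "halts orc (For 24 (NV 0) ?b) s (n * (4 + 4) + 4) (?I n)"
  proof (rule halts_For[where I = ?I])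
    fix i s' assume I: "i < n" "?I i s'" "nmem s' 24 0 = i" "frame (For 24 (NV 0) ?b) s s'"
    have e: "nmem s' 2 = nmem s 2" "rmem s' 2 = rmem s 2" "rmem s' 1 i = w i"
      using I(1,4) s by (simp_all add: frame_def ok0_def)
    have T': "T \<inter> {..<Suc i} = (if i \<in> T then insert i (T \<inter> {..<i}) else T \<inter> {..<i})"
      by (auto simp: less_Suc_eq)
    have "halts orc ?b s' (3 + 1) (?I (Suc i))"
      unfolding blk.simps
    proof (rule halts_Cond_Skip)
      assume "bval s' (NLess (NC 0) (NGet 2 (NV 24)))"
      then have "i \<in> T" using e I Q by (simp split: if_splits)
      then have "halts orc (Seq (RS 4 (RAdd (RV 4) (RGet 2 (NV 24)))) (RS 5 (RAdd (RV 5) (RGet 1 (NV 24))))) s' (1 + 2) (?I (Suc i))"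
        using e I by (intro halts_RSeq halts_RSet) (simp add: T')
      then show "halts orc (Seq (RS 4 (RAdd (RV 4) (RGet 2 (NV 24)))) (RS 5 (RAdd (RV 5) (RGet 1 (NV 24))))) s' 3 (?I (Suc i))"
        by (rule halts_weaken) auto
    next
      assume "\<not> bval s' (NLess (NC 0) (NGet 2 (NV 24)))"
      then have "i \<notin> T" using e I Q by (simp split: if_splits)
      then show "?I (Suc i) s'" using I by (simp add: T')
    qed
    then show "halts orc ?b s' 4 (?I (Suc i))" by simp
  qed (use s in \<open>auto simp: ok0_def\<close>)
  moreover have "T \<inter> {..<n} = T" using T by auto
  ultimately show ?thesis by (simp add: load4_def)
qed

lemma halts_load5:
  assumes s: "ok0 s" "feas s" and T: "T \<subseteq> {..<n}" and F: "rmem s 3 0 = F T" "rmem s 5 0 = sum w T"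
    and Q: "\<forall>x<n. nmem s 2 x = (if x \<in> T then 1 else 0)"
  shows "halts orc load5 s (n * (1 + 4) + 4 + 2 + 1)
    (\<lambda>s'. feas s' \<and> rmem s 6 0 \<le> rmem s' 6 0 \<and> (sum w T \<le> 1 \<longrightarrow> F T \<le> rmem s' 6 0))"
  unfolding load5_def blk.simps
proof (rule halts_Cond_Skip)
  assume b: "bval s (BAnd (BNot (RLess (RNat (NC 1)) (RV 5))) (RLess (RV 6) (RV 3)))"
  show "halts orc (Seq (RS 6 (RV 3)) (For 24 (NV 0) (NSet 1 (NV 24) (NGet 2 (NV 24))))) s (n * (1 + 4) + 4 + 2)
    (\<lambda>s'. feas s' \<and> rmem s 6 0 \<le> rmem s' 6 0 \<and> (sum w T \<le> 1 \<longrightarrow> F T \<le> rmem s' 6 0))"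
  proof (rule halts_RSeq)
    let ?s = "rwrite 6 (nval s (NConst 0)) (rval s (RV 3)) s"
    let ?b = "NSet 1 (NV 24) (NGet 2 (NV 24))"
    have "halts orc (For 24 (NV 0) ?b) ?s (n * (1 + 4) + 4) (\<lambda>s'. \<forall>x<n. nmem s' 1 x = nmem s 2 x)"
    proof (rule halts_For[where I = "\<lambda>i s'. \<forall>x<i. nmem s' 1 x = nmem s 2 x"])
      fix i s' assume I: "\<forall>x<i. nmem s' 1 x = nmem s 2 x" "nmem s' 24 0 = i" "frame (For 24 (NV 0) ?b) ?s s'"
      have "nmem s' 2 = nmem s 2" using I(3) by (simp add: frame_def)
      then show "halts orc ?b s' 1 (\<lambda>s'. \<forall>x<Suc i. nmem s' 1 x = nmem s 2 x)"
        using I(1,2) by (intro halts_NSet) (simp add: less_Suc_eq)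
    qed (use s in \<open>auto simp: ok0_def\<close>)
    then show "halts orc (For 24 (NV 0) ?b) ?s (n * (1 + 4) + 4)
      (\<lambda>s'. feas s' \<and> rmem s 6 0 \<le> rmem s' 6 0 \<and> (sum w T \<le> 1 \<longrightarrow> F T \<le> rmem s' 6 0))"
    proof (rule halts_mono)
      fix s' assume s': "\<forall>x<n. nmem s' 1 x = nmem s 2 x" "frame (For 24 (NV 0) ?b) ?s s'"
      have "rmem s' 6 0 = F T" using s'(2) F(1) by (simp add: frame_def)
      moreover have "out s' = T" using s'(1) Q T by (auto simp: out_def split: if_splits)
      ultimately show "feas s' \<and> rmem s 6 0 \<le> rmem s' 6 0 \<and> (sum w T \<le> 1 \<longrightarrow> F T \<le> rmem s' 6 0)"
        using b F by (simp add: feas_def)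
    qed simp
  qed
next
  assume "\<not> bval s (BAnd (BNot (RLess (RNat (NC 1)) (RV 5))) (RLess (RV 6) (RV 3)))"
  then show "feas s \<and> rmem s 6 0 \<le> rmem s 6 0 \<and> (sum w T \<le> 1 \<longrightarrow> F T \<le> rmem s 6 0)"
    using s(2) F by auto
qed

lemma load_time:
  "(n * (1 + 4) + 4) + (2 * Suc n * (2 + 4) + 4) + (K * ((60 * W ^ 2 + 20) + 4) + 4) + (n * (4 + 4) + 4)
    + (n * (1 + 4) + 4 + 2 + 1) + 50 \<le> 200 * n * W ^ 3"
proof -
  have "60 * W ^ 2 + 24 \<le> 84 * W ^ 2" using W1 by simp
  then have "K * ((60 * W ^ 2 + 20) + 4) \<le> W * (84 * W ^ 2)" using KW by (intro mult_le_mono) auto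
  also have "\<dots> = 84 * W ^ 3" by (simp add: power2_eq_square power3_eq_cube)
  also have "\<dots> \<le> 84 * (n * W ^ 3)" using n1 by simp
  finally have "K * ((60 * W ^ 2 + 20) + 4) \<le> 84 * (n * W ^ 3)" .
  moreover have "n * 1 \<le> n * W ^ 3" using W1 by (intro mult_le_mono2) simp
  moreover have "X \<le> 84 * Y \<Longrightarrow> n * 1 \<le> Y \<Longrightarrow> (n * (1 + 4) + 4) + (2 * Suc n * (2 + 4) + 4) + (X + 4)
      + (n * (4 + 4) + 4) + (n * (1 + 4) + 4 + 2 + 1) + 50 \<le> 200 * Y" for X Y
    using n1 by simp
  ultimately show ?thesis by (simp only: mult.assoc)
qed

lemma halts_load:
  assumes s: "ok0 s" "feas s" and p: "nmem s 23 0 \<le> W"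
  defines "T \<equiv> its (nmem s 3) (nmem s 23 0)"
  shows "halts orc load s (200 * n * W ^ 3) (\<lambda>s'. rmem s' 3 0 = F T \<and> rmem s' 4 0 = (\<Sum>x\<in>T. rmem s 2 x)
     \<and> feas s' \<and> rmem s 6 0 \<le> rmem s' 6 0 \<and> (sum w T \<le> 1 \<longrightarrow> F T \<le> rmem s' 6 0))"
  unfolding halts_def load_def blk.simps
  apply (rule wpt_Seq, rule wpt_use[OF halts_load1[OF s(1)]])
  subgoal premises p1 for t1 s1
    apply (rule wpt_Seq, rule wpt_use[OF halts_load2[OF _ p1(2)]])
    subgoal by (rule ok0_frame[OF s(1) p1(3)]) auto
    subgoal premises p2 for t2 s2
    proof -
      have f2: "frame load2 s1 s2" using p2(3) .
      have e2: "nmem s2 3 = nmem s 3" "nmem s1 3 = nmem s 3" "nmem s2 23 = nmem s 23" "rmem s2 = rmem s"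
        using p1(3) f2 by (simp_all add: frame_def fun_eq_iff)
      have o2: "ok0 s2" using s(1) p1(3) f2 by (auto simp: ok0_def frame_def)
      have g2: "feas s2" using s(2) p1(3) f2 by (auto simp: feas_def out_def frame_def)
      have Q2: "\<forall>x<n. nmem s2 2 x = (if \<exists>c<2 * Suc n. nmem s2 3 c = Suc x then 1 else 0)"
        using p2(2) e2 by simp
      have L3: "halts orc load3 s2 (K * ((60 * W ^ 2 + 20) + 4) + 4) (\<lambda>s'. \<forall>x<n. nmem s' 2 x = (if x \<in> T then 1 else 0))"
        using halts_load3[OF o2 _ Q2] p by (simp add: e2 T_def)
      show ?thesis
        apply (rule wpt_Seq, rule wpt_use[OF L3])
        subgoal premises p3 for t3 s3
          apply (intro wpt_Seq wpt_Query wpt_RSet)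
          apply (rule wpt_use[OF halts_load4[where T = T]])
          subgoal using o2 p3(3) by (auto simp: ok0_def frame_def)
          subgoal by simp
          subgoal by simp
          subgoal by (simp add: T_def its_sub)
          subgoal using p3(2) by simp
          subgoal premises p4 for t4 s4
          proof -
            let ?s3 = "rwrite 5 0 0 (rwrite 4 0 0 (rwrite 3 0 (orc (nmem s3 2)) s3))"
            have f4: "frame load4 ?s3 s4" using p4(3) by simp
            have "orc (nmem s3 2) = F T"
              unfolding orc using p3(2) its_sub[of "nmem s 3" "nmem s 23 0"]
              by (intro arg_cong[of _ _ F]) (auto simp: T_def split: if_splits)
            then have F4: "rmem s4 3 0 = F T" using f4 by (simp add: frame_def)
            have o4: "ok0 s4" using o2 p3(3) f4 by (auto simp: ok0_def frame_def)
            have g4: "feas s4" using g2 p3(3) f4 by (auto simp: feas_def out_def frame_def)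
            have Q4: "\<forall>x<n. nmem s4 2 x = (if x \<in> T then 1 else 0)" using p3(2) f4 by (simp add: frame_def)
            have e4: "rmem s4 6 0 = rmem s 6 0" using f4 p3(3) e2(4) by (simp add: frame_def)
            have e3: "rmem s3 2 = rmem s 2" using p3(3) e2(4) by (simp add: frame_def)
            show ?thesis
              apply (rule wpt_use[OF halts_load5[OF o4 g4 _ F4 _ Q4]])
              subgoal by (simp add: T_def its_sub)
              subgoal using p4(2) by simp
              subgoal premises p5 for t5 s5
              proof -
                have "rmem s5 3 0 = F T" "rmem s5 4 0 = (\<Sum>x\<in>T. rmem s 2 x)"
                  using p5(3) F4 p4(2) e3 by (simp_all add: frame_def)
                moreover have "t5 \<le> 200 * n * W ^ 3"
                  using p1(1) p2(1) p3(1) p4(1) p5(1) load_time by linarith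
                ultimately show ?thesis using p5(2) e4 by simp
              qed
              done
          qed
          done
        done
    qed
    done
  done

definition ok :: "state \<Rightarrow> bool" where
  "ok s \<longleftrightarrow> ok0 s \<and> nmem s 6 0 = L ^ K \<and> (\<forall>x<n. rmem s 2 x = ell x)"

lemma ok_frame: "ok s \<Longrightarrow> frame c s s' \<Longrightarrow> {0, 4, 5, 6} \<inter> nmods c = {} \<Longrightarrow> {1, 2} \<inter> rmods c = {} \<Longrightarrow> ok s'"
  by (auto simp: ok_def ok0_def frame_def)

lemma halts_eval:
  assumes s: "ok s" "feas s"
  shows "halts orc evalc s (220 * n * W ^ 4) (\<lambda>s'. rmem s' 7 0 = V (rmem s 9 0) (nmem s 3)
     \<and> feas s' \<and> rmem s 6 0 \<le> rmem s' 6 0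
     \<and> (\<forall>p<L ^ K. sum w (its (nmem s 3) p) \<le> 1 \<longrightarrow> F (its (nmem s 3) p) \<le> rmem s' 6 0))"
proof -
  let ?b = "Seq load (RS 7 (RAdd (RV 7) (RAdd (RMul (RV 9) (RV 3)) (RMul (RSub (RNat (NC 1)) (RV 9)) (RV 4)))))"
  let ?A = "nmem s 3" and ?D = "rmem s 9 0"
  let ?s = "rwrite 7 (nval s (NConst 0)) (rval s (RNat (NC 0))) s"
  let ?I = "\<lambda>i s'. rmem s' 7 0 = (\<Sum>p<i. h ?D (its ?A p)) \<and> feas s' \<and> rmem s 6 0 \<le> rmem s' 6 0
     \<and> (\<forall>p<i. sum w (its ?A p) \<le> 1 \<longrightarrow> F (its ?A p) \<le> rmem s' 6 0)"
  let ?B = "200 * n * W ^ 3 + 2"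
  have "halts orc (For 23 (NV 6) ?b) ?s (L ^ K * (?B + 4) + 4) (?I (L ^ K))"
  proof (rule halts_For[where I = ?I])
    fix i s' assume I: "i < L ^ K" "?I i s'" "nmem s' 23 0 = i" "frame (For 23 (NV 6) ?b) ?s s'"
    have e: "nmem s' 3 = ?A" "rmem s' 9 = rmem s 9" "rmem s' 2 = rmem s 2"
      using I(4) by (simp_all add: frame_def)
    have o: "ok0 s'" using s(1) I(4) by (auto simp: ok_def ok0_def frame_def)
    have iW: "nmem s' 23 0 \<le> W" using I(1,3) NFW by simp
    have ell: "(\<Sum>x\<in>its ?A i. rmem s 2 x) = sum ell (its ?A i)"
      by (rule sum.cong) (use s(1) e its_sub in \<open>auto simp: ok_def\<close>)
    show "halts orc ?b s' ?B (?I (Suc i))"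
    proof (rule halts_Seq[OF halts_load[OF o _ iW], where ?B2.0 = 1])
      show "feas s'" using I(2) by simp
      fix s1 assume s1: "rmem s1 3 0 = F (its (nmem s' 3) (nmem s' 23 0)) \<and>
          rmem s1 4 0 = (\<Sum>x\<in>its (nmem s' 3) (nmem s' 23 0). rmem s' 2 x) \<and> feas s1 \<and> rmem s' 6 0 \<le> rmem s1 6 0 \<and>
          (sum w (its (nmem s' 3) (nmem s' 23 0)) \<le> 1 \<longrightarrow> F (its (nmem s' 3) (nmem s' 23 0)) \<le> rmem s1 6 0)"
        "frame load s' s1"
      have e1: "rmem s1 7 = rmem s' 7" "rmem s1 9 = rmem s 9" using s1(2) e by (simp_all add: frame_def)
      have s1': "rmem s1 3 0 = F (its ?A i)" "rmem s1 4 0 = sum ell (its ?A i)" "feas s1" "rmem s' 6 0 \<le> rmem s1 6 0"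
        "sum w (its ?A i) \<le> 1 \<longrightarrow> F (its ?A i) \<le> rmem s1 6 0"
        using s1(1) by (simp_all add: e I(3) ell)
      have g: "\<forall>p<Suc i. sum w (its ?A p) \<le> 1 \<longrightarrow> F (its ?A p) \<le> rmem s1 6 0"
        using s1'(4,5) I(2) by (auto simp: less_Suc_eq intro: order_trans)
      have fe: "feas (rwrite 7 0 v s1)" for v
        using s1'(3) by (simp add: feas_def out_def)
      show "halts orc (RS 7 (RAdd (RV 7) (RAdd (RMul (RV 9) (RV 3)) (RMul (RSub (RNat (NC 1)) (RV 9)) (RV 4))))) s1 1 (?I (Suc i))"
        by (rule halts_RSet) (use s1' I(2) g fe e1 in \<open>simp add: h_def\<close>)
    qed simp
  qed (use s in \<open>auto simp: ok_def ok0_def feas_def out_def\<close>)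
  then have "halts orc evalc s ((L ^ K * (?B + 4) + 4) + 2) (?I (L ^ K))"
    unfolding evalc_def blk.simps by (rule halts_RSeq)
  then show ?thesis
  proof (rule halts_weaken)
    have "L ^ K * (?B + 4) \<le> W * (206 * n * W ^ 3)"
      using NFW n1 W1 by (intro mult_le_mono) (auto simp: algebra_simps intro: order_trans[of _ "n * 1"])
    also have "\<dots> = 206 * n * W ^ 4" by (simp add: power4_eq_xxxx power3_eq_cube)
    finally have "L ^ K * (?B + 4) \<le> 206 * (n * W ^ 4)" by simp
    moreover have "1 * 1 \<le> n * W ^ 4" using n1 W1 by (intro mult_le_mono) auto
    moreover have "X \<le> 206 * Y \<Longrightarrow> 1 * 1 \<le> Y \<Longrightarrow> (X + 4) + 2 \<le> 220 * Y" for X Y :: nat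
      by simp
    ultimately show "(L ^ K * (?B + 4) + 4) + 2 \<le> 220 * n * W ^ 4" by (simp only: mult.assoc)
  qed (auto simp: V_def)
qed

end

lemma halts_frame_step:
  assumes "frame c s s'" shows "a \<in> nmods c \<Longrightarrow> frame c s (nwrite a i v s')" "b \<in> rmods c \<Longrightarrow> frame c s (rwrite b i u s')"
  using assms by (auto simp: frame_def)

lemma frame_sub: "frame c s s' \<Longrightarrow> nmods c \<subseteq> nmods d \<Longrightarrow> rmods c \<subseteq> rmods d \<Longrightarrow> frame d s s'"
  by (auto simp: frame_def)

context prog
begin

lemma feas_write: "ar \<noteq> 1 \<Longrightarrow> feas (nwrite ar i v s) = feas s" "b \<noteq> 6 \<Longrightarrow> feas (rwrite b i u s) = feas s"
  by (auto simp: feas_def out_def)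

lemma ok_write: "ar \<notin> {0, 4, 5, 6} \<Longrightarrow> ok (nwrite ar i v s) = ok s" "b \<notin> {1, 2} \<Longrightarrow> ok (rwrite b i u s) = ok s"
  by (auto simp: ok_def ok0_def)

abbreviation "TE \<equiv> 220 * n * W ^ 4"

text \<open>The hypotheses let the expressions depend on the scanned element and on everything that
  the scan leaves alone; \<open>cd\<close> and \<open>ke\<close> may in addition read the gain that
  has just been stored in array \<open>r\<close>.\<close>

lemma halts_scan:
  assumes s: "ok s" "feas s" and r: "r = 14 \<or> r = 16"
    and ce: "\<And>s' x. x < n \<Longrightarrow> nmem s' 26 0 = x \<Longrightarrow> frame (scan r ce cd ke) s s' \<Longrightarrow> nval s' ce = cf x"
    and cd: "\<And>s' x. x < n \<Longrightarrow> nmem s' 26 0 = x \<Longrightarrow> frame (scan r ce cd ke) s s'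
      \<Longrightarrow> rmem s' r x = gain (rmem s 9 0) (nmem s 3) (cf x) x \<Longrightarrow> bval s' cd = c x"
    and ke: "\<And>s' x. x < n \<Longrightarrow> nmem s' 26 0 = x \<Longrightarrow> frame (scan r ce cd ke) s s'
      \<Longrightarrow> rmem s' r x = gain (rmem s 9 0) (nmem s 3) (cf x) x \<Longrightarrow> rval s' ke = kk x"
  shows "halts orc (scan r ce cd ke) s (500 * n ^ 2 * W ^ 4) (\<lambda>s'. nmem s' 3 = nmem s 3 \<and> nmem s' 28 0 = scanf c kk n
     \<and> rmem s' 20 0 = (if scanf c kk n = 0 then 0 else gain (rmem s 9 0) (nmem s 3) (cf (scanf c kk n - 1)) (scanf c kk n - 1))
     \<and> (\<forall>x<n. rmem s' r x = gain (rmem s 9 0) (nmem s 3) (cf x) x) \<and> feas s' \<and> rmem s 6 0 \<le> rmem s' 6 0)"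
proof -
  let ?A = "nmem s 3" and ?D = "rmem s 9 0"
  let ?G = "\<lambda>x. gain ?D ?A (cf x) x"
  let ?S = "scan r ce cd ke"
  let ?cond = "BAnd cd (BNot (BAnd (NLess (NC 0) (NV 28)) (BNot (RLess ke (RV 15)))))"
  let ?upd = "blk [NS 28 (NAdd (NV 26) (NC 1)), RS 15 ke, RS 20 (RGet r (NV 26))]"
  let ?b = "blk [NS 27 (NGet 3 ce), NSet 3 ce (NAdd (NV 26) (NC 1)), evalc, NSet 3 ce (NV 27),
       RSet r (NV 26) (RSub (RV 7) (RV 8)), Cond ?cond ?upd Skip]"
  have mb: "nmods ?b = {1, 2, 3, 16, 17, 18, 19, 20, 21, 22, 23, 24, 25, 27, 28}" "rmods ?b = {3, 4, 5, 6, 7, 15, 20, r}"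
    by auto
  let ?I = "\<lambda>i s'. nmem s' 3 = ?A \<and> nmem s' 28 0 = scanf c kk i
     \<and> (nmem s' 28 0 \<noteq> 0 \<longrightarrow> rmem s' 15 0 = kk (nmem s' 28 0 - 1))
     \<and> rmem s' 20 0 = (if scanf c kk i = 0 then 0 else ?G (scanf c kk i - 1))
     \<and> (\<forall>x<i. rmem s' r x = ?G x) \<and> feas s' \<and> rmem s 6 0 \<le> rmem s' 6 0"
  have loop: "halts orc (For 26 (NV 0) ?b) s0 (n * ((TE + 20) + 4) + 4) (?I n)"
    if fr0: "frame ?S s s0" and I0: "?I 0 s0" and V0: "rmem s0 8 0 = V ?D ?A" for s0
  proof (rule halts_For[where I = ?I])
    fix i s' assume I: "i < n" "?I i s'" "nmem s' 26 0 = i" "frame (For 26 (NV 0) ?b) s0 s'"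
    have fr: "frame ?S s s'"
      by (rule frame_trans[OF fr0], rule frame_sub[OF I(4)]) (auto simp: mb)
    have V0': "rmem s' 8 0 = V ?D ?A" using frameD(2)[OF I(4), of 8] V0 r by (auto simp: mb)
    have frc: "nval x ce = cf i" if "frame ?S s x" "nmem x 26 0 = i" for x
      by (rule ce[OF I(1) that(2,1)])
    let ?s1 = "nwrite 27 0 (?A (cf i)) s'"
    let ?s2 = "nwrite 3 (cf i) (Suc i) ?s1"
    have fr1: "frame ?S s ?s1" by (rule halts_frame_step[OF fr]) simp
    have fr2: "frame ?S s ?s2" by (rule halts_frame_step[OF fr1]) simp
    have n1: "nmem ?s1 26 0 = i" "nmem ?s2 26 0 = i" using I(3) by simp_all
    have o2: "ok ?s2" by (rule ok_frame[OF s(1) fr2]) (use r in auto)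
    have g2: "feas ?s2" using I(2) by (simp add: feas_write)
    have c0: "nval s' ce = cf i" "nval ?s1 ce = cf i" "nval ?s2 ce = cf i" using frc fr fr1 fr2 n1 I(3) by blast+
    have D2: "rmem ?s2 9 0 = ?D" using frameD(2)[OF fr2, of 9] r by auto
    have A2: "nmem ?s2 3 = ?A(cf i := Suc i)" using I(2) by simp
    have T: "halts orc (Seq evalc (Seq (NSet 3 ce (NV 27)) (Seq (RSet r (NV 26) (RSub (RV 7) (RV 8)))
        (Cond ?cond (blk [NS 28 (NAdd (NV 26) (NC 1)), RS 15 ke, RS 20 (RGet r (NV 26))]) Skip)))) ?s2 (TE + 11) (?I (Suc i))"
    proof (rule halts_Seq[OF halts_eval[OF o2 g2], where ?B2.0 = "10"])
      fix s3 assume s3: "rmem s3 7 0 = V (rmem ?s2 9 0) (nmem ?s2 3) \<and> feas s3 \<and> rmem ?s2 6 0 \<le> rmem s3 6 0 \<and>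
          (\<forall>p<L ^ K. sum w (its (nmem ?s2 3) p) \<le> 1 \<longrightarrow> F (its (nmem ?s2 3) p) \<le> rmem s3 6 0)"
        and f3: "frame evalc ?s2 s3"
      have fr3: "frame ?S s s3" by (rule frame_trans[OF fr2], rule frame_sub[OF f3]) auto
      have n3: "nmem s3 26 0 = i" "nmem s3 27 0 = ?A (cf i)" "nmem s3 3 = ?A(cf i := Suc i)" "nmem s3 28 = nmem s' 28"
        "rmem s3 8 = rmem s' 8" "rmem s3 15 = rmem s' 15" "rmem s3 20 = rmem s' 20" "rmem s3 r = rmem s' r"
        using f3 I(2,3) r by (auto simp: frame_def)
      have c3: "nval s3 ce = cf i" by (rule frc[OF fr3 n3(1)])
      let ?s4 = "nwrite 3 (cf i) (?A (cf i)) s3"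
      have fr4: "frame ?S s ?s4" by (rule halts_frame_step[OF fr3]) simp
      have A4: "nmem ?s4 3 = ?A" using n3 by simp
      let ?s5 = "rwrite r i (?G i) ?s4"
      have fr5: "frame ?S s ?s5" by (rule halts_frame_step[OF fr4]) simp
      have e5: "rmem ?s4 7 0 - rmem ?s4 8 0 = ?G i"
        using s3 n3 V0' D2 A2 by (simp add: gain_def)
      have r5: "rmem ?s5 r i = ?G i" "nmem ?s5 26 0 = i" using n3 by simp_all
      have cd5: "bval ?s5 cd = c i" by (rule cd[OF I(1) r5(2) fr5 r5(1)])
      have ke5: "rval ?s5 ke = kk i" by (rule ke[OF I(1) r5(2) fr5 r5(1)])
      have r15: "rmem ?s5 15 0 = rmem s' 15 0" "rmem ?s5 20 0 = rmem s' 20 0" "rmem ?s5 6 0 = rmem s3 6 0"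
        "nmem ?s5 28 0 = nmem s' 28 0" "nmem ?s5 3 = ?A" "\<forall>x<Suc i. rmem ?s5 r x = ?G x"
        using n3 r I(2) A4 by (auto simp: less_Suc_eq)
      have f5: "feas ?s5" using s3 r by (auto simp: feas_write)
      have b5: "rmem s 6 0 \<le> rmem ?s5 6 0" using s3 I(2) r15(3) by simp
      have bc: "bval ?s5 ?cond \<longleftrightarrow> c i \<and> (scanf c kk i = 0 \<or> kk i < kk (scanf c kk i - 1))"
        using cd5 ke5 r15 I(2) by auto
      have TC: "halts orc (Cond ?cond ?upd Skip) ?s5 ((1 + 2 + 2) + 1) (?I (Suc i))"
      proof (rule halts_Cond_Skip)
        assume "bval ?s5 ?cond"
        then have "c i \<and> (scanf c kk i = 0 \<or> kk i < kk (scanf c kk i - 1))" unfolding bc .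
        then have sc: "scanf c kk (Suc i) = Suc i" by (simp add: Let_def)
        let ?s6 = "nwrite 28 0 (Suc i) ?s5"
        have fr6: "frame ?S s ?s6" by (rule halts_frame_step[OF fr5]) simp
        have ke6: "rval ?s6 ke = kk i"
          by (rule ke[OF I(1) _ fr6]) (use r5 in simp_all)
        show "halts orc ?upd ?s5 (1 + 2 + 2) (?I (Suc i))"
          unfolding blk.simps
          apply (intro halts_NSeq halts_RSeq halts_RSet)
          using r5 sc r15 f5 b5 r ke6 by (auto simp: feas_write)
      next
        assume "\<not> bval ?s5 ?cond"
        then have "\<not> (c i \<and> (scanf c kk i = 0 \<or> kk i < kk (scanf c kk i - 1)))" unfolding bc .
        then have sc: "scanf c kk (Suc i) = scanf c kk i" by (auto simp: Let_def)
        show "?I (Suc i) ?s5"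
          unfolding sc using r15 f5 b5 I(2) by (simp only:) simp
      qed
      have "halts orc (Seq (NSet 3 ce (NV 27)) (Seq (RSet r (NV 26) (RSub (RV 7) (RV 8)))
        (Cond ?cond ?upd Skip))) s3 (((1 + 2 + 2) + 1) + 2 + 2) (?I (Suc i))"
        by (rule halts_NSeq_eq[where j = "cf i" and v = "?A (cf i)"], use c3 in simp, use n3 in simp,
            rule halts_RSeq_eq[where j = i and v = "?G i"], use n3 in simp, use e5 in simp, rule TC)
      then show "halts orc (Seq (NSet 3 ce (NV 27)) (Seq (RSet r (NV 26) (RSub (RV 7) (RV 8)))
        (Cond ?cond ?upd Skip))) s3 10 (?I (Suc i))"
        by (rule halts_weaken) simp_all
    qed simp
    have "halts orc ?b s' ((TE + 11) + 2 + 2) (?I (Suc i))"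
      unfolding blk.simps
      by (rule halts_NSeq_eq[where j = 0 and v = "?A (cf i)"], simp, use I(2) c0 in simp,
          rule halts_NSeq_eq[where j = "cf i" and v = "Suc i"], use c0 in simp, use n1 in simp,
          rule T[unfolded blk.simps])
    then show "halts orc ?b s' (TE + 20) (?I (Suc i))" by (rule halts_weaken) simp_all
  next
    show "nval s0 (NV 0) = n" using frameD(1)[OF fr0, of 0] s(1) by (simp add: ok_def ok0_def)
    show "26 \<notin> nmods ?b" "nreads (NV 0) \<inter> insert 26 (nmods ?b) = {}" unfolding mb by simp_all
    show "?I 0 s0" by (rule I0)
  qed (auto simp: feas_write)
  have "halts orc ?S s (TE + ((n * ((TE + 20) + 4) + 4) + 2 + 2 + 2) + 1) (?I n)"
    unfolding scan_def blk.simps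
  proof (rule halts_Seq[OF halts_eval[OF s] _ le_refl])
    fix s1 assume s1: "rmem s1 7 0 = V ?D ?A \<and> feas s1 \<and> rmem s 6 0 \<le> rmem s1 6 0 \<and>
       (\<forall>p<L ^ K. sum w (its ?A p) \<le> 1 \<longrightarrow> F (its ?A p) \<le> rmem s1 6 0)" "frame evalc s s1"
    show "halts orc (Seq (RS 8 (RV 7)) (Seq (NS 28 (NC 0)) (Seq (RS 20 (RNat (NC 0))) (For 26 (NV 0)
       (Seq (NS 27 (NGet 3 ce)) (Seq (NSet 3 ce (NAdd (NV 26) (NC 1))) (Seq evalc (Seq (NSet 3 ce (NV 27))
       (Seq (RSet r (NV 26) (RSub (RV 7) (RV 8))) (Cond ?cond
         (Seq (NS 28 (NAdd (NV 26) (NC 1))) (Seq (RS 15 ke) (RS 20 (RGet r (NV 26))))) Skip)))))))))) s1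
       ((n * ((TE + 20) + 4) + 4) + 2 + 2 + 2) (?I n)"
      apply (intro halts_RSeq halts_NSeq)
      apply (rule loop[unfolded blk.simps])
      subgoal using s1(2) by (auto simp: frame_def)
      subgoal using s1 by (auto simp: frame_def feas_write)
      subgoal using s1 by simp
      done
  qed
  then show ?thesis
  proof (rule halts_weaken)
    define Y where "Y = n * W ^ 4"
    have Y: "1 * 1 \<le> Y" unfolding Y_def using n1 W1 by (intro mult_le_mono) auto
    have nY: "n * Y = n ^ 2 * W ^ 4" by (simp add: Y_def power2_eq_square)
    have "n * ((220 * Y + 20) + 4) \<le> n * (244 * Y)" using Y by (intro mult_le_mono2) simp
    also have "\<dots> = 244 * (n * Y)" by simp
    finally have 1: "n * ((220 * Y + 20) + 4) \<le> 244 * (n * Y)" .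
    have 2: "1 * Y \<le> n * Y" using n1 by (intro mult_le_mono1)
    have "X \<le> 244 * Z \<Longrightarrow> 1 * Y \<le> Z \<Longrightarrow> 220 * Y + ((X + 4) + 2 + 2 + 2) + 1 \<le> 500 * Z" for X Z
      using Y by simp
    from this[OF 1 2] show "TE + ((n * ((TE + 20) + 4) + 4) + 2 + 2 + 2) + 1 \<le> 500 * n ^ 2 * W ^ 4"
      by (simp only: nY[symmetric] Y_def mult.assoc)
  qed auto
qed

end

section \<open>The six operations\<close>

abbreviation "fcellE \<equiv> NAdd n2N1 (NAdd (NMul (NV 14) (NV 4)) (NV 13))"
abbreviation "scellE \<equiv> NAdd nN1 (NAdd (NV 26) (NC 1))"

definition "fillscan = scan 14 fcellE
  (BNot (RLess (RGet 14 (NV 26)) (RMul (RNat (NV 15)) (RV 12)))) (RGet 1 (NV 26))"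
definition "smallscan = scan 14 scellE
  (BAnd (RLess (RGet 16 (NV 26)) (RV 11)) (RLess (RNat (NC 0)) (RGet 14 (NV 26))))
  (RDiv (RGet 1 (NV 26)) (RGet 14 (NV 26)))"
text \<open>The condition \<open>0 < 0\<close> selects nothing. The scan is run for its side effect:
  array 16 receives the gains at the committed elements, against which smallness is tested until the
  next reset.\<close>

definition "flagscan = scan 16 scellE (NLess (NC 0) (NC 0)) (RNat (NC 0))"

definition "guard = BAnd (NLess (NV 14) (NV 5)) (NLess (NV 13) (NV 4))"

definition "reset = blk [For 29 (NAdd nN1 (NMul (NV 5) (NV 4))) (NSet 3 (NAdd nN1 (NV 29)) (NC 0)),
  NS 13 (NC 0), NS 14 (NC 0), NS 15 (NC 0), RS 9 (RV 19), flagscan]"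
definition "fillc = Cond guard (blk [fillscan, NSet 3 fcellE (NV 28)]) Skip"
definition "commitc = blk [Cond guard (blk [fillscan, NSet 3 (NV 28) (NV 28)]) Skip, reset]"
definition "chunkb = Cond (RLess (RV 13) (RV 12))
  (blk [smallscan, NSet 3 (NAdd nN1 (NV 28)) (NV 28), RS 13 (RAdd (RV 13) (RV 20))]) Skip"
definition "chunkc = blk [RS 13 (RNat (NC 0)), For 30 (NV 0) chunkb]"
definition "phasec = blk [NS 13 (NAdd (NV 13) (NC 1)), NS 14 (NC 0), NS 15 (NC 0),
  RS 9 (RMul (RV 9) (RDiv (RNat (NAdd (NV 4) (NC 1))) (RNat (NV 4))))]"
definition "opc = Cond (NLess (NV 12) (NC 1)) (NS 15 (NAdd (NV 15) (NC 1)))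
  (Cond (NLess (NV 12) (NC 2)) (blk [NS 14 (NAdd (NV 14) (NC 1)), NS 15 (NC 0)])
  (Cond (NLess (NV 12) (NC 3)) fillc
  (Cond (NLess (NV 12) (NC 4)) chunkc
  (Cond (NLess (NV 12) (NC 5)) phasec commitc))))"
definition "opsc = For 11 (NV 7) (blk [NS 16 (NV 10), NS 17 (NC 6), NS 18 (NV 11), digc, NS 12 (NV 22), opc])"
definition "runc = blk [For 29 nN1 (NSet 3 (NV 29) (NC 0)), reset, opsc, evalc]"

abbreviation "scn \<equiv> {1, 2, 3, 16, 17, 18, 19, 20, 21, 22, 23, 24, 25, 26, 27, 28} :: nat set"

lemma mods_ops [simp]:
  "nmods fillscan = scn" "rmods fillscan = {3, 4, 5, 6, 7, 8, 14, 15, 20}"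
  "nmods smallscan = scn" "rmods smallscan = {3, 4, 5, 6, 7, 8, 14, 15, 20}"
  "nmods flagscan = scn" "rmods flagscan = {3, 4, 5, 6, 7, 8, 15, 16, 20}"
  "nmods reset = scn \<union> {13, 14, 15, 29}" "rmods reset = {3, 4, 5, 6, 7, 8, 9, 15, 16, 20}"
  "nmods fillc = scn" "rmods fillc = {3, 4, 5, 6, 7, 8, 14, 15, 20}"
  "nmods commitc = scn \<union> {13, 14, 15, 29}" "rmods commitc = {3, 4, 5, 6, 7, 8, 9, 14, 15, 16, 20}"
  "nmods chunkb = scn" "rmods chunkb = {3, 4, 5, 6, 7, 8, 13, 14, 15, 20}"
  "nmods chunkc = scn \<union> {30}" "rmods chunkc = {3, 4, 5, 6, 7, 8, 13, 14, 15, 20}"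
  "nmods phasec = {13, 14, 15}" "rmods phasec = {9}"
  by (auto simp: fillscan_def smallscan_def flagscan_def reset_def fillc_def commitc_def chunkb_def chunkc_def phasec_def)

lemma mods_opc [simp]:
  "nmods opc = scn \<union> {13, 14, 15, 29, 30}" "rmods opc = {3, 4, 5, 6, 7, 8, 9, 13, 14, 15, 16, 20}"
  by (auto simp: opc_def)

lemma mods_run [simp]:
  "nmods opsc = scn \<union> {11, 12, 13, 14, 15, 29, 30}" "rmods opsc = {3, 4, 5, 6, 7, 8, 9, 13, 14, 15, 16, 20}"
  "nmods runc = scn \<union> {11, 12, 13, 14, 15, 29, 30}" "rmods runc = {3, 4, 5, 6, 7, 8, 9, 13, 14, 15, 16, 20}"
  by (auto simp: runc_def opsc_def)

context prog
begin

text \<open>The number of cells in use. As \<open>pre\<close> keeps everything beyond it empty, the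
  finite loop in \<open>reset\<close> produces exactly \<open>base\<close>.\<close>

definition Mx :: nat where "Mx = 2 * Suc n + K * L"

text \<open>\<open>b\<close> stands for a value recorded earlier, so the predicate also carries the
  fact that the best value never decreases.\<close>

definition pre :: "real \<Rightarrow> state \<Rightarrow> bool" where
  "pre b s \<longleftrightarrow> ok s \<and> feas s \<and> b \<le> rmem s 6 0 \<and> rmem s 12 0 = unit \<and> rmem s 11 0 = thr \<and> rmem s 19 0 = a0
     \<and> (\<forall>c\<ge>Mx. nmem s 3 c = 0)"

text \<open>The simulation relation between memory and the abstract state. Its last clause depends
  on \<open>A\<close> only through \<open>base A\<close>, so it survives all writes above the
  committed cells.\<close>

definition rel :: "real \<Rightarrow> (nat \<Rightarrow> nat) \<times> nat \<times> nat \<times> nat \<times> real \<Rightarrow> state \<Rightarrow> bool" where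
  "rel b = (\<lambda>(A, t, i, m, D) s. pre b s \<and> nmem s 3 = A \<and> nmem s 13 0 = t \<and> nmem s 14 0 = i \<and> nmem s 15 0 = m
     \<and> rmem s 9 0 = D \<and> (\<forall>x<n. rmem s 16 x = gain a0 (base A) (scell x) x))"

abbreviation "TS \<equiv> 500 * n ^ 2 * W ^ 4"

lemma rel_frame:
  assumes "rel b (A, t, i, m, D) s" "frame c s s'" "nmem s' 3 = A" "feas s'" "rmem s 6 0 \<le> rmem s' 6 0"
    "{0, 4, 5, 6, 13, 14, 15} \<inter> nmods c = {}" "{1, 2, 9, 11, 12, 16, 19} \<inter> rmods c = {}"
  shows "rel b (A, t, i, m, D) s'"
proof -
  have "ok s'" by (rule ok_frame[OF _ assms(2)]) (use assms(1,6,7) in \<open>auto simp: rel_def pre_def\<close>)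
  then show ?thesis using assms by (auto simp: rel_def pre_def frame_def)
qed

lemma rel_rwrite:
  "rel b (A, t, i, m, D) s \<Longrightarrow> br \<notin> {1, 2, 6, 9, 11, 12, 16, 19} \<Longrightarrow> rel b (A, t, i, m, D) (rwrite br j v s)"
  by (auto simp: rel_def pre_def ok_write feas_write)

lemma rel_nwrite:
  "rel b (A, t, i, m, D) s \<Longrightarrow> ar \<notin> {0, 1, 3, 4, 5, 6, 13, 14, 15} \<Longrightarrow> rel b (A, t, i, m, D) (nwrite ar j v s)"
  by (auto simp: rel_def pre_def ok_write feas_write)

lemma halts_fillscan:
  assumes R: "rel b (A, t, i, m, D) s"
  shows "halts orc fillscan s TS (\<lambda>s'. nmem s' 28 0 = pickf A t i m D \<and> rel b (A, t, i, m, D) s')"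
proof -
  have s: "ok s" "feas s" and e: "nmem s 3 = A" "rmem s 9 0 = D" "nmem s 0 0 = n" "nmem s 4 0 = L"
    "nmem s 13 0 = t" "nmem s 14 0 = i" "nmem s 15 0 = m" "rmem s 12 0 = unit" "\<forall>x<n. rmem s 1 x = w x"
    using R by (auto simp: rel_def pre_def ok_def ok0_def)
  have "halts orc fillscan s TS (\<lambda>s'. nmem s' 3 = nmem s 3 \<and> nmem s' 28 0 = scanf (\<lambda>x. \<not> gain D A (fcell i t) x < real m * unit) w n
     \<and> rmem s' 20 0 = (if scanf (\<lambda>x. \<not> gain D A (fcell i t) x < real m * unit) w n = 0 then 0 else
        gain (rmem s 9 0) (nmem s 3) (fcell i t) (scanf (\<lambda>x. \<not> gain D A (fcell i t) x < real m * unit) w n - 1))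
     \<and> (\<forall>x<n. rmem s' 14 x = gain (rmem s 9 0) (nmem s 3) (fcell i t) x) \<and> feas s' \<and> rmem s 6 0 \<le> rmem s' 6 0)"
    unfolding fillscan_def
    by (rule halts_scan[OF s, where cf = "\<lambda>_. fcell i t"]) (use e in \<open>auto simp: frame_def fcell_def algebra_simps\<close>)
  then show ?thesis
  proof (rule halts_mono)
    let ?p = "scanf (\<lambda>x. \<not> gain D A (fcell i t) x < real m * unit) w n"
    fix s' assume a: "nmem s' 3 = nmem s 3 \<and> nmem s' 28 0 = ?p
     \<and> rmem s' 20 0 = (if ?p = 0 then 0 else gain (rmem s 9 0) (nmem s 3) (fcell i t) (?p - 1))
     \<and> (\<forall>x<n. rmem s' 14 x = gain (rmem s 9 0) (nmem s 3) (fcell i t) x) \<and> feas s' \<and> rmem s 6 0 \<le> rmem s' 6 0"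
      and f: "frame fillscan s s'"
    have "rel b (A, t, i, m, D) s'" by (rule rel_frame[OF R f]) (use a e(1) in auto)
    then show "nmem s' 28 0 = pickf A t i m D \<and> rel b (A, t, i, m, D) s'"
      using a by (simp only: pickf_def)
  qed simp
qed

lemma halts_smallscan:
  assumes R: "rel b (A, t, i, m, D) s"
  shows "halts orc smallscan s TS (\<lambda>s'. nmem s' 28 0 = picks A D \<and> rel b (A, t, i, m, D) s' \<and> rmem s' 13 = rmem s 13
    \<and> rmem s' 20 0 = (if picks A D = 0 then 0 else gain D A (scell (picks A D - 1)) (picks A D - 1)))"
proof -
  have s: "ok s" "feas s" and e: "nmem s 3 = A" "rmem s 9 0 = D" "nmem s 0 0 = n"
    "rmem s 11 0 = thr" "\<forall>x<n. rmem s 1 x = w x" "\<forall>x<n. rmem s 16 x = gain a0 (base A) (scell x) x"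
    using R by (auto simp: rel_def pre_def ok_def ok0_def)
  let ?c = "\<lambda>x. gain a0 (base A) (scell x) x < thr \<and> 0 < gain D A (scell x) x"
  let ?k = "\<lambda>x. w x / gain D A (scell x) x"
  have "halts orc smallscan s TS (\<lambda>s'. nmem s' 3 = nmem s 3 \<and> nmem s' 28 0 = scanf ?c ?k n
     \<and> rmem s' 20 0 = (if scanf ?c ?k n = 0 then 0 else
        gain (rmem s 9 0) (nmem s 3) (scell (scanf ?c ?k n - 1)) (scanf ?c ?k n - 1))
     \<and> (\<forall>x<n. rmem s' 14 x = gain (rmem s 9 0) (nmem s 3) (scell x) x) \<and> feas s' \<and> rmem s 6 0 \<le> rmem s' 6 0)"
    unfolding smallscan_def
    by (rule halts_scan[OF s, where cf = scell]) (use e in \<open>auto simp: frame_def scell_def\<close>)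
  then show ?thesis
  proof (rule halts_mono)
    fix s' assume a: "nmem s' 3 = nmem s 3 \<and> nmem s' 28 0 = scanf ?c ?k n
     \<and> rmem s' 20 0 = (if scanf ?c ?k n = 0 then 0 else
        gain (rmem s 9 0) (nmem s 3) (scell (scanf ?c ?k n - 1)) (scanf ?c ?k n - 1))
     \<and> (\<forall>x<n. rmem s' 14 x = gain (rmem s 9 0) (nmem s 3) (scell x) x) \<and> feas s' \<and> rmem s 6 0 \<le> rmem s' 6 0"
      and f: "frame smallscan s s'"
    have "rel b (A, t, i, m, D) s'" by (rule rel_frame[OF R f]) (use a e in auto)
    moreover have "rmem s' 13 = rmem s 13" using f by (simp add: frame_def)
    ultimately show "nmem s' 28 0 = picks A D \<and> rel b (A, t, i, m, D) s' \<and> rmem s' 13 = rmem s 13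
      \<and> rmem s' 20 0 = (if picks A D = 0 then 0 else gain D A (scell (picks A D - 1)) (picks A D - 1))"
      using a by (simp only: picks_def e(1,2))
  qed simp
qed

lemma base_base: "base (base A) = base A"
  by (auto simp: base_def)

lemma halts_reset:
  assumes P: "pre b s"
  shows "halts orc reset s ((Suc n + K * L) * 5 + TS + 20) (rel b (base (nmem s 3), 0, 0, 0, a0))"
proof -
  let ?A = "nmem s 3"
  let ?b = "NSet 3 (NAdd nN1 (NV 29)) (NC 0)"
  let ?f = "For 29 (NAdd nN1 (NMul (NV 5) (NV 4))) ?b"
  let ?I = "\<lambda>i s'. nmem s' 3 = (\<lambda>c. if Suc n \<le> c \<and> c < Suc n + i then 0 else ?A c)"
  have c: "nmem s 0 0 = n" "nmem s 4 0 = L" "nmem s 5 0 = K" using P by (auto simp: pre_def ok_def ok0_def)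
  have loop: "halts orc ?f s ((Suc n + K * L) * (1 + 4) + 4) (?I (Suc n + K * L))"
  proof (rule halts_For[where I = ?I])
    fix i s' assume I: "?I i s'" "nmem s' 29 0 = i" "frame ?f s s'"
    have e: "nmem s' 0 0 = n" using I(3) c by (simp add: frame_def)
    show "halts orc ?b s' 1 (?I (Suc i))"
      by (rule halts_NSet) (use I(1,2) e in \<open>auto simp: fun_eq_iff\<close>)
  qed (use c in \<open>auto simp: fun_eq_iff\<close>)
  have base: "(\<lambda>c. if Suc n \<le> c \<and> c < Suc n + (Suc n + K * L) then 0 else ?A c) = base ?A"
    using P by (auto simp: fun_eq_iff base_def pre_def Mx_def)
  have fin: "halts orc (Seq (NS 13 (NC 0)) (Seq (NS 14 (NC 0)) (Seq (NS 15 (NC 0)) (Seq (RS 9 (RV 19)) flagscan)))) s1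
      (TS + 2 + 2 + 2 + 2) (rel b (base ?A, 0, 0, 0, a0))"
    if s1: "nmem s1 3 = base ?A" "frame ?f s s1" for s1
  proof -
    let ?s2 = "rwrite 9 0 a0 (nwrite 15 0 0 (nwrite 14 0 0 (nwrite 13 0 0 s1)))"
    have r1: "rmem s1 = rmem s" using s1(2) by (simp add: frame_def fun_eq_iff)
    have a0: "rmem s1 19 0 = a0" using P r1 by (simp add: pre_def)
    have "ok s1" by (rule ok_frame[OF _ s1(2)]) (use P in \<open>auto simp: pre_def\<close>)
    then have o: "ok ?s2" by (simp add: ok_write)
    have "feas s1" using P s1(2) by (auto simp: pre_def feas_def out_def frame_def)
    then have g: "feas ?s2" by (simp add: feas_write)
    have p: "pre b ?s2"
      unfolding pre_def using o g P s1 r1 by (auto simp: pre_def base_def Mx_def)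
    have "halts orc flagscan ?s2 TS (\<lambda>s'. nmem s' 3 = nmem ?s2 3 \<and> nmem s' 28 0 = scanf (\<lambda>_. False) (\<lambda>_. 0) n
     \<and> rmem s' 20 0 = (if scanf (\<lambda>_. False) (\<lambda>_. 0) n = 0 then 0 else
        gain (rmem ?s2 9 0) (nmem ?s2 3) (scell (scanf (\<lambda>_. False) (\<lambda>_. 0) n - 1)) (scanf (\<lambda>_. False) (\<lambda>_. 0) n - 1))
     \<and> (\<forall>x<n. rmem s' 16 x = gain (rmem ?s2 9 0) (nmem ?s2 3) (scell x) x) \<and> feas s' \<and> rmem ?s2 6 0 \<le> rmem s' 6 0)"
      unfolding flagscan_def
      by (rule halts_scan[OF o g, where cf = scell]) (use c s1 in \<open>auto simp: frame_def scell_def\<close>)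
    then have "halts orc flagscan ?s2 TS (rel b (base ?A, 0, 0, 0, a0))"
    proof (rule halts_mono)
      fix s' assume a: "nmem s' 3 = nmem ?s2 3 \<and> nmem s' 28 0 = scanf (\<lambda>_. False) (\<lambda>_. 0) n
     \<and> rmem s' 20 0 = (if scanf (\<lambda>_. False) (\<lambda>_. 0) n = 0 then 0 else
        gain (rmem ?s2 9 0) (nmem ?s2 3) (scell (scanf (\<lambda>_. False) (\<lambda>_. 0) n - 1)) (scanf (\<lambda>_. False) (\<lambda>_. 0) n - 1))
     \<and> (\<forall>x<n. rmem s' 16 x = gain (rmem ?s2 9 0) (nmem ?s2 3) (scell x) x) \<and> feas s' \<and> rmem ?s2 6 0 \<le> rmem s' 6 0"
        and f: "frame flagscan ?s2 s'"
      have o': "ok s'" by (rule ok_frame[OF o f]) auto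
      have "nmem s' 3 = base ?A" using a s1(1) by simp
      moreover have "\<forall>x<n. rmem s' 16 x = gain a0 (base ?A) (scell x) x" using a s1(1) by simp
      moreover have "b \<le> rmem s' 6 0" using a p by (auto simp: pre_def)
      moreover have "rmem s' 12 0 = unit" "rmem s' 11 0 = thr" "rmem s' 19 0 = a0" "rmem s' 9 0 = a0"
        "nmem s' 13 0 = 0" "nmem s' 14 0 = 0" "nmem s' 15 0 = 0"
        using f p by (simp_all add: frame_def pre_def)
      moreover have "\<forall>c\<ge>Mx. base ?A c = 0" by (auto simp: base_def Mx_def)
      ultimately show "rel b (base ?A, 0, 0, 0, a0) s'" using a o' by (simp add: rel_def pre_def base_base)
    qed simp
    then show ?thesis using a0 by (intro halts_NSeq halts_RSeq) simp
  qed
  have "halts orc reset s ((Suc n + K * L) * (1 + 4) + 4 + (TS + 2 + 2 + 2 + 2) + 1) (rel b (base ?A, 0, 0, 0, a0))"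
    unfolding reset_def blk.simps
    by (rule halts_Seq[OF loop _ le_refl], rule fin) (simp_all only: base)
  then show ?thesis by (rule halts_weaken) simp_all
qed

lemma guard: "rel b (A, t, i, m, D) s \<Longrightarrow> bval s guard \<longleftrightarrow> i < K \<and> t < L"
  by (auto simp: guard_def rel_def pre_def ok_def ok0_def)

lemma fcell_Mx: "i < K \<Longrightarrow> t < L \<Longrightarrow> fcell i t < Mx"
proof -
  assume "i < K" "t < L"
  then have "i * L + t < Suc i * L" "Suc i * L \<le> K * L" by (simp, intro mult_le_mono1, simp)
  then show ?thesis by (simp add: fcell_def Mx_def)
qed

lemma pre_write: "pre b s \<Longrightarrow> c < Mx \<Longrightarrow> pre b (nwrite 3 c v s)"
  by (auto simp: pre_def ok_write feas_write)

lemma rel_write: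
  assumes "rel b (A, t, i, m, D) s" "Suc n \<le> c" "c < Mx"
  shows "rel b (A(c := v), t, i, m, D) (nwrite 3 c v s)"
proof -
  have "base (A(c := v)) = base A" using assms(2) by (auto simp: base_def)
  then show ?thesis using assms pre_write[of b s c v] by (auto simp: rel_def)
qed

lemma halts_fillc:
  assumes R: "rel b (A, t, i, m, D) s"
  shows "halts orc fillc s (TS + 3) (rel b (ostep 2 (A, t, i, m, D)))"
proof -
  have "halts orc fillc s ((TS + 1 + 1) + 1) (rel b (ostep 2 (A, t, i, m, D)))"
    unfolding fillc_def blk.simps
  proof (rule halts_Cond_Skip)
    assume "bval s guard"
    then have it: "i < K" "t < L" using guard[OF R] by auto
    show "halts orc (Seq fillscan (NSet 3 fcellE (NV 28))) s (TS + 1 + 1) (rel b (ostep 2 (A, t, i, m, D)))"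
    proof (rule halts_Seq[OF halts_fillscan[OF R] _ le_refl], rule halts_NSet)
      fix s1 assume s1: "nmem s1 28 0 = pickf A t i m D \<and> rel b (A, t, i, m, D) s1"
      then have e: "nval s1 fcellE = fcell i t" by (auto simp: rel_def pre_def ok_def ok0_def fcell_def)
      have "Suc n \<le> fcell i t" by (simp add: fcell_def)
      from rel_write[OF _ this fcell_Mx[OF it]] s1
      have "rel b (A(fcell i t := pickf A t i m D), t, i, m, D) (nwrite 3 (fcell i t) (pickf A t i m D) s1)" by blast
      then show "rel b (ostep 2 (A, t, i, m, D)) (nwrite 3 (nval s1 fcellE) (nval s1 (NV 28)) s1)"
        unfolding e using s1 it by (simp add: ostep_def)
    qed
  next
    assume "\<not> bval s guard"
    then have "\<not> (i < K \<and> t < L)" using guard[OF R] by simp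
    then show "rel b (ostep 2 (A, t, i, m, D)) s" using R by (auto simp: ostep_def)
  qed
  then show ?thesis by (rule halts_weaken) simp_all
qed

lemma halts_commitc:
  assumes R: "rel b (A, t, i, m, D) s"
  shows "halts orc commitc s (2 * TS + (Suc n + K * L) * 5 + 30) (rel b (ostep 5 (A, t, i, m, D)))"
proof -
  let ?A = "if i < K \<and> t < L then A(pickf A t i m D := pickf A t i m D) else A"
  have "halts orc (Cond guard (Seq fillscan (NSet 3 (NV 28) (NV 28))) Skip) s ((TS + 1 + 1) + 1)
    (\<lambda>s'. pre b s' \<and> nmem s' 3 = ?A)"
  proof (rule halts_Cond_Skip)
    assume "bval s guard"
    then have it: "i < K \<and> t < L" using guard[OF R] by simp
    show "halts orc (Seq fillscan (NSet 3 (NV 28) (NV 28))) s (TS + 1 + 1) (\<lambda>s'. pre b s' \<and> nmem s' 3 = ?A)"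
    proof (rule halts_Seq[OF halts_fillscan[OF R] _ le_refl], rule halts_NSet)
      fix s1 assume s1: "nmem s1 28 0 = pickf A t i m D \<and> rel b (A, t, i, m, D) s1"
      have "pickf A t i m D \<le> n" unfolding pickf_def by (rule scanf_le)
      then have "pickf A t i m D < Mx" by (simp add: Mx_def)
      then show "pre b (nwrite 3 (nval s1 (NV 28)) (nval s1 (NV 28)) s1) \<and>
          nmem (nwrite 3 (nval s1 (NV 28)) (nval s1 (NV 28)) s1) 3 = ?A"
        using s1 it pre_write by (simp add: rel_def)
    qed
  next
    assume "\<not> bval s guard"
    then show "pre b s \<and> nmem s 3 = ?A" using guard[OF R] R by (auto simp: rel_def)
  qed
  then have "halts orc commitc s (((TS + 1 + 1) + 1) + ((Suc n + K * L) * 5 + TS + 20) + 1) (rel b (ostep 5 (A, t, i, m, D)))"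
    unfolding commitc_def blk.simps
  proof (rule halts_Seq[OF _ _ le_refl])
    fix s1 assume s1: "pre b s1 \<and> nmem s1 3 = ?A"
    then have "halts orc reset s1 ((Suc n + K * L) * 5 + TS + 20) (rel b (base ?A, 0, 0, 0, a0))"
      using halts_reset[of b s1] by simp
    moreover have "ostep 5 (A, t, i, m, D) = (base ?A, 0, 0, 0, a0)" by (simp add: ostep_def)
    ultimately show "halts orc reset s1 ((Suc n + K * L) * 5 + TS + 20) (rel b (ostep 5 (A, t, i, m, D)))" by simp
  qed
  then show ?thesis by (rule halts_weaken) simp_all
qed

lemma halts_chunkc:
  assumes R: "rel b (A, t, i, m, D) s"
  shows "halts orc chunkc s (n * (TS + 10) + 10) (rel b (ostep 3 (A, t, i, m, D)))"
proof -
  let ?I = "\<lambda>j s'. rel b (fst ((pstep D ^^ j) (A, 0)), t, i, m, D) s' \<and> rmem s' 13 0 = snd ((pstep D ^^ j) (A, 0))"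
  have loop: "halts orc (For 30 (NV 0) chunkb) s0 (n * ((TS + 5) + 4) + 4) (?I n)"
    if s0: "rel b (A, t, i, m, D) s0" "rmem s0 13 0 = 0" for s0
  proof (rule halts_For[where I = ?I])
    fix j s' assume I: "?I j s'"
    define B acc where "B = fst ((pstep D ^^ j) (A, 0))" and "acc = snd ((pstep D ^^ j) (A, 0))"
    have pj: "(pstep D ^^ j) (A, 0) = (B, acc)" by (simp add: B_def acc_def)
    have I': "rel b (B, t, i, m, D) s'" "rmem s' 13 0 = acc" using I by (simp_all add: pj)
    have u: "rmem s' 12 0 = unit" using I' by (simp add: rel_def pre_def)
    have "halts orc chunkb s' ((TS + 3 + 1) + 1) (?I (Suc j))"
      unfolding chunkb_def blk.simps
    proof (rule halts_Cond_Skip)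
      assume "bval s' (RLess (RV 13) (RV 12))"
      then have lt: "acc < unit" using I' u by simp
      have pS: "(pstep D ^^ Suc j) (A, 0) = (B(Suc n + picks B D := picks B D),
         acc + (if picks B D = 0 then 0 else gain D B (scell (picks B D - 1)) (picks B D - 1)))"
        using lt by (simp add: pj) (simp add: pstep_def)
      show "halts orc (Seq smallscan (Seq (NSet 3 (NAdd nN1 (NV 28)) (NV 28)) (RS 13 (RAdd (RV 13) (RV 20))))) s' (TS + 3 + 1) (?I (Suc j))"
      proof (rule halts_Seq[OF halts_smallscan[OF I'(1)], where ?B2.0 = "1 + 2"])
        fix s1 assume s1: "nmem s1 28 0 = picks B D \<and> rel b (B, t, i, m, D) s1 \<and> rmem s1 13 = rmem s' 13
          \<and> rmem s1 20 0 = (if picks B D = 0 then 0 else gain D B (scell (picks B D - 1)) (picks B D - 1))"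
        then have e: "nval s1 (NAdd nN1 (NV 28)) = Suc n + picks B D" by (auto simp: rel_def pre_def ok_def ok0_def)
        have pn: "picks B D \<le> n" unfolding picks_def by (rule scanf_le)
        let ?s2 = "nwrite 3 (Suc n + picks B D) (picks B D) s1"
        have r2: "rel b (B(Suc n + picks B D := picks B D), t, i, m, D) ?s2"
          by (rule rel_write) (use s1 pn in \<open>auto simp: Mx_def\<close>)
        have r3: "rel b (B(Suc n + picks B D := picks B D), t, i, m, D) (rwrite 13 0 v ?s2)" for v
          by (rule rel_rwrite[OF r2]) simp
        show "halts orc (Seq (NSet 3 (NAdd nN1 (NV 28)) (NV 28)) (RS 13 (RAdd (RV 13) (RV 20)))) s1 (1 + 2) (?I (Suc j))"
          apply (rule halts_NSeq, rule halts_RSet)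
          unfolding pS e fst_conv snd_conv using r3 s1 I'(2) by simp
      qed simp
    next
      assume "\<not> bval s' (RLess (RV 13) (RV 12))"
      then have "\<not> acc < unit" using I' u by simp
      then have pS: "(pstep D ^^ Suc j) (A, 0) = (B, acc)" by (simp add: pj) (simp add: pstep_def)
      show "?I (Suc j) s'" unfolding pS using I' by simp
    qed
    then show "halts orc chunkb s' (TS + 5) (?I (Suc j))" by (rule halts_weaken) simp_all
  next
    fix j s' v assume "?I j s'"
    then show "?I j (nwrite 30 0 v s')" using rel_nwrite by simp
  qed (use s0 in \<open>auto simp: rel_def pre_def ok_def ok0_def\<close>)
  have "rel b (A, t, i, m, D) (rwrite 13 0 0 s)" by (rule rel_rwrite[OF R]) simp
  then have "halts orc chunkc s ((n * ((TS + 5) + 4) + 4) + 2) (?I n)"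
    unfolding chunkc_def blk.simps by (intro halts_RSeq loop) simp_all
  then show ?thesis
  proof (rule halts_weaken)
    have "n * ((TS + 5) + 4) \<le> n * (TS + 10)" by (rule mult_le_mono2) simp
    then show "(n * ((TS + 5) + 4) + 4) + 2 \<le> n * (TS + 10) + 10" by linarith
  qed (auto simp: ostep_def chunk_def)
qed

text \<open>Operation 3 makes up to \<open>n\<close> picks, each by a scan of \<open>n\<close>
  elements, and an evaluation is linear in \<open>n\<close>; this is the factor
  \<open>n ^ 3\<close>.\<close>

lemma op_time:
  assumes "x \<le> n * (TS + 10) + 10 \<or> x \<le> 2 * TS + (Suc n + K * L) * 5 + 30"
  shows "x + 6 \<le> 1200 * n ^ 3 * W ^ 4"
proof -
  define Z where "Z = n ^ 3 * W ^ 4"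
  have Z1: "1 * 1 \<le> Z" unfolding Z_def using n1 W1 by (intro mult_le_mono) auto
  have Zn: "n \<le> Z" using n1 W1 mult_le_mono[of n "n ^ 3" 1 "W ^ 4"] by (simp add: Z_def self_le_power)
  have ZW: "W * W \<le> Z"
  proof -
    have "W ^ 2 \<le> W ^ 4" using W1 by (intro power_increasing) auto
    then show ?thesis using n1 mult_le_mono[of 1 "n ^ 3" "W ^ 2" "W ^ 4"] by (simp add: Z_def power2_eq_square)
  qed
  have KL: "K * L \<le> Z" using mult_le_mono[OF KW LW] ZW by simp
  have T1: "n * TS = 500 * Z" by (simp add: Z_def power2_eq_square power3_eq_cube)
  have T2: "TS \<le> 500 * Z"
  proof -
    have "n ^ 2 \<le> n ^ 3" using n1 by (intro power_increasing) auto
    then show ?thesis by (simp add: Z_def)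
  qed
  have "n * (TS + 10) + 10 = 500 * Z + 10 * n + 10" using T1 by (simp add: algebra_simps)
  then have "x + 6 \<le> 1200 * Z" using assms Z1 Zn KL T2 by auto
  then show ?thesis by (simp add: Z_def)
qed

lemma halts_opc:
  assumes R: "rel b \<sigma> s" and o: "nmem s 12 0 = c" "c < 6"
  shows "halts orc opc s (1200 * n ^ 3 * W ^ 4) (rel b (ostep c \<sigma>))"
proof -
  obtain A t i m D where \<sigma>: "\<sigma> = (A, t, i, m, D)" by (cases \<sigma>)
  note R = R[unfolded \<sigma>]
  let ?B = "max (n * (TS + 10) + 10) (2 * TS + (Suc n + K * L) * 5 + 30)"
  have L: "nmem s 4 0 = L" using R by (simp add: rel_def pre_def ok_def ok0_def)
  have B: "10 \<le> ?B" by simp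
  have 0: "c < 1 \<Longrightarrow> halts orc (NS 15 (NAdd (NV 15) (NC 1))) s (?B + 4) (rel b (ostep c \<sigma>))"
    by (rule halts_weaken[OF halts_NSet[where P = "rel b (ostep c \<sigma>)"]])
       (use R in \<open>auto simp: \<sigma> ostep_def rel_def pre_def ok_write feas_write\<close>)
  have 1: "c = 1 \<Longrightarrow> halts orc (blk [NS 14 (NAdd (NV 14) (NC 1)), NS 15 (NC 0)]) s (?B + 3) (rel b (ostep c \<sigma>))"
    unfolding blk.simps
    by (rule halts_weaken[OF halts_NSeq[OF halts_NSet[where P = "rel b (ostep c \<sigma>)"]]])
       (use R in \<open>auto simp: \<sigma> ostep_def rel_def pre_def ok_write feas_write\<close>)
  have 2: "c = 2 \<Longrightarrow> halts orc fillc s (?B + 2) (rel b (ostep c \<sigma>))"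
    using halts_weaken[OF halts_fillc[OF R], of "?B + 2"] by (simp add: \<sigma>)
  have 3: "c = 3 \<Longrightarrow> halts orc chunkc s (?B + 1) (rel b (ostep c \<sigma>))"
    using halts_weaken[OF halts_chunkc[OF R], of "?B + 1"] by (simp add: \<sigma>)
  have 4: "c = 4 \<Longrightarrow> halts orc phasec s ?B (rel b (ostep c \<sigma>))"
    unfolding phasec_def blk.simps
    by (rule halts_weaken[OF halts_NSeq[OF halts_NSeq[OF halts_NSeq[OF halts_RSet[where P = "rel b (ostep c \<sigma>)"]]]]])
       (use R L in \<open>auto simp: \<sigma> ostep_def rel_def pre_def ok_write feas_write\<close>)
  have 5: "c = 5 \<Longrightarrow> halts orc commitc s ?B (rel b (ostep c \<sigma>))"
    using halts_weaken[OF halts_commitc[OF R], of "?B"] by (simp add: \<sigma>)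
  have "halts orc opc s (?B + 4 + 1) (rel b (ostep c \<sigma>))"
    unfolding opc_def
  proof (rule halts_Cond)
    have e: "x + 4 = (((x + 1) + 1) + 1) + 1" for x :: nat by simp
    assume a1: "\<not> bval s (NLess (NV 12) (NC 1))"
    show "halts orc (Cond (NLess (NV 12) (NC 2)) (blk [NS 14 (NAdd (NV 14) (NC 1)), NS 15 (NC 0)])
      (Cond (NLess (NV 12) (NC 3)) fillc (Cond (NLess (NV 12) (NC 4)) chunkc
      (Cond (NLess (NV 12) (NC 5)) phasec commitc)))) s (?B + 4) (rel b (ostep c \<sigma>))"
      unfolding e
    proof (rule halts_Cond)
      assume a2: "\<not> bval s (NLess (NV 12) (NC 2))"
      show "halts orc (Cond (NLess (NV 12) (NC 3)) fillc (Cond (NLess (NV 12) (NC 4)) chunkc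
        (Cond (NLess (NV 12) (NC 5)) phasec commitc))) s (((?B + 1) + 1) + 1) (rel b (ostep c \<sigma>))"
      proof (rule halts_Cond)
        assume a3: "\<not> bval s (NLess (NV 12) (NC 3))"
        show "halts orc (Cond (NLess (NV 12) (NC 4)) chunkc (Cond (NLess (NV 12) (NC 5)) phasec commitc)) s ((?B + 1) + 1) (rel b (ostep c \<sigma>))"
        proof (rule halts_Cond)
          assume a4: "\<not> bval s (NLess (NV 12) (NC 4))"
          show "halts orc (Cond (NLess (NV 12) (NC 5)) phasec commitc) s (?B + 1) (rel b (ostep c \<sigma>))"
            by (rule halts_Cond) (use a4 4 5 o in auto)
        next
          assume "bval s (NLess (NV 12) (NC 4))"
          then have "c = 3" using a3 o by simp
          then show "halts orc chunkc s (?B + 1) (rel b (ostep c \<sigma>))" by (rule 3)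
        qed
      next
        assume "bval s (NLess (NV 12) (NC 3))"
        then have "c = 2" using a2 o by simp
        then have "halts orc fillc s (?B + 2) (rel b (ostep c \<sigma>))" by (rule 2)
        then show "halts orc fillc s ((?B + 1) + 1) (rel b (ostep c \<sigma>))" by (rule halts_weaken) simp_all
      qed
    next
      assume "bval s (NLess (NV 12) (NC 2))"
      then have "c = 1" using a1 o by simp
      then have "halts orc (blk [NS 14 (NAdd (NV 14) (NC 1)), NS 15 (NC 0)]) s (?B + 3) (rel b (ostep c \<sigma>))" by (rule 1)
      then show "halts orc (blk [NS 14 (NAdd (NV 14) (NC 1)), NS 15 (NC 0)]) s (((?B + 1) + 1) + 1) (rel b (ostep c \<sigma>))"
        by (rule halts_weaken) simp_all
    qed
  next
    assume "bval s (NLess (NV 12) (NC 1))"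
    then have "c < 1" using o by simp
    then show "halts orc (NS 15 (NAdd (NV 15) (NC 1))) s (?B + 4) (rel b (ostep c \<sigma>))" by (rule 0)
  qed
  then show ?thesis
  proof (rule halts_weaken)
    show "?B + 4 + 1 \<le> 1200 * n ^ 3 * W ^ 4"
    proof -
      have gen: "max X Y \<le> X \<or> max X Y \<le> Y" for X Y :: nat by (simp add: max_def)
      have le: "X + 6 \<le> Y \<Longrightarrow> X + 4 + 1 \<le> Y" for X Y :: nat by simp
      show ?thesis by (rule le[OF op_time[OF gen]])
    qed
  qed
qed

end

section \<open>Preprocessing: \<open>L\<close>, the modular part, and the largest singleton\<close>

definition "lloopc = blk [NS 4 (NC 1),
  While (RLess (RMul (RNat (NV 4)) (RV 0)) (RNat (NC 7))) (NS 4 (NAdd (NV 4) (NC 1)))]"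

abbreviation "ecell \<equiv> NAdd (NV 29) (NC 1)"

definition "ellb = blk [NSet 3 ecell (NC 0), load, RSet 2 (NV 29) (RSub (RV 18) (RV 3)), NSet 3 ecell ecell]"
definition "maxb = blk [NSet 3 ecell ecell, load, Cond (RLess (RV 17) (RV 3)) (RS 17 (RV 3)) Skip, NSet 3 ecell (NC 0)]"

definition "prepc = blk [For 29 (NV 0) (NSet 3 ecell ecell), load, RS 18 (RV 3), For 29 (NV 0) ellb,
  For 29 (NV 0) (NSet 3 ecell (NC 0)), For 29 (NV 0) maxb]"

lemma mods_prep [simp]:
  "nmods ellb = {1, 2, 3, 16, 17, 18, 19, 20, 21, 22, 24, 25}" "rmods ellb = {2, 3, 4, 5, 6}"
  "nmods maxb = {1, 2, 3, 16, 17, 18, 19, 20, 21, 22, 24, 25}" "rmods maxb = {3, 4, 5, 6, 17}"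
  "nmods prepc = {1, 2, 3, 16, 17, 18, 19, 20, 21, 22, 24, 25, 29}" "rmods prepc = {2, 3, 4, 5, 6, 17, 18}"
  by (auto simp: ellb_def maxb_def prepc_def)

context prog
begin

text \<open>What one guess \<open>G\<close> guarantees. It is monotone in the recorded value, so
  trying further guesses cannot destroy it.\<close>

definition good :: "nat \<Rightarrow> nat \<Rightarrow> state \<Rightarrow> bool" where
  "good N G s \<longleftrightarrow> (\<forall>A t i m D p. fold ostep (map (dig 6 G) [0..<N]) (bs {}, 0, 0, 0, a0) = (A, t, i, m, D) \<longrightarrow>
     p < L ^ K \<longrightarrow> sum w (its A p) \<le> 1 \<longrightarrow> F (its A p) \<le> rmem s 6 0)"

lemma halts_opsc:
  assumes R: "rel b (bs {}, 0, 0, 0, a0) s" and G: "nmem s 10 0 = G" "G \<le> W" and N: "nmem s 7 0 = N" "N \<le> W"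
  shows "halts orc opsc s (N * ((1200 * n ^ 3 * W ^ 4 + 60 * W ^ 2 + 20) + 4) + 4)
    (rel b (fold ostep (map (dig 6 G) [0..<N]) (bs {}, 0, 0, 0, a0)))"
proof -
  let ?b = "blk [NS 16 (NV 10), NS 17 (NC 6), NS 18 (NV 11), digc, NS 12 (NV 22), opc]"
  let ?\<sigma> = "\<lambda>j. fold ostep (map (dig 6 G) [0..<j]) (bs {}, 0, 0, 0, a0)"
  have mb: "nmods ?b = scn \<union> {12, 13, 14, 15, 29, 30}" "rmods ?b = {3, 4, 5, 6, 7, 8, 9, 13, 14, 15, 16, 20}" by auto
  show ?thesis unfolding opsc_def
  proof (rule halts_For[where I = "\<lambda>j. rel b (?\<sigma> j)"])
    fix j s' assume I: "j < N" "rel b (?\<sigma> j) s'" "nmem s' 11 0 = j" "frame (For 11 (NV 7) ?b) s s'"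
    obtain A t i m D where \<sigma>: "?\<sigma> j = (A, t, i, m, D)" by (cases "?\<sigma> j")
    have R': "rel b (A, t, i, m, D) s'" using I(2) by (simp only: \<sigma>)
    have g: "nmem s' 10 0 = G" using frameD(1)[OF I(4), of 10] G by (simp add: mb)
    let ?s1 = "nwrite 18 0 j (nwrite 17 0 6 (nwrite 16 0 G s'))"
    have R1: "rel b (A, t, i, m, D) ?s1" by (intro rel_nwrite R') simp_all
    have d: "halts orc digc ?s1 (60 * W ^ 2) (\<lambda>s'. nmem s' 22 0 = dig (nmem ?s1 17 0) (nmem ?s1 16 0) (nmem ?s1 18 0))"
      by (rule halts_dig) (use G N I(1) W1 in auto)
    have T: "halts orc (Seq digc (Seq (NS 12 (NV 22)) opc)) ?s1 (60 * W ^ 2 + (1200 * n ^ 3 * W ^ 4 + 2) + 1) (rel b (?\<sigma> (Suc j)))"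
    proof (rule halts_Seq[OF d _ le_refl], rule halts_NSeq)
      fix s2 assume d2: "nmem s2 22 0 = dig (nmem ?s1 17 0) (nmem ?s1 16 0) (nmem ?s1 18 0)" and f: "frame digc ?s1 s2"
      have R2: "rel b (A, t, i, m, D) s2"
      proof (rule rel_frame[OF R1 f])
        show "nmem s2 3 = A" using frameD(1)[OF f, of 3] R1 by (simp add: rel_def)
        show "feas s2" by (rule feas_frame[OF _ f]) (use R1 in \<open>auto simp: rel_def pre_def\<close>)
        show "rmem ?s1 6 0 \<le> rmem s2 6 0" using frameD(2)[OF f, of 6] by simp
      qed auto
      let ?s3 = "nwrite 12 (nval s2 (NConst 0)) (nval s2 (NV 22)) s2"
      have R3: "rel b (A, t, i, m, D) ?s3" by (rule rel_nwrite[OF R2]) simp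
      have "halts orc opc ?s3 (1200 * n ^ 3 * W ^ 4) (rel b (ostep (dig 6 G j) (A, t, i, m, D)))"
        by (rule halts_opc[OF R3]) (use d2 dig_less[of 6] in simp_all)
      then show "halts orc opc ?s3 (1200 * n ^ 3 * W ^ 4) (rel b (?\<sigma> (Suc j)))" by (simp add: \<sigma>)
    qed
    have "halts orc ?b s' ((60 * W ^ 2 + (1200 * n ^ 3 * W ^ 4 + 2) + 1) + 2 + 2 + 2) (rel b (?\<sigma> (Suc j)))"
      unfolding blk.simps
      by (rule halts_NSeq_eq[where j = 0 and v = G], simp, simp add: g, rule halts_NSeq_eq[where j = 0 and v = 6],
          simp, simp, rule halts_NSeq_eq[where j = 0 and v = j], simp, simp add: I(3), rule T)
    then show "halts orc ?b s' (1200 * n ^ 3 * W ^ 4 + 60 * W ^ 2 + 20) (rel b (?\<sigma> (Suc j)))"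
      by (rule halts_weaken) simp_all
  next
    fix j s' v assume "rel b (?\<sigma> j) s'"
    then show "rel b (?\<sigma> j) (nwrite 11 0 v s')"
      by (cases "?\<sigma> j") (simp only:, rule rel_nwrite, simp_all)
  qed (use R N mb in auto)
qed

lemma run_time:
  assumes N: "N \<le> W"
  shows "(Suc n * (1 + 4) + 4) + ((Suc n + K * L) * 5 + TS + 20) + (N * ((1200 * n ^ 3 * W ^ 4 + 60 * W ^ 2 + 20) + 4) + 4)
     + TE + 10 \<le> 4000 * n ^ 3 * W ^ 5"
proof -
  define Q where "Q = n ^ 3 * W ^ 5"
  define R where "R = n ^ 3 * W ^ 4"
  have p: "1 \<le> n ^ k" "1 \<le> W ^ k" for k using n1 W1 by simp_all
  have Q1: "1 * 1 \<le> Q" unfolding Q_def by (intro mult_le_mono p)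
  have R1: "1 * 1 \<le> R" unfolding R_def by (intro mult_le_mono p)
  have nQ: "n * 1 \<le> Q" unfolding Q_def using n1 by (intro mult_le_mono p self_le_power) auto
  have KQ: "K * L \<le> Q"
  proof -
    have "K * L \<le> W * W" by (intro mult_le_mono KW LW)
    also have "\<dots> \<le> 1 * W ^ 5" using W1 power_increasing[of 2 5 W] by (simp add: power2_eq_square)
    also have "\<dots> \<le> Q" unfolding Q_def by (intro mult_le_mono1 p)
    finally show ?thesis .
  qed
  have T2: "n ^ 2 * W ^ 4 \<le> Q" unfolding Q_def using n1 W1 by (intro mult_le_mono power_increasing) auto
  have TE: "n * W ^ 4 \<le> Q" unfolding Q_def using n1 W1 by (intro mult_le_mono power_increasing self_le_power) auto
  have "W ^ 2 \<le> R"
  proof -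
    have "1 * W ^ 2 \<le> n ^ 3 * W ^ 4" using W1 by (intro mult_le_mono p power_increasing) auto
    then show ?thesis by (simp add: R_def)
  qed
  then have "(1200 * R + 60 * W ^ 2 + 20) + 4 \<le> 1284 * R" using R1 by simp
  then have "N * ((1200 * R + 60 * W ^ 2 + 20) + 4) \<le> W * (1284 * R)" using N by (intro mult_le_mono)
  also have "\<dots> = 1284 * Q"
  proof -
    have "W ^ 5 = W * W ^ 4" using power_Suc[of W 4] by simp
    then show ?thesis unfolding Q_def R_def by (simp only: ac_simps)
  qed
  finally have NQ: "N * ((1200 * R + 60 * W ^ 2 + 20) + 4) \<le> 1284 * Q" .
  have "n * 1 \<le> Q \<Longrightarrow> k \<le> Q \<Longrightarrow> x \<le> Q \<Longrightarrow> y \<le> 1284 * Q \<Longrightarrow> z \<le> Q \<Longrightarrow>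
    (Suc n * (1 + 4) + 4) + ((Suc n + k) * 5 + 500 * x + 20) + (y + 4) + 220 * z + 10 \<le> 4000 * Q" for k x y z
    using Q1 by simp
  from this[OF nQ KQ T2 NQ TE] show ?thesis
    by (simp only: Q_def R_def mult.assoc)
qed

lemma halts_runc:
  assumes P: "pre b s" and G: "nmem s 10 0 = G" "G \<le> W" and N: "nmem s 7 0 = N" "N \<le> W"
  shows "halts orc runc s (4000 * n ^ 3 * W ^ 5) (\<lambda>s'. pre b s' \<and> good N G s')"
proof -
  let ?A = "nmem s 3" and ?f = "For 29 nN1 (NSet 3 (NV 29) (NC 0))"
  let ?TR = "(Suc n + K * L) * 5 + TS + 20"
  let ?TO = "N * ((1200 * n ^ 3 * W ^ 4 + 60 * W ^ 2 + 20) + 4) + 4"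
  have n: "nmem s 0 0 = n" using P by (simp add: pre_def ok_def ok0_def)
  have clear: "halts orc ?f s (Suc n * (1 + 4) + 4) (\<lambda>s'. nmem s' 3 = (\<lambda>c. if c < Suc n then 0 else ?A c))"
    by (rule halts_For[where I = "\<lambda>i s'. nmem s' 3 = (\<lambda>c. if c < i then 0 else ?A c)"])
       (use n in \<open>auto simp: fun_eq_iff less_Suc_eq intro!: halts_NSet[unfolded One_nat_def]\<close>)
  have "halts orc runc s ((Suc n * (1 + 4) + 4) + (?TR + (?TO + TE + 1) + 1) + 1) (\<lambda>s'. pre b s' \<and> good N G s')"
    unfolding runc_def blk.simps
  proof (rule halts_Seq[OF clear _ le_refl])
    fix s1 assume s1: "nmem s1 3 = (\<lambda>c. if c < Suc n then 0 else ?A c)" and f1: "frame ?f s s1"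
    have r1: "rmem s1 = rmem s" using f1 by (simp add: frame_def fun_eq_iff)
    have "ok s1" by (rule ok_frame[OF _ f1]) (use P in \<open>auto simp: pre_def\<close>)
    moreover have "feas s1" by (rule feas_frame[OF _ f1]) (use P in \<open>auto simp: pre_def\<close>)
    ultimately have P1: "pre b s1" using P s1 r1 by (simp add: pre_def)
    have z: "base (nmem s1 3) = bs {}" by (auto simp: s1 base_def bs_def)
    show "halts orc (Seq reset (Seq opsc evalc)) s1 (?TR + (?TO + TE + 1) + 1) (\<lambda>s'. pre b s' \<and> good N G s')"
    proof (rule halts_Seq[OF halts_reset[OF P1] _ le_refl])
      fix s2 assume s2: "rel b (base (nmem s1 3), 0, 0, 0, a0) s2" and f2: "frame reset s1 s2"
      have g2: "nmem s2 10 0 = G" "nmem s2 7 0 = N"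
        using frameD(1)[OF f2, of 10] frameD(1)[OF f2, of 7] frameD(1)[OF f1, of 10] frameD(1)[OF f1, of 7] G N by simp_all
      show "halts orc (Seq opsc evalc) s2 (?TO + TE + 1) (\<lambda>s'. pre b s' \<and> good N G s')"
      proof (rule halts_Seq[OF halts_opsc[OF s2[unfolded z] g2(1) G(2) g2(2) N(2)] _ le_refl])
        fix s3 assume s3: "rel b (fold ostep (map (dig 6 G) [0..<N]) (bs {}, 0, 0, 0, a0)) s3"
        obtain A t i m D where \<sigma>: "fold ostep (map (dig 6 G) [0..<N]) (bs {}, 0, 0, 0, a0) = (A, t, i, m, D)"
          using prod_cases5 by blast
        have A: "nmem s3 3 = A" "pre b s3" using s3 by (simp_all only: \<sigma> rel_def prod.case)
        have o3: "ok s3" "feas s3" using A(2) by (simp_all add: pre_def)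
        show "halts orc evalc s3 TE (\<lambda>s'. pre b s' \<and> good N G s')"
        proof (rule halts_mono[OF halts_eval[OF o3] le_refl])
          fix s4 assume s4: "rmem s4 7 0 = V (rmem s3 9 0) (nmem s3 3) \<and> feas s4 \<and> rmem s3 6 0 \<le> rmem s4 6 0
            \<and> (\<forall>p<L ^ K. sum w (its (nmem s3 3) p) \<le> 1 \<longrightarrow> F (its (nmem s3 3) p) \<le> rmem s4 6 0)"
            and f4: "frame evalc s3 s4"
          have "ok s4" by (rule ok_frame[OF o3(1) f4]) auto
          then have "pre b s4" using A(2) s4 f4 by (auto simp: pre_def frame_def)
          moreover have "good N G s4" unfolding good_def \<sigma> using s4 A(1) by simp
          ultimately show "pre b s4 \<and> good N G s4" ..
        qed
      qed
    qed
  qed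
  then show ?thesis
    by (rule halts_weaken) (use run_time[OF N(2)] in linarith)+
qed

end

section \<open>Parameters and enumeration of the guesses\<close>

primrec pw :: "nat \<Rightarrow> nexp" where
  "pw 0 = NC 1"
| "pw (Suc k) = NMul (NV 4) (pw k)"

lemma nval_pw [simp]: "nval s (pw k) = nmem s 4 0 ^ k"
  by (induction k) auto

definition "nfc = For 29 (NV 5) (NS 6 (NMul (NV 6) (NV 4)))"
definition "cntc = For 29 (NV 7) (NS 8 (NMul (NV 8) (NC 6)))"
definition "a0c = For 29 (NV 4) (RS 19 (RMul (RV 19) (RDiv (RNat (NV 4)) (RNat (NAdd (NV 4) (NC 1))))))"
definition "paramc = blk [NS 5 (NMul (NC 8) (pw 3)), NS 6 (NC 1), nfc, NS 7 (NMul (NC 3400) (pw 14)),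
  NS 8 (NC 1), cntc, RS 19 (RNat (NC 1)), a0c]"
definition "jc = blk [RS 10 (RMul (RMul (RNat (NAdd (NV 9) (NC 1))) (RV 17)) (RNat (NV 6))),
  RS 12 (RDiv (RV 10) (RNat (NMul (NC 8) (pw 5)))), RS 11 (RDiv (RV 10) (RNat (NMul (NC 4) (pw 2)))),
  For 10 (NV 8) runc]"
definition "prog_com = blk [lloopc, prepc, paramc, For 9 (NV 0) jc]"

lemma mods_main [simp]:
  "nmods lloopc = {4}" "rmods lloopc = {}" "nmods nfc = {6, 29}" "rmods nfc = {}"
  "nmods cntc = {8, 29}" "rmods cntc = {}" "nmods a0c = {29}" "rmods a0c = {19}"
  "nmods paramc = {5, 6, 7, 8, 29}" "rmods paramc = {19}"
  "nmods jc = scn \<union> {10, 11, 12, 13, 14, 15, 29, 30}"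
  "rmods jc = {3, 4, 5, 6, 7, 8, 9, 10, 11, 12, 13, 14, 15, 16, 20}"
  by (auto simp: lloopc_def nfc_def cntc_def a0c_def paramc_def jc_def)

text \<open>Reals cannot be rounded to naturals in the language, so the ceiling of
  \<open>7 / e\<close> is found by counting up until the product with \<open>e\<close> reaches
  7.\<close>

lemma halts_lloop:
  assumes e: "0 < e" "e < 1" "rmem s 0 0 = e"
  defines "l \<equiv> nat \<lceil>7 / e\<rceil>"
  shows "halts orc lloopc s (5 * l + 10) (\<lambda>s'. nmem s' 4 0 = l)"
proof -
  let ?W = "While (RLess (RMul (RNat (NV 4)) (RV 0)) (RNat (NC 7))) (NS 4 (NAdd (NV 4) (NC 1)))"
  have "0 < \<lceil>7 / e\<rceil>" using e by simp
  then have l1: "1 \<le> l" unfolding l_def by linarith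
  have test: "real i * e < 7 \<longleftrightarrow> i < l" for i
  proof -
    have "real i * e < 7 \<longleftrightarrow> real_of_int (int i) < 7 / e" using e by (simp add: field_simps)
    also have "\<dots> \<longleftrightarrow> int i < \<lceil>7 / e\<rceil>" by (simp only: less_ceiling_iff)
    finally show ?thesis by (simp add: l_def zless_nat_conj) linarith
  qed
  have "wpt orc ?W s' t (\<lambda>t' s'. t' \<le> t + 5 * (l - i) + 1 \<and> nmem s' 4 0 = l)"
    if "nmem s' 4 0 = i" "i \<le> l" "rmem s' 0 0 = e" for s' i t
    using that
  proof (induction "l - i" arbitrary: s' i t)
    case 0
    then have "\<not> bval s' (RLess (RMul (RNat (NV 4)) (RV 0)) (RNat (NC 7)))" using test[of i] by simp
    then show ?case using 0 by (intro wpt_While) (simp add: wpt_Skip)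
  next
    case (Suc k)
    then have il: "i < l" by simp
    then have b: "bval s' (RLess (RMul (RNat (NV 4)) (RV 0)) (RNat (NC 7)))" using test[of i] Suc by simp
    have "wpt orc ?W (nwrite 4 0 (Suc i) s') (t + 3) (\<lambda>t' s'. t' \<le> (t + 3) + 5 * (l - Suc i) + 1 \<and> nmem s' 4 0 = l)"
      by (rule Suc(1)) (use Suc il in auto)
    then have "wpt orc ?W (nwrite 4 0 (Suc i) s') (t + 1 + 1 + 1) (\<lambda>t' s'. t' \<le> t + 5 * (l - i) + 1 \<and> nmem s' 4 0 = l)"
    proof -
      have e: "t + 1 + 1 + 1 = t + 3" by simp
      show ?thesis unfolding e using il by (intro wpt_mono[OF \<open>wpt orc ?W (nwrite 4 0 (Suc i) s') (t + 3) _\<close>]) auto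
    qed
    then show ?case
      using b Suc by (intro wpt_While) (simp, intro wpt_Seq wpt_NSet, simp)
  qed
  from this[of "nwrite 4 0 1 s" 1] l1 e(3)
  have W: "wpt orc ?W (nwrite 4 0 1 s) t (\<lambda>t' s'. t' \<le> t + 5 * (l - 1) + 1 \<and> nmem s' 4 0 = l)" for t by simp
  show ?thesis
    unfolding halts_def lloopc_def blk.simps
    apply (rule wpt_Seq, rule wpt_NSet)
    apply (simp only: nval.simps)
    apply (rule wpt_mono[OF W])
    apply auto
    done
qed

context prog
begin

abbreviation "TL \<equiv> 200 * n * W ^ 3"

lemma bs_upd: "(bs S)(Suc x := Suc x) = bs (insert x S)" "(bs S)(Suc x := 0) = bs (S - {x})"
  by (auto simp: bs_def fun_eq_iff)

lemma halts_load_bs: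
  assumes s: "ok0 s" "feas s" "nmem s 23 0 = 0" "nmem s 3 = bs S" "S \<subseteq> {..<n}"
  shows "halts orc load s TL (\<lambda>s'. rmem s' 3 0 = F S \<and> feas s')"
proof -
  have "its (nmem s 3) (nmem s 23 0) = S" using s its_bs' by simp
  then show ?thesis using halts_load[OF s(1,2)] s(3) by (auto elim!: halts_weaken)
qed

lemma ok0_write: "ar \<notin> {0, 4, 5} \<Longrightarrow> ok0 (nwrite ar i v s) = ok0 s" "br \<noteq> 1 \<Longrightarrow> ok0 (rwrite br i u s) = ok0 s"
  by (auto simp: ok0_def)

lemma halts_ellb:
  assumes s: "ok0 s" "feas s" "nmem s 23 0 = 0" "nmem s 3 = bs {..<n}" "rmem s 18 0 = F {..<n}"
    and i: "nmem s 29 0 = i" "i < n"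
  shows "halts orc ellb s (TL + 6) (\<lambda>s'. feas s' \<and> nmem s' 3 = bs {..<n} \<and> rmem s' 2 = (rmem s 2)(i := ell i))"
proof -
  let ?Q = "\<lambda>s'. feas s' \<and> nmem s' 3 = bs {..<n} \<and> rmem s' 2 = (rmem s 2)(i := ell i)"
  let ?s1 = "nwrite 3 (Suc i) 0 s"
  have s1: "ok0 ?s1" "feas ?s1" "nmem ?s1 23 0 = 0" "nmem ?s1 3 = bs ({..<n} - {i})"
    using s by (simp_all add: ok0_write feas_write bs_upd)
  have "halts orc (Seq load (Seq (RSet 2 (NV 29) (RSub (RV 18) (RV 3))) (NSet 3 ecell ecell))) ?s1 (TL + (1 + 2) + 1) ?Q"
  proof (rule halts_Seq[OF halts_load_bs[OF s1] _ le_refl])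
    fix s2 assume s2: "rmem s2 3 0 = F ({..<n} - {i}) \<and> feas s2" "frame load ?s1 s2"
    have e: "nmem s2 29 0 = i" "nmem s2 3 = bs ({..<n} - {i})" "rmem s2 18 0 = F {..<n}" "rmem s2 2 = rmem s 2"
      using s2(2) i s s1(4) by (simp_all add: frame_def)
    have "insert i ({..<n} - {i}) = {..<n}" using i by auto
    then show "halts orc (Seq (RSet 2 (NV 29) (RSub (RV 18) (RV 3))) (NSet 3 ecell ecell)) s2 (1 + 2) ?Q"
      using s2 e by (intro halts_RSeq halts_NSet) (simp add: feas_write bs_upd ell_def)
  qed auto
  then have "halts orc ellb s (TL + (1 + 2) + 1 + 2) ?Q"
    unfolding ellb_def blk.simps using i by (intro halts_NSeq) simp
  then show ?thesis by (rule halts_weaken) simp_all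
qed

lemma halts_maxb:
  assumes s: "ok0 s" "feas s" "nmem s 23 0 = 0" "nmem s 3 = bs {}" and i: "nmem s 29 0 = i" "i < n"
  shows "halts orc maxb s (TL + 7) (\<lambda>s'. feas s' \<and> nmem s' 3 = bs {} \<and> rmem s' 17 0 = max (rmem s 17 0) (F {i}))"
proof -
  let ?Q = "\<lambda>s'. feas s' \<and> nmem s' 3 = bs {} \<and> rmem s' 17 0 = max (rmem s 17 0) (F {i})"
  let ?s1 = "nwrite 3 (Suc i) (Suc i) s"
  let ?c = "Cond (RLess (RV 17) (RV 3)) (RS 17 (RV 3)) Skip"
  have s1: "ok0 ?s1" "feas ?s1" "nmem ?s1 23 0 = 0" "nmem ?s1 3 = bs {i}"
    using s by (simp_all add: ok0_write feas_write bs_upd)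
  have i': "{i} \<subseteq> {..<n}" using i by simp
  have "halts orc (Seq load (Seq ?c (NSet 3 ecell (NC 0)))) ?s1 (TL + ((1 + 1) + 1 + 1) + 1) ?Q"
  proof (rule halts_Seq[OF halts_load_bs[OF s1 i'] _ le_refl])
    fix s2 assume s2: "rmem s2 3 0 = F {i} \<and> feas s2" "frame load ?s1 s2"
    have e: "nmem s2 29 0 = i" "nmem s2 3 = bs {i}" "rmem s2 17 0 = rmem s 17 0"
      using s2(2) i s s1(4) by (simp_all add: frame_def)
    have c: "halts orc ?c s2 (1 + 1) (\<lambda>s'. feas s' \<and> rmem s' 17 0 = max (rmem s 17 0) (F {i}))"
      by (intro halts_Cond_Skip halts_RSet) (use s2 e in \<open>auto simp: feas_write\<close>)
    show "halts orc (Seq ?c (NSet 3 ecell (NC 0))) s2 ((1 + 1) + 1 + 1) ?Q"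
    proof (rule halts_Seq[OF c _ le_refl], rule halts_NSet)
      fix s3 assume s3: "feas s3 \<and> rmem s3 17 0 = max (rmem s 17 0) (F {i})" "frame ?c s2 s3"
      then show "?Q (nwrite 3 (nval s3 ecell) (nval s3 (NC 0)) s3)"
        using e by (simp add: frame_def feas_write bs_upd)
    qed
  qed
  then have "halts orc maxb s (TL + ((1 + 1) + 1 + 1) + 1 + 2) ?Q"
    unfolding maxb_def blk.simps using i by (intro halts_NSeq) simp
  then show ?thesis by (rule halts_weaken) simp_all
qed

lemma halts_prep:
  assumes s: "ok0 s" "feas s" "nmem s 23 0 = 0" "nmem s 3 = (\<lambda>_. 0)" "rmem s 17 0 = 0"
  shows "halts orc prepc s (1000 * n ^ 2 * W ^ 3) (\<lambda>s'. feas s' \<and> nmem s' 3 = (\<lambda>_. 0) \<and> (\<forall>x<n. rmem s' 2 x = ell x)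
     \<and> (\<forall>x<n. F {x} \<le> rmem s' 17 0) \<and> (rmem s' 17 0 = 0 \<or> (\<exists>x<n. rmem s' 17 0 = F {x})))"
  (is "halts orc prepc s _ ?Q")
proof -
  have z: "bs {} = (\<lambda>_. 0)" by (auto simp: bs_def)
  let ?b1 = "NSet 3 ecell ecell" and ?b2 = "NSet 3 ecell (NC 0)"
  have l1: "halts orc (For 29 (NV 0) ?b1) s (n * (1 + 4) + 4) (\<lambda>s'. nmem s' 3 = bs {..<n})"
  proof (rule halts_For[where I = "\<lambda>i s'. nmem s' 3 = bs {..<i}"])
    show "nmem s 3 = bs {..<0}" using s z by simp
    fix i and s' :: state assume "nmem s' 3 = bs {..<i}" "nmem s' 29 0 = i"
    then show "halts orc ?b1 s' 1 (\<lambda>s'. nmem s' 3 = bs {..<Suc i})"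
      by (intro halts_NSet) (simp add: bs_upd lessThan_Suc)
  qed (use s in \<open>auto simp: ok0_def\<close>)
  have l2: "halts orc (For 29 (NV 0) ellb) s1 (n * ((TL + 6) + 4) + 4) (\<lambda>s'. feas s' \<and> nmem s' 3 = bs {..<n} \<and> (\<forall>x<n. rmem s' 2 x = ell x))"
    if s1: "ok0 s1" "feas s1" "nmem s1 23 0 = 0" "nmem s1 3 = bs {..<n}" "rmem s1 18 0 = F {..<n}" for s1
  proof (rule halts_For[where I = "\<lambda>i s'. feas s' \<and> nmem s' 3 = bs {..<n} \<and> (\<forall>x<i. rmem s' 2 x = ell x)"])
    fix i s' assume I: "i < n" "feas s' \<and> nmem s' 3 = bs {..<n} \<and> (\<forall>x<i. rmem s' 2 x = ell x)" "nmem s' 29 0 = i"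
      and f: "frame (For 29 (NV 0) ellb) s1 s'"
    have "ok0 s'" by (rule ok0_frame[OF s1(1) f]) auto
    moreover have "nmem s' 23 0 = 0" "rmem s' 18 0 = F {..<n}" using f s1 by (simp_all add: frame_def)
    ultimately have "halts orc ellb s' (TL + 6) (\<lambda>s''. feas s'' \<and> nmem s'' 3 = bs {..<n} \<and> rmem s'' 2 = (rmem s' 2)(i := ell i))"
      using halts_ellb I by blast
    then show "halts orc ellb s' (TL + 6) (\<lambda>s'. feas s' \<and> nmem s' 3 = bs {..<n} \<and> (\<forall>x<Suc i. rmem s' 2 x = ell x))"
      by (rule halts_weaken) (use I(2) in \<open>auto simp: less_Suc_eq\<close>)
  qed (use s1 in \<open>auto simp: ok0_def feas_write\<close>)
  have l3: "halts orc (For 29 (NV 0) ?b2) s2 (n * (1 + 4) + 4) (\<lambda>s'. nmem s' 3 = bs {})"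
    if s2: "ok0 s2" "nmem s2 3 = bs {..<n}" for s2
  proof -
    have "halts orc (For 29 (NV 0) ?b2) s2 (n * (1 + 4) + 4) (\<lambda>s'. nmem s' 3 = bs ({..<n} - {..<n}))"
    proof (rule halts_For[where I = "\<lambda>i s'. nmem s' 3 = bs ({..<n} - {..<i})"])
      fix i and s' :: state assume "nmem s' 3 = bs ({..<n} - {..<i})" "nmem s' 29 0 = i"
      moreover have "{..<n} - {..<Suc i} = {..<n} - {..<i} - {i}" by auto
      ultimately show "halts orc ?b2 s' 1 (\<lambda>s'. nmem s' 3 = bs ({..<n} - {..<Suc i}))"
        by (intro halts_NSet) (simp add: bs_upd)
    qed (use s2 in \<open>auto simp: ok0_def\<close>)
    then show ?thesis by simp
  qed
  have l4: "halts orc (For 29 (NV 0) maxb) s3 (n * ((TL + 7) + 4) + 4) (\<lambda>s'. feas s' \<and> nmem s' 3 = bs {}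
      \<and> (\<forall>x<n. F {x} \<le> rmem s' 17 0) \<and> (rmem s' 17 0 = 0 \<or> (\<exists>x<n. rmem s' 17 0 = F {x})))"
    if s3: "ok0 s3" "feas s3" "nmem s3 23 0 = 0" "nmem s3 3 = bs {}" "rmem s3 17 0 = 0" for s3
  proof (rule halts_For[where I = "\<lambda>i s'. feas s' \<and> nmem s' 3 = bs {}
      \<and> (\<forall>x<i. F {x} \<le> rmem s' 17 0) \<and> (rmem s' 17 0 = 0 \<or> (\<exists>x<n. rmem s' 17 0 = F {x}))"])
    fix i s' assume I: "i < n" "feas s' \<and> nmem s' 3 = bs {}
      \<and> (\<forall>x<i. F {x} \<le> rmem s' 17 0) \<and> (rmem s' 17 0 = 0 \<or> (\<exists>x<n. rmem s' 17 0 = F {x}))" "nmem s' 29 0 = i"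
      and f: "frame (For 29 (NV 0) maxb) s3 s'"
    have "ok0 s'" by (rule ok0_frame[OF s3(1) f]) auto
    moreover have "nmem s' 23 0 = 0" using f s3 by (simp add: frame_def)
    ultimately have "halts orc maxb s' (TL + 7) (\<lambda>s''. feas s'' \<and> nmem s'' 3 = bs {} \<and> rmem s'' 17 0 = max (rmem s' 17 0) (F {i}))"
      using halts_maxb I by blast
    then show "halts orc maxb s' (TL + 7) (\<lambda>s'. feas s' \<and> nmem s' 3 = bs {}
      \<and> (\<forall>x<Suc i. F {x} \<le> rmem s' 17 0) \<and> (rmem s' 17 0 = 0 \<or> (\<exists>x<n. rmem s' 17 0 = F {x})))"
      by (rule halts_weaken) (use I(1,2) in \<open>auto simp: less_Suc_eq max_def intro: order_trans\<close>)
  qed (use s3 in \<open>auto simp: ok0_def feas_write\<close>)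
  have "halts orc prepc s ((n * (1 + 4) + 4) + (TL + (((n * ((TL + 6) + 4) + 4) + ((n * (1 + 4) + 4) + (n * ((TL + 7) + 4) + 4) + 1) + 1) + 2) + 1) + 1) ?Q"
    unfolding prepc_def blk.simps
  proof (rule halts_Seq[OF l1 _ le_refl])
    fix s1 assume s1: "nmem s1 3 = bs {..<n}" "frame (For 29 (NV 0) ?b1) s s1"
    have o1: "ok0 s1" "feas s1" "nmem s1 23 0 = 0" "rmem s1 17 0 = 0"
      using s s1(2) by (auto simp: ok0_def feas_def out_def frame_def)
    show "halts orc (Seq load (Seq (RS 18 (RV 3)) (Seq (For 29 (NV 0) ellb) (Seq (For 29 (NV 0) ?b2) (For 29 (NV 0) maxb))))) s1
      (TL + (((n * ((TL + 6) + 4) + 4) + ((n * (1 + 4) + 4) + (n * ((TL + 7) + 4) + 4) + 1) + 1) + 2) + 1) ?Q"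
    proof (rule halts_Seq[OF halts_load_bs[OF o1(1-3) s1(1) order_refl] _ le_refl], rule halts_RSeq)
      fix s2 assume s2: "rmem s2 3 0 = F {..<n} \<and> feas s2" "frame load s1 s2"
      let ?s2 = "rwrite 18 (nval s2 (NConst 0)) (rval s2 (RV 3)) s2"
      have o2: "ok0 ?s2" "feas ?s2" "nmem ?s2 23 0 = 0" "nmem ?s2 3 = bs {..<n}" "rmem ?s2 18 0 = F {..<n}" "rmem ?s2 17 0 = 0"
        using s2 o1 s1(1) by (auto simp: ok0_def feas_write frame_def)
      show "halts orc (Seq (For 29 (NV 0) ellb) (Seq (For 29 (NV 0) ?b2) (For 29 (NV 0) maxb))) ?s2
        ((n * ((TL + 6) + 4) + 4) + ((n * (1 + 4) + 4) + (n * ((TL + 7) + 4) + 4) + 1) + 1) ?Q"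
      proof (rule halts_Seq[OF l2[OF o2(1-5)] _ le_refl])
        fix s3 assume s3: "feas s3 \<and> nmem s3 3 = bs {..<n} \<and> (\<forall>x<n. rmem s3 2 x = ell x)" "frame (For 29 (NV 0) ellb) ?s2 s3"
        have o3: "ok0 s3" by (rule ok0_frame[OF o2(1) s3(2)]) auto
        have e3: "nmem s3 23 0 = 0" "rmem s3 17 0 = 0" using s3(2) o2 by (simp_all add: frame_def)
        show "halts orc (Seq (For 29 (NV 0) ?b2) (For 29 (NV 0) maxb)) s3 ((n * (1 + 4) + 4) + (n * ((TL + 7) + 4) + 4) + 1) ?Q"
        proof (rule halts_Seq[OF l3[OF o3] _ le_refl])
          show "nmem s3 3 = bs {..<n}" using s3 by simp
          fix s4 assume s4: "nmem s4 3 = bs {}" "frame (For 29 (NV 0) ?b2) s3 s4"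
          have "ok0 s4" by (rule ok0_frame[OF o3 s4(2)]) auto
          moreover have "feas s4" by (rule feas_frame[OF _ s4(2)]) (use s3 in auto)
          moreover have e4: "nmem s4 23 0 = 0" "rmem s4 17 0 = 0" "rmem s4 2 = rmem s3 2" using s4(2) e3 by (simp_all add: frame_def)
          ultimately have m: "halts orc (For 29 (NV 0) maxb) s4 (n * ((TL + 7) + 4) + 4) (\<lambda>s'. feas s' \<and> nmem s' 3 = bs {}
            \<and> (\<forall>x<n. F {x} \<le> rmem s' 17 0) \<and> (rmem s' 17 0 = 0 \<or> (\<exists>x<n. rmem s' 17 0 = F {x})))"
            using l4 s4(1) by blast
          show "halts orc (For 29 (NV 0) maxb) s4 (n * ((TL + 7) + 4) + 4) ?Q"
            by (rule halts_mono[OF m le_refl]) (use s3(1) e4(3) z in \<open>auto simp: frame_def\<close>)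
        qed
      qed
    qed
  qed
  then show ?thesis
  proof (rule halts_weaken)
    define Y where "Y = n * W ^ 3"
    have Y1: "n * 1 \<le> Y" unfolding Y_def using W1 by (intro mult_le_mono) auto
    have Y0: "1 \<le> Y" using Y1 n1 by simp
    have Y2: "1 * Y \<le> n * Y" using n1 by (intro mult_le_mono1)
    have nY: "n * Y = n ^ 2 * W ^ 3" by (simp add: Y_def power2_eq_square)
    have e: "n * (200 * Y + k) = 200 * (n * Y) + k * n" for k by (simp add: algebra_simps)
    have "(n * (1 + 4) + 4) + (200 * Y + (((n * (200 * Y + (6 + 4)) + 4) + ((n * (1 + 4) + 4) + (n * (200 * Y + (7 + 4)) + 4) + 1) + 1) + 2) + 1) + 1
      \<le> 1000 * (n * Y)"
    proof -
      define Z where "Z = n * Y"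
      have "1 * Y \<le> Z" using Y2 by (simp only: Z_def)
      then show ?thesis unfolding e Z_def[symmetric] using Y1 Y0 by simp
    qed
    then show "(n * (1 + 4) + 4) + (TL + (((n * ((TL + 6) + 4) + 4) + ((n * (1 + 4) + 4) + (n * ((TL + 7) + 4) + 4) + 1) + 1) + 2) + 1) + 1
      \<le> 1000 * n ^ 2 * W ^ 3"
      by (simp only: nY) (simp add: Y_def algebra_simps)
  qed auto
qed

lemma good_mono: "good N G s \<Longrightarrow> rmem s 6 0 \<le> rmem s' 6 0 \<Longrightarrow> good N G s'"
  unfolding good_def by (meson order_trans)

lemma pre_self: "pre b s \<Longrightarrow> pre (rmem s 6 0) s"
  by (simp add: pre_def)

lemma halts_jc:
  assumes s: "ok s" "feas s" "rmem s 19 0 = a0" "\<forall>c\<ge>Mx. nmem s 3 c = 0" "nmem s 7 0 = N" "nmem s 8 0 = C"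
    and U: "U = real (Suc (nmem s 9 0)) * rmem s 17 0" and CW: "C \<le> W" "N \<le> W"
  shows "halts orc jc s (C * (4000 * n ^ 3 * W ^ 5 + 4) + 10) (\<lambda>s'. pre (rmem s 6 0) s' \<and> (\<forall>G<C. good N G s'))"
proof -
  let ?v = "U * real (L ^ K)"
  let ?s1 = "rwrite 11 0 thr (rwrite 12 0 unit (rwrite 10 0 ?v s))"
  have c: "nmem s 4 0 = L" "nmem s 6 0 = L ^ K" using s by (simp_all add: ok_def ok0_def)
  have p1: "pre (rmem s 6 0) ?s1" using s by (simp add: pre_def ok_write feas_write)
  let ?I = "\<lambda>i s'. pre (rmem s 6 0) s' \<and> (\<forall>G<i. good N G s')"
  have loop: "halts orc (For 10 (NV 8) runc) ?s1 (C * (4000 * n ^ 3 * W ^ 5 + 4) + 4) (?I C)"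
  proof (rule halts_For[where I = ?I])
    fix i s' assume I: "i < C" "?I i s'" "nmem s' 10 0 = i" "frame (For 10 (NV 8) runc) ?s1 s'"
    have N': "nmem s' 7 0 = N" using I(4) s by (simp add: frame_def)
    have "halts orc runc s' (4000 * n ^ 3 * W ^ 5) (\<lambda>s''. pre (rmem s' 6 0) s'' \<and> good N i s'')"
      by (rule halts_runc[OF pre_self I(3) _ N' CW(2)]) (use I(1,2) CW in auto)
    then show "halts orc runc s' (4000 * n ^ 3 * W ^ 5) (?I (Suc i))"
    proof (rule halts_weaken)
      fix s'' assume s'': "pre (rmem s' 6 0) s'' \<and> good N i s''"
      then have "rmem s' 6 0 \<le> rmem s'' 6 0" by (simp add: pre_def)
      moreover have "rmem s 6 0 \<le> rmem s' 6 0" using I(2) by (simp add: pre_def)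
      ultimately show "?I (Suc i) s''" using s'' I(2) good_mono by (auto simp: pre_def less_Suc_eq)
    qed simp
  next
    fix i s' v assume "?I i s'"
    then show "?I i (nwrite 10 0 v s')" by (simp add: pre_def ok_write feas_write good_def)
  qed (use p1 s in auto)
  have "halts orc jc s ((C * (4000 * n ^ 3 * W ^ 5 + 4) + 4) + 2 + 2 + 2) (?I C)"
    unfolding jc_def blk.simps
  proof (rule halts_RSeq_eq[where j = 0 and v = ?v], simp_all only: nval.simps)
    have e: "(1 + real (nmem s 9 0)) * rmem s 17 0 = U" unfolding U by simp
    show "rval s (RMul (RMul (RNat (NAdd (NV 9) (NC 1))) (RV 17)) (RNat (NV 6))) = ?v"
      using c by (simp add: e)
    show "halts orc (Seq (RS 12 (RDiv (RV 10) (RNat (NMul (NC 8) (pw 5)))))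
       (Seq (RS 11 (RDiv (RV 10) (RNat (NMul (NC 4) (pw 2))))) (For 10 (NV 8) runc)))
       (rwrite 10 0 ?v s) ((C * (4000 * n ^ 3 * W ^ 5 + 4) + 4) + 2 + 2) (?I C)"
      apply (rule halts_RSeq_eq[where j = 0 and v = unit])
      subgoal by simp
      subgoal using c by (simp add: unit_def)
      apply (rule halts_RSeq_eq[where j = 0 and v = thr])
      subgoal by simp
      subgoal using c by (simp add: thr_def)
      subgoal by (rule loop)
      done
  qed
  then show ?thesis by (rule halts_weaken) simp_all
qed

end

lemma halts_nfc:
  assumes "nmem s 4 0 = l" "nmem s 5 0 = k" "nmem s 6 0 = 1"
  shows "halts orc nfc s (k * (1 + 4) + 4) (\<lambda>s'. nmem s' 6 0 = l ^ k)"
  unfolding nfc_def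
proof (rule halts_For[where I = "\<lambda>i s'. nmem s' 6 0 = l ^ i"])
  fix i s' assume I: "nmem s' 6 0 = l ^ i" "frame (For 29 (NV 5) (NS 6 (NMul (NV 6) (NV 4)))) s s'"
  have "nmem s' 4 0 = l" using I(2) assms by (simp add: frame_def)
  then show "halts orc (NS 6 (NMul (NV 6) (NV 4))) s' 1 (\<lambda>s'. nmem s' 6 0 = l ^ Suc i)"
    by (intro halts_NSet) (simp add: I(1) mult.commute)
qed (use assms in auto)

lemma halts_cntc:
  assumes "nmem s 7 0 = k" "nmem s 8 0 = 1"
  shows "halts orc cntc s (k * (1 + 4) + 4) (\<lambda>s'. nmem s' 8 0 = 6 ^ k)"
  unfolding cntc_def
  by (rule halts_For[where I = "\<lambda>i s'. nmem s' 8 0 = 6 ^ i"])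
     (use assms in \<open>auto intro!: halts_NSet[unfolded One_nat_def]\<close>)

lemma halts_a0c:
  assumes "nmem s 4 0 = l" "rmem s 19 0 = 1"
  shows "halts orc a0c s (l * (1 + 4) + 4) (\<lambda>s'. rmem s' 19 0 = (real l / real (Suc l)) ^ l)"
  unfolding a0c_def
proof (rule halts_For[where I = "\<lambda>i s'. rmem s' 19 0 = (real l / real (Suc l)) ^ i"])
  let ?b = "RS 19 (RMul (RV 19) (RDiv (RNat (NV 4)) (RNat (NAdd (NV 4) (NC 1)))))"
  fix i s' assume I: "rmem s' 19 0 = (real l / real (Suc l)) ^ i" "frame (For 29 (NV 4) ?b) s s'"
  have "nmem s' 4 0 = l" using I(2) assms by (simp add: frame_def)
  then show "halts orc ?b s' 1 (\<lambda>s'. rmem s' 19 0 = (real l / real (Suc l)) ^ Suc i)"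
    by (intro halts_RSet) (simp add: I(1) mult.commute)
qed (use assms in auto)

lemma halts_paramc:
  assumes l: "nmem s 4 0 = l" and k: "k = 8 * l ^ 3" and N: "N = 3400 * l ^ 14"
  shows "halts orc paramc s (5 * (k + N + l) + 40) (\<lambda>s'. nmem s' 5 0 = k \<and> nmem s' 6 0 = l ^ k \<and> nmem s' 7 0 = N
    \<and> nmem s' 8 0 = 6 ^ N \<and> rmem s' 19 0 = (real l / real (Suc l)) ^ l)" (is "halts orc paramc s _ ?Q")
proof -
  let ?s2 = "nwrite 6 0 1 (nwrite 5 0 k s)"
  have n: "halts orc nfc ?s2 (k * (1 + 4) + 4) (\<lambda>s'. nmem s' 6 0 = l ^ k)"
    by (rule halts_nfc) (use l in simp_all)
  have "halts orc (Seq nfc (Seq (NS 7 (NMul (NC 3400) (pw 14))) (Seq (NS 8 (NC 1)) (Seq cntc (Seq (RS 19 (RNat (NC 1))) a0c))))) ?s2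
     ((k * (1 + 4) + 4) + (((N * (1 + 4) + 4) + ((l * (1 + 4) + 4) + 2) + 1) + 2 + 2) + 1) ?Q"
  proof (rule halts_Seq[OF n _ le_refl])
    fix s3 assume s3: "nmem s3 6 0 = l ^ k" "frame nfc ?s2 s3"
    have e3: "nmem s3 4 0 = l" "nmem s3 5 0 = k" using s3(2) l by (simp_all add: frame_def)
    let ?s5 = "nwrite 8 0 1 (nwrite 7 0 N s3)"
    have c: "halts orc cntc ?s5 (N * (1 + 4) + 4) (\<lambda>s'. nmem s' 8 0 = 6 ^ N)"
      by (rule halts_cntc) simp_all
    have "halts orc (Seq cntc (Seq (RS 19 (RNat (NC 1))) a0c)) ?s5 ((N * (1 + 4) + 4) + ((l * (1 + 4) + 4) + 2) + 1) ?Q"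
    proof (rule halts_Seq[OF c _ le_refl], rule halts_RSeq_eq[where j = 0 and v = 1])
      fix s6 assume s6: "nmem s6 8 0 = 6 ^ N" "frame cntc ?s5 s6"
      have e6: "nmem s6 4 0 = l" "nmem s6 5 0 = k" "nmem s6 6 0 = l ^ k" "nmem s6 7 0 = N"
        using s6(2) e3 s3(1) by (simp_all add: frame_def)
      have a: "halts orc a0c (rwrite 19 0 1 s6) (l * (1 + 4) + 4) (\<lambda>s'. rmem s' 19 0 = (real l / real (Suc l)) ^ l)"
        by (rule halts_a0c) (use e6 in simp_all)
      show "halts orc a0c (rwrite 19 0 1 s6) (l * (1 + 4) + 4) ?Q"
        by (rule halts_mono[OF a le_refl]) (use e6 s6(1) in \<open>simp add: frame_def\<close>)
    qed simp_all
    then show "halts orc (Seq (NS 7 (NMul (NC 3400) (pw 14))) (Seq (NS 8 (NC 1)) (Seq cntc (Seq (RS 19 (RNat (NC 1))) a0c)))) s3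
       (((N * (1 + 4) + 4) + ((l * (1 + 4) + 4) + 2) + 1) + 2 + 2) ?Q"
      by (intro halts_NSeq_eq[where j = 0 and v = N] halts_NSeq_eq[where j = 0 and v = 1]) (use e3 N in simp_all)
  qed
  then have "halts orc paramc s (((k * (1 + 4) + 4) + (((N * (1 + 4) + 4) + ((l * (1 + 4) + 4) + 2) + 1) + 2 + 2) + 1) + 2 + 2) ?Q"
    unfolding paramc_def blk.simps
    by (intro halts_NSeq_eq[where j = 0 and v = k] halts_NSeq_eq[where j = 0 and v = 1]) (use l k in simp_all)
  then show ?thesis by (rule halts_weaken) simp_all
qed

context prog
begin

lemma fold_pad: "fold ostep (replicate k 0) (A, t, i, m, D) = (A, t, i, m + k, D)"
  by (induction k arbitrary: m) (auto simp: ostep_def)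

text \<open>The program tries lists of length exactly \<open>N\<close>. A shorter list is padded
  with operation 0, which only raises the guess \<open>m\<close> and leaves all cells as they
  are.\<close>

lemma good_use:
  assumes st: "steps {} N (A, t, i, m, D)" and p: "p < L ^ K" "sum w (its A p) \<le> 1"
    and good: "\<forall>G<6 ^ N. good N G s"
  shows "F (its A p) \<le> rmem s 6 0"
proof -
  obtain os where os: "length os \<le> N" "\<forall>c\<in>set os. c < 6" "fold ostep os (bs {}, 0, 0, 0, a0) = (A, t, i, m, D)"
    using st unfolding steps_def by blast
  define ps where "ps = os @ replicate (N - length os) 0"
  have ps: "length ps = N" "\<forall>c\<in>set ps. c < 6" using os by (auto simp: ps_def)
  have ps3: "fold ostep ps (bs {}, 0, 0, 0, a0) = (A, t, i, m + (N - length os), D)"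
    unfolding ps_def fold_append comp_apply os(3) by (rule fold_pad)
  obtain G where G: "G < 6 ^ N" "\<forall>j<N. dig 6 G j = ps ! j"
    using dig_surj[of N "\<lambda>j. ps ! j" 6] ps by auto
  have "map (dig 6 G) [0..<N] = ps"
    by (rule nth_equalityI) (use G ps in auto)
  then show ?thesis using good G(1) ps3 p unfolding good_def by blast
qed

end

lemma main_run:
  fixes e :: real
  assumes setf: "setfun n F w" and orc: "\<And>v. orc v = F {x. x < n \<and> v x \<noteq> 0}" and n1: "1 \<le> n"
    and e: "0 < e" "e < 1"
    and s: "nmem s 0 0 = n" "\<And>a i. 0 < a \<Longrightarrow> nmem s a i = 0" "rmem s 0 0 = e" "\<forall>x<n. rmem s 1 x = w x"
      "\<And>a i. 1 < a \<Longrightarrow> rmem s a i = 0"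
  defines "L \<equiv> nat \<lceil>7 / e\<rceil>"
  defines "K \<equiv> 8 * L ^ 3" and "N \<equiv> 3400 * L ^ 14"
  defines "W \<equiv> 6 ^ N * L ^ K"
  shows "halts orc prog_com s (8000 * n ^ 4 * W ^ 6) (\<lambda>s'. sum w {x. x < n \<and> nmem s' 1 x \<noteq> 0} \<le> 1
     \<and> rmem s' 6 0 \<le> F {x. x < n \<and> nmem s' 1 x \<noteq> 0}
     \<and> (\<exists>M. (\<forall>x<n. F {x} \<le> M) \<and> (M = 0 \<or> (\<exists>x<n. M = F {x}))
        \<and> (\<forall>j<n. \<forall>A t i m D p. alg.steps n F w L K (real (Suc j) * M) {} N (A, t, i, m, D) \<longrightarrow> p < L ^ K
            \<longrightarrow> sum w (items n L K A (dig L p)) \<le> 1 \<longrightarrow> F (items n L K A (dig L p)) \<le> rmem s' 6 0)))"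
proof -
  have "0 < \<lceil>7 / e\<rceil>" using e by simp
  then have L1: "1 \<le> L" unfolding L_def by linarith
  have p: "1 \<le> L ^ k" for k using L1 by simp
  have N6: "N < 6 ^ N" by (rule less_le_trans[OF less_exp]) (simp add: power_mono)
  have C_W: "6 ^ N \<le> W" and NF_W: "L ^ K \<le> W" using p by (simp_all add: W_def)
  have NW: "N \<le> W" using N6 C_W by linarith
  have "L ^ 1 \<le> L ^ 14" "L ^ 3 \<le> L ^ 14" using L1 by (intro power_increasing; simp)+
  then have LN: "L \<le> N" "K \<le> N" by (simp_all add: N_def K_def)
  then have LW: "L \<le> W" "K \<le> W" using NW by linarith+
  have W1: "1 \<le> W" using L1 LW by simp
  have a: "alg n F w L" by (intro alg.intro setf alg_axioms.intro L1)
  \<comment> \<open>Preprocessing runs before \<open>K\<close> is stored. Array 5 still holds 0, so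
    the slots are not read and the instance with \<open>K = 0\<close> describes what
    \<open>load\<close> evaluates.\<close>
  interpret P0: prog n F w L 0 0 orc W
    by (intro prog.intro a prog_axioms.intro orc n1 W1) (use LW W1 in simp_all)
  have P: "prog n F w L K orc W"
    by (intro prog.intro a prog_axioms.intro orc n1 W1 NF_W LW)
  \<comment> \<open>The estimate \<open>U\<close> changes from round to round of the outer loop
    while the facts about the recorded set do not mention it; hence one interpretation for all
    \<open>U\<close>.\<close>
  interpret P: prog n F w L K U orc W for U by (rule P)
  let ?Z = "\<lambda>s. nmem s 3 = (\<lambda>_. 0)"
  let ?G = "\<lambda>M j s'. \<forall>j'<j. \<forall>G<6 ^ N. P.good (real (Suc j') * M) N G s'"
  let ?TJ = "6 ^ N * (4000 * n ^ 3 * W ^ 5 + 4) + 10"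
  have main: "halts orc (For 9 (NV 0) jc) s3 (n * (?TJ + 4) + 4) (\<lambda>s'. P.feas s' \<and> ?G M n s')"
    if s3: "P.ok s3" "P.feas s3" "rmem s3 19 0 = P.a0" "?Z s3" "nmem s3 7 0 = N" "nmem s3 8 0 = 6 ^ N" "rmem s3 17 0 = M"
    for s3 M
  proof -
    let ?I = "\<lambda>j s'. P.ok s' \<and> P.feas s' \<and> (\<forall>c\<ge>P.Mx. nmem s' 3 c = 0) \<and> ?G M j s'"
    have "halts orc (For 9 (NV 0) jc) s3 (n * (?TJ + 4) + 4) (?I n)"
    proof (rule halts_For[where I = ?I])
      fix j s' assume I: "j < n" "?I j s'" "nmem s' 9 0 = j" and f: "frame (For 9 (NV 0) jc) s3 s'"
      have r: "rmem s' 19 0 = P.a0" "nmem s' 7 0 = N" "nmem s' 8 0 = 6 ^ N" "rmem s' 17 0 = M"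
        using f s3 by (simp_all add: frame_def)
      have "halts orc jc s' ?TJ (\<lambda>s''. P.pre (real (Suc j) * M) (rmem s' 6 0) s'' \<and> (\<forall>G<6 ^ N. P.good (real (Suc j) * M) N G s''))"
        by (rule P.halts_jc) (use I r C_W NW in auto)
      then show "halts orc jc s' ?TJ (?I (Suc j))"
      proof (rule halts_weaken)
        fix s'' assume a: "P.pre (real (Suc j) * M) (rmem s' 6 0) s'' \<and> (\<forall>G<6 ^ N. P.good (real (Suc j) * M) N G s'')"
        then have b: "rmem s' 6 0 \<le> rmem s'' 6 0" by (simp add: P.pre_def)
        have "?G M j s''" using I(2) P.good_mono[OF _ b] by blast
        then have "?G M (Suc j) s''" using a by (auto simp: less_Suc_eq simp del: of_nat_Suc)
        moreover have "P.ok s'' \<and> P.feas s'' \<and> (\<forall>c\<ge>P.Mx. nmem s'' 3 c = 0)" using a by (simp add: P.pre_def)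
        ultimately show "?I (Suc j) s''" by blast
      qed simp
    next
      fix j s' v assume I: "?I j s'"
      have "?G M j (nwrite 9 0 v s')" using I by (auto simp: P.good_def)
      then show "?I j (nwrite 9 0 v s')" using I by (simp add: P.ok_write P.feas_write)
    next
      show "nval s3 (NV 0) = n" using s3(1) by (simp add: P.ok_def P.ok0_def)
      show "?I 0 s3" using s3 by simp
    qed auto
    then show ?thesis by (rule halts_weaken) auto
  qed
  define Q where "Q = (\<lambda>s'. \<exists>M. P.feas s' \<and> (\<forall>x<n. F {x} \<le> M) \<and> (M = 0 \<or> (\<exists>x<n. M = F {x})) \<and> ?G M n s')"
  have "halts orc prog_com s ((5 * L + 10) + (1000 * n ^ 2 * W ^ 3 + ((5 * (K + N + L) + 40) + (n * (?TJ + 4) + 4) + 1) + 1) + 1) Q"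
    unfolding prog_com_def blk.simps
  proof (rule halts_Seq[OF halts_lloop[OF e s(3), folded L_def] _ le_refl])
    fix s1 assume s1: "nmem s1 4 0 = L" "frame lloopc s s1"
    have f1: "rmem s1 = rmem s" "\<And>a. a \<noteq> 4 \<Longrightarrow> nmem s1 a = nmem s a" using s1(2) by (auto simp: frame_def fun_eq_iff)
    have o1: "P0.ok0 s1" using s s1(1) f1 by (simp add: P0.ok0_def)
    have out1: "P0.out s1 = {}" using s f1 by (simp add: P0.out_def)
    have g1: "P0.feas s1" using s f1 P0.nonneg[of "{}"] by (simp add: P0.feas_def out1)
    have z1: "nmem s1 23 0 = 0" "?Z s1" "rmem s1 17 0 = 0" using s f1 by (auto simp: fun_eq_iff)
    show "halts orc (Seq prepc (Seq paramc (For 9 (NV 0) jc))) s1 (1000 * n ^ 2 * W ^ 3 + ((5 * (K + N + L) + 40) + (n * (?TJ + 4) + 4) + 1) + 1) Q"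
    proof (rule halts_Seq[OF P0.halts_prep[OF o1 g1 z1] _ le_refl])
      fix s2 assume s2: "P0.feas s2 \<and> ?Z s2 \<and> (\<forall>x<n. rmem s2 2 x = P0.ell x)
        \<and> (\<forall>x<n. F {x} \<le> rmem s2 17 0) \<and> (rmem s2 17 0 = 0 \<or> (\<exists>x<n. rmem s2 17 0 = F {x}))" "frame prepc s1 s2"
      define M where "M = rmem s2 17 0"
      have e2: "nmem s2 4 0 = L" "nmem s2 0 0 = n" "\<forall>x<n. rmem s2 1 x = w x"
        using s2(2) s1(1) f1 s by (simp_all add: frame_def)
      show "halts orc (Seq paramc (For 9 (NV 0) jc)) s2 ((5 * (K + N + L) + 40) + (n * (?TJ + 4) + 4) + 1) Q"
      proof (rule halts_Seq[OF halts_paramc[OF e2(1) meta_eq_to_obj_eq[OF K_def] meta_eq_to_obj_eq[OF N_def]] _ le_refl])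
        fix s3 assume s3: "nmem s3 5 0 = K \<and> nmem s3 6 0 = L ^ K \<and> nmem s3 7 0 = N \<and> nmem s3 8 0 = 6 ^ N
          \<and> rmem s3 19 0 = (real L / real (Suc L)) ^ L" "frame paramc s2 s3"
        have e3: "nmem s3 4 0 = L" "nmem s3 0 0 = n" "\<forall>x<n. rmem s3 1 x = w x" "?Z s3" "\<forall>x<n. rmem s3 2 x = P0.ell x"
          "rmem s3 17 0 = M"
          using s3(2) e2 s2(1) by (simp_all add: frame_def M_def)
        have "P.ok s3" using s3(1) e3 by (simp add: P.ok_def P.ok0_def)
        moreover have "P.feas s3" using s2(1) s3(2) by (auto simp: P.feas_def P.out_def frame_def)
        ultimately have "halts orc (For 9 (NV 0) jc) s3 (n * (?TJ + 4) + 4) (\<lambda>s'. P.feas s' \<and> ?G M n s')"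
          using main[of s3 M] s3(1) e3 by (simp add: P.a0_def)
        then show "halts orc (For 9 (NV 0) jc) s3 (n * (?TJ + 4) + 4) Q"
          by (rule halts_weaken) (use s2(1) in \<open>auto simp: Q_def M_def[symmetric] simp del: of_nat_Suc\<close>)
      qed
    qed
  qed
  then show ?thesis
  proof (rule halts_weaken)
    have np: "1 \<le> n ^ k" "1 \<le> W ^ k" for k using n1 W1 by simp_all
    define Y where "Y = n ^ 4 * W ^ 6"
    define R where "R = n ^ 3 * W ^ 5"
    have R1: "1 * 1 \<le> R" unfolding R_def by (intro mult_le_mono np)
    have Y1: "1 * 1 \<le> Y" unfolding Y_def by (intro mult_le_mono np)
    have "1 * W \<le> n ^ 4 * W ^ 6" using W1 by (intro mult_le_mono np self_le_power) auto
    then have WY: "W \<le> Y" by (simp add: Y_def)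
    have "n * 1 \<le> n ^ 4 * W ^ 6" using n1 by (intro mult_le_mono np self_le_power) auto
    then have nY: "n \<le> Y" by (simp add: Y_def)
    have pY: "n ^ 2 * W ^ 3 \<le> Y" unfolding Y_def using n1 W1 by (intro mult_le_mono power_increasing) auto
    have "6 ^ N * (4000 * R + 4) \<le> W * (4004 * R)" using R1 by (intro mult_le_mono C_W) simp
    then have "n * (6 ^ N * (4000 * R + 4)) \<le> n * (W * (4004 * R))" by (rule mult_le_mono2)
    also have "\<dots> = 4004 * Y"
    proof -
      have "W ^ 6 = W * W ^ 5" "n ^ 4 = n * n ^ 3" using power_Suc[of W 5] power_Suc[of n 3] by simp_all
      then show ?thesis unfolding Y_def R_def by (simp only: ac_simps)
    qed
    finally have nTJ: "n * (6 ^ N * (4000 * R + 4)) \<le> 4004 * Y" .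
    have "n * (6 ^ N * (4000 * R + 4) + 10 + 4) = n * (6 ^ N * (4000 * R + 4)) + 14 * n" by (simp add: algebra_simps)
    then have J: "n * (6 ^ N * (4000 * R + 4) + 10 + 4) \<le> 4018 * Y" using nTJ nY by linarith
    have "x \<le> 4018 * Y \<Longrightarrow> y \<le> Y \<Longrightarrow>
      (5 * L + 10) + (1000 * y + ((5 * (K + N + L) + 40) + (x + 4) + 1) + 1) + 1 \<le> 8000 * Y" for x y
      using WY LW NW Y1 by simp
    from this[OF J pY] show "(5 * L + 10) + (1000 * n ^ 2 * W ^ 3 + ((5 * (K + N + L) + 40) + (n * (?TJ + 4) + 4) + 1) + 1) + 1
      \<le> 8000 * n ^ 4 * W ^ 6"
      by (simp only: Y_def R_def mult.assoc)
  next
    fix s' assume "Q s'"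
    then obtain M where M: "P.feas s'" "\<forall>x<n. F {x} \<le> M" "M = 0 \<or> (\<exists>x<n. M = F {x})" "?G M n s'"
      unfolding Q_def by blast
    have "\<forall>j<n. \<forall>A t i m D p. P.steps (real (Suc j) * M) {} N (A, t, i, m, D) \<longrightarrow> p < L ^ K
            \<longrightarrow> sum w (items n L K A (dig L p)) \<le> 1 \<longrightarrow> F (items n L K A (dig L p)) \<le> rmem s' 6 0"
      using M(4) P.good_use by blast
    then show "sum w {x. x < n \<and> nmem s' 1 x \<noteq> 0} \<le> 1
     \<and> rmem s' 6 0 \<le> F {x. x < n \<and> nmem s' 1 x \<noteq> 0}
     \<and> (\<exists>M. (\<forall>x<n. F {x} \<le> M) \<and> (M = 0 \<or> (\<exists>x<n. M = F {x}))
        \<and> (\<forall>j<n. \<forall>A t i m D p. P.steps (real (Suc j) * M) {} N (A, t, i, m, D) \<longrightarrow> p < L ^ K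
            \<longrightarrow> sum w (items n L K A (dig L p)) \<le> 1 \<longrightarrow> F (items n L K A (dig L p)) \<le> rmem s' 6 0))"
      using M(1-3) unfolding P.feas_def P.out_def by blast
  qed
qed

section \<open>The main theorem\<close>

context setfun
begin

lemma F_le_sum:
  assumes "finite X" "X \<noteq> {}" "X \<subseteq> {..<n}"
  shows "F X \<le> (\<Sum>x\<in>X. F {x})"
  using assms
proof (induction X rule: finite_ne_induct)
  case (insert x X)
  have "F ({x} \<union> X) + F ({x} \<inter> X) \<le> F {x} + F X" by (rule subm) (use insert in auto)
  moreover have "0 \<le> F ({x} \<inter> X)" by (rule nonneg) (use insert in auto)
  ultimately show ?case using insert by simp
qed simp

lemma F_diff_le_sum:
  assumes "finite X" "X \<subseteq> {..<n}"
  shows "F X - F {} \<le> (\<Sum>x\<in>X. F {x})"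
  using F_le_sum[of X] assms nonneg[of "{}"] by (cases "X = {}") auto

end

context alg
begin

text \<open>Summed over \<open>Os\<close>, the curvature bound shows that the part of
  \<open>F Os\<close> not covered by \<open>ell\<close> is at most \<open>c * F Os\<close>. The
  losses, in multiples of \<open>FO / L\<close>, are 4 from the run, 2 from replacing the optimum by
  \<open>Os\<close>, and 1 from \<open>a0\<close> exceeding \<open>1 / e\<close>; this is the origin
  of \<open>L \<ge> 7 / \<epsilon>\<close>.\<close>

lemma final_bound:
  fixes c e v FO :: real
  assumes U: "0 < U" "U \<le> FO" and Os: "Os \<subseteq> {..<n}" "FO - 2 * U / real L \<le> F Os"
    and c: "0 \<le> c" "c \<le> 1" "\<And>x. x < n \<Longrightarrow> (1 - c) * F {x} \<le> ell x" and Le: "7 \<le> real L * e"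
    and v: "F Os - a0 * (F Os - F {} - sum ell Os) - 4 * U / real L \<le> v"
  shows "(1 - c / exp 1 - e) * FO \<le> v"
proof -
  have L: "0 < real L" using L1 by simp
  define t where "t = U / real L"
  have fin: "finite Os" using Os finite_subset by blast
  have FOs: "F {} \<le> F Os" "0 \<le> F {}" using mono[of "{}" Os] nonneg[of "{}"] Os by auto
  have "(1 - c) * (F Os - F {}) \<le> (1 - c) * (\<Sum>x\<in>Os. F {x})"
    using F_diff_le_sum[OF fin Os(1)] c by (intro mult_left_mono) auto
  also have "\<dots> \<le> sum ell Os"
    unfolding sum_distrib_left by (rule sum_mono) (use c(3) Os in auto)
  finally have "F Os - F {} - sum ell Os \<le> c * (F Os - F {})" by (simp add: algebra_simps)
  also have "\<dots> \<le> c * F Os" using c FOs by (intro mult_left_mono) auto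
  finally have "a0 * (F Os - F {} - sum ell Os) \<le> a0 * (c * F Os)"
    using a0_bounds(1) by (intro mult_left_mono) auto
  then have 1: "(1 - a0 * c) * F Os - 4 * t \<le> v" using v by (simp add: t_def algebra_simps)
  have ac: "0 \<le> a0 * c" "a0 * c \<le> 1" using a0_bounds c by (auto intro: mult_le_one)
  have "(1 - a0 * c) * (FO - 2 * t) \<le> (1 - a0 * c) * F Os"
    using ac Os(2) by (intro mult_left_mono) (auto simp: t_def)
  moreover have "0 \<le> a0 * c * (2 * t)" using U L by (intro mult_nonneg_nonneg[OF ac(1)]) (auto simp: t_def)
  moreover have "(1 - k) * (FO - 2 * r) \<le> (1 - k) * x \<Longrightarrow> 0 \<le> k * (2 * r)
      \<Longrightarrow> (1 - k) * x - 4 * r \<le> v \<Longrightarrow> (1 - k) * FO - 6 * r \<le> v" for k x r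
    by (simp add: algebra_simps)
  ultimately have "(1 - a0 * c) * FO - 6 * t \<le> v" using 1 by blast
  then have 2: "(1 - a0 * c) * FO - 6 * U / real L \<le> v" by (simp add: t_def)
  have "6 * U / real L \<le> 6 * FO / real L" using U L by (intro divide_right_mono) auto
  then have 3: "(1 - a0 * c - 6 / real L) * FO \<le> v" using 2 by (simp add: algebra_simps)
  have "a0 * c \<le> (1 + 1 / real L) / exp 1 * c" using a0_bounds(3) c by (intro mult_right_mono)
  also have "\<dots> = c / exp 1 + c / exp 1 / real L" by (simp add: field_simps)
  also have "\<dots> \<le> c / exp 1 + 1 / real L"
  proof -
    have "c / exp 1 \<le> 1" using c(2) exp_ge_add_one_self[of "1::real"] by (simp add: divide_le_eq)
    then show ?thesis using L by (intro add_left_mono divide_right_mono) auto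
  qed
  finally have "a0 * c + 6 / real L \<le> c / exp 1 + 7 / real L" by simp
  moreover have "7 / real L \<le> e" using Le L by (simp add: field_simps)
  ultimately have "1 - c / exp 1 - e \<le> 1 - a0 * c - 6 / real L" by simp
  then have "(1 - c / exp 1 - e) * FO \<le> (1 - a0 * c - 6 / real L) * FO" using U by (intro mult_right_mono) auto
  then show ?thesis using 3 by simp
qed

end

text \<open>From \<open>6 \<le> 2 ^ 3\<close> and \<open>L ^ (8 * L ^ 3) \<le> 2 ^ N\<close> the
  sixth power is at most \<open>2 ^ (24 * N)\<close>. Now \<open>24 * 3400 = 81600\<close>, and
  \<open>L \<le> 8 / e\<close> gives the factor \<open>8 ^ 14\<close>. The bound is smallest at
  curvature 0, so its growth with \<open>c\<close> can be discarded.\<close>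

lemma time_bound_ge:
  fixes e c :: real
  assumes n: "1 \<le> n" and e: "0 < e" "e < 1" and c: "0 \<le> c" "c < 1"
  defines "L \<equiv> nat \<lceil>7 / e\<rceil>"
  shows "real (8000 * n ^ 4 * (6 ^ (3400 * L ^ 14) * L ^ (8 * L ^ 3)) ^ 6)
    \<le> 8000 * time_bound [:1:] (monom (81600 * 8 ^ 14) 14) n e c"
proof -
  have "0 < \<lceil>7 / e\<rceil>" using e by simp
  then have L1: "1 \<le> L" unfolding L_def by linarith
  have "real L = of_int \<lceil>7 / e\<rceil>" using \<open>0 < \<lceil>7 / e\<rceil>\<close> by (simp add: L_def)
  then have "real L \<le> 7 / e + 1" using of_int_ceiling_le_add_one[of "7 / e"] by simp
  also have "\<dots> \<le> 8 / e" using e by (simp add: field_simps)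
  finally have L8: "real L \<le> 8 * (1 / e)" by simp
  define N where "N = 3400 * L ^ 14"
  define q where "q = 81600 * 8 ^ 14 * (1 / e) ^ 14"
  have q: "poly (monom (81600 * 8 ^ 14) 14) (1 / e) = q" by (simp only: poly_monom q_def)
  have q0: "0 \<le> q" using e by (simp add: q_def)
  have "(6::nat) ^ N \<le> 8 ^ N" by (rule power_mono) simp_all
  also have "\<dots> = 2 ^ (3 * N)" by (simp add: power_mult)
  finally have W1: "(6::nat) ^ N \<le> 2 ^ (3 * N)" .
  have "L ^ (8 * L ^ 3) \<le> (2 ^ L) ^ (8 * L ^ 3)" by (rule power_mono) (simp_all add: less_imp_le)
  also have "\<dots> = 2 ^ (8 * L ^ 4)" by (simp add: power_mult[symmetric] power_Suc[symmetric] mult.left_commute del: power_Suc)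
  also have "\<dots> \<le> 2 ^ N"
  proof (rule power_increasing)
    have "L ^ 4 \<le> L ^ 14" using L1 by (intro power_increasing) auto
    then show "8 * L ^ 4 \<le> N" by (simp add: N_def)
  qed simp
  finally have "6 ^ N * L ^ (8 * L ^ 3) \<le> 2 ^ (3 * N) * 2 ^ N" using W1 by (intro mult_le_mono)
  also have "\<dots> = 2 ^ (4 * N)" by (simp add: power_add[symmetric])
  finally have "(6 ^ N * L ^ (8 * L ^ 3)) ^ 6 \<le> (2 ^ (4 * N)) ^ 6" by (rule power_mono) simp
  also have "\<dots> = 2 ^ (24 * N)" by (simp add: power_mult[symmetric])
  finally have "real ((6 ^ N * L ^ (8 * L ^ 3)) ^ 6) \<le> real (2 ^ (24 * N))" by (simp only: of_nat_le_iff)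
  also have "\<dots> = 2 powr real (24 * N)" by (simp only: of_nat_power of_nat_numeral powr_realpow zero_less_numeral)
  also have "\<dots> \<le> 2 powr q"
  proof (rule powr_mono)
    have "real (24 * N) = 81600 * real L ^ 14" by (simp add: N_def)
    also have "\<dots> \<le> 81600 * (8 * (1 / e)) ^ 14" using L8 by (intro mult_left_mono power_mono) auto
    also have "\<dots> = q" by (simp only: q_def power_mult_distrib mult.assoc)
    finally show "real (24 * N) \<le> q" .
  qed simp
  also have "\<dots> \<le> 2 powr (q / (1 - c))"
    using c q0 by (intro powr_mono) (auto simp: le_divide_eq mult_left_le)
  also have "\<dots> \<le> max 2 (1 / e * ln (1 / (1 - c))) powr (q / (1 - c))"
    using c q0 by (intro powr_mono2) auto
  finally have W: "real ((6 ^ N * L ^ (8 * L ^ 3)) ^ 6) \<le> max 2 (1 / e * ln (1 / (1 - c))) powr (q / (1 - c))" .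
  have c1: "1 \<le> 1 / (1 - c)\<^sup>2" using c by (simp add: power_le_one)
  have n4: "real n ^ 4 * 1 \<le> real n ^ 4 * (1 / (1 - c)\<^sup>2)" by (rule mult_left_mono[OF c1]) simp
  have "real n ^ 4 * 1 * real ((6 ^ N * L ^ (8 * L ^ 3)) ^ 6)
    \<le> real n ^ 4 * (1 / (1 - c)\<^sup>2) * (max 2 (1 / e * ln (1 / (1 - c))) powr (q / (1 - c)))"
    by (rule mult_mono[OF n4 W]) auto
  then have "8000 * (real n ^ 4 * real ((6 ^ N * L ^ (8 * L ^ 3)) ^ 6))
    \<le> 8000 * (real n ^ 4 / (1 - c)\<^sup>2 * (max 2 (1 / e * ln (1 / (1 - c))) powr (q / (1 - c))))"
    by simp
  then show ?thesis
    unfolding time_bound_def q N_def[symmetric] by (simp add: mult.assoc)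
qed

theorem theorem3p3:
  shows "\<exists>(P :: com) (C :: real) (q :: real poly) (p :: real poly).
    \<forall>(E :: 'a set) (xs :: 'a list) (f :: 'a set \<Rightarrow> real) (w :: 'a \<Rightarrow> real) (\<epsilon> :: real).
      finite E \<longrightarrow> E \<noteq> {} \<longrightarrow> distinct xs \<longrightarrow> set xs = E \<longrightarrow>
      (\<forall>S. S \<subseteq> E \<longrightarrow> 0 \<le> f S) \<longrightarrow> mono_on (Pow E) f \<longrightarrow> submodular_on E f \<longrightarrow>
      (\<forall>e\<in>E. 0 \<le> w e \<and> w e \<le> 1) \<longrightarrow> 0 < \<epsilon> \<longrightarrow> \<epsilon> < 1 \<longrightarrow>
      (\<exists>T :: nat.
         halts_within P xs f w \<epsilon> T \<and>
         (curvature E f < 1 \<longrightarrow>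
            real T \<le> C * time_bound q p (card E) \<epsilon> (curvature E f)) \<and>
         (\<forall>S \<in> set_pmf (output_after P xs f w \<epsilon> T). S \<subseteq> E \<and> sum w S \<le> 1) \<and>
         (\<forall>Opt. is_arg_max f (\<lambda>S. S \<subseteq> E \<and> sum w S \<le> 1) Opt \<longrightarrow>
            measure_pmf.expectation (output_after P xs f w \<epsilon> T) f
              \<ge> (1 - curvature E f / exp 1 - \<epsilon>) * f Opt))"
proof (rule exI[of _ prog_com], rule exI[of _ 8000], rule exI[of _ "[:1:]"], rule exI[of _ "monom (81600 * 8 ^ 14) 14"],
    intro allI impI)
  fix E :: "'a set" and xs :: "'a list" and f :: "'a set \<Rightarrow> real" and w :: "'a \<Rightarrow> real" and \<epsilon> :: real
  assume E: "finite E" "E \<noteq> {}" and xs: "distinct xs" "set xs = E"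
    and f0: "\<forall>S. S \<subseteq> E \<longrightarrow> 0 \<le> f S" and fm: "mono_on (Pow E) f" and fs: "submodular_on E f"
    and w: "\<forall>e\<in>E. 0 \<le> w e \<and> w e \<le> 1" and \<epsilon>: "0 < \<epsilon>" "\<epsilon> < 1"
  define n where "n = length xs"
  define g where "g = (!) xs"
  define F where "F X = f (g ` X)" for X
  define u where "u x = w (g x)" for x
  have g: "bij_betw g {..<n} E"
    using bij_betw_nth[OF xs(1), of "{..<n}" E] xs(2) by (simp add: g_def n_def)
  have inj: "inj_on g {..<n}" and img: "g ` {..<n} = E" using g by (auto simp: bij_betw_def)
  have cardE: "card E = n" using bij_betw_same_card[OF g] by simp
  have n1: "1 \<le> n" using E cardE card_gt_0_iff[of E] by linarith
  have sub: "g ` X \<subseteq> E" if "X \<subseteq> {..<n}" for X using that img by blast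
  have sumw: "sum w (g ` X) = sum u X" if "X \<subseteq> {..<n}" for X
    using sum.reindex[OF inj_on_subset[OF inj that], of w] by (simp add: u_def o_def)
  interpret S: setfun n F u
  proof
    show "F A \<le> F B" if "A \<subseteq> B" "B \<subseteq> {..<n}" for A B
      unfolding F_def by (rule mono_onD[OF fm]) (use that sub in auto)
    show "F (A \<union> B) + F (A \<inter> B) \<le> F A + F B" if "A \<subseteq> {..<n}" "B \<subseteq> {..<n}" for A B
    proof -
      have "g ` (A \<inter> B) = g ` A \<inter> g ` B" by (rule inj_on_image_Int[OF inj that])
      then show ?thesis using fs sub[OF that(1)] sub[OF that(2)]
        unfolding F_def submodular_on_def by (metis image_Un)
    qed
    show "0 \<le> F A" if "A \<subseteq> {..<n}" for A using f0 sub[OF that] by (simp add: F_def)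
    show "0 \<le> u x" "u x \<le> 1" if "x < n" for x
      using w img that by (auto simp: u_def)
  qed
  define L where "L = nat \<lceil>7 / \<epsilon>\<rceil>"
  define K where "K = 8 * L ^ 3"
  define N where "N = 3400 * L ^ 14"
  define W where "W = 6 ^ N * L ^ K"
  define T where "T = 8000 * n ^ 4 * W ^ 6"
  have "0 < \<lceil>7 / \<epsilon>\<rceil>" using \<epsilon> by simp
  then have L1: "1 \<le> L" unfolding L_def by linarith
  have "7 / \<epsilon> \<le> real L" unfolding L_def using le_of_int_ceiling[of "7 / \<epsilon>"] by linarith
  then have Le: "7 \<le> real L * \<epsilon>" using \<epsilon> by (simp add: field_simps)
  let ?orc = "\<lambda>v. f (decode xs v)" and ?s = "init_state xs w \<epsilon>"
  have dec: "decode xs v = g ` {x. x < n \<and> v x \<noteq> 0}" for v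
    by (auto simp: decode_def g_def n_def)
  have orc: "?orc v = F {x. x < n \<and> v x \<noteq> 0}" for v by (simp add: dec F_def)
  have "halts ?orc prog_com ?s T (\<lambda>s'. sum u {x. x < n \<and> nmem s' 1 x \<noteq> 0} \<le> 1
     \<and> rmem s' 6 0 \<le> F {x. x < n \<and> nmem s' 1 x \<noteq> 0}
     \<and> (\<exists>M. (\<forall>x<n. F {x} \<le> M) \<and> (M = 0 \<or> (\<exists>x<n. M = F {x}))
        \<and> (\<forall>j<n. \<forall>A t i m D p. alg.steps n F u L K (real (Suc j) * M) {} N (A, t, i, m, D) \<longrightarrow> p < L ^ K
            \<longrightarrow> sum u (items n L K A (dig L p)) \<le> 1 \<longrightarrow> F (items n L K A (dig L p)) \<le> rmem s' 6 0)))"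
    unfolding T_def W_def N_def K_def L_def
    by (rule main_run[OF S.setfun_axioms orc n1 \<epsilon>]) (auto simp: init_state_def n_def u_def g_def)
  then obtain t s' where r: "reach ?orc t (prog_com, ?s) (Skip, s')" "t \<le> T"
    and out: "sum u {x. x < n \<and> nmem s' 1 x \<noteq> 0} \<le> 1" "rmem s' 6 0 \<le> F {x. x < n \<and> nmem s' 1 x \<noteq> 0}"
    and M: "\<exists>M. (\<forall>x<n. F {x} \<le> M) \<and> (M = 0 \<or> (\<exists>x<n. M = F {x}))
        \<and> (\<forall>j<n. \<forall>A t i m D p. alg.steps n F u L K (real (Suc j) * M) {} N (A, t, i, m, D) \<longrightarrow> p < L ^ K
            \<longrightarrow> sum u (items n L K A (dig L p)) \<le> 1 \<longrightarrow> F (items n L K A (dig L p)) \<le> rmem s' 6 0)"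
    unfolding halts_def wpt_def by auto
  define O' where "O' = {x. x < n \<and> nmem s' 1 x \<noteq> 0}"
  have O': "O' \<subseteq> {..<n}" by (auto simp: O'_def)
  \<comment> \<open>There is a single outcome, so the expectation below is the value of one
    set.\<close>
  have fin_state: "exec prog_com xs f w \<epsilon> T = return_pmf (Skip, s')"
    unfolding exec_def by (rule run_reach_Skip[OF r])
  have outp: "output_after prog_com xs f w \<epsilon> T = return_pmf (g ` O')"
    by (simp add: output_after_def fin_state dec O'_def)
  define c where "c = curvature E f"
  let ?ratio = "\<lambda>e. if f {e} = 0 then 1 else marginal f (E - {e}) {e} / f {e}"
  have cE: "1 - c = Min (?ratio ` E)" by (simp add: c_def curvature_def)
  have ell: "marginal f (E - {g x}) {g x} = S.ell x" if "x < n" for x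
  proof -
    have "g ` ({..<n} - {x}) = E - {g x}"
      using inj_on_image_set_diff[OF inj, of "{..<n}" "{x}"] that img by simp
    moreover have "E - {g x} \<union> {g x} = E" using that img by auto
    ultimately show ?thesis by (simp add: marginal_def S.ell_def F_def img)
  qed
  have Fg: "F {x} = f {g x}" for x by (simp add: F_def)
  have ratio: "0 \<le> ?ratio (g x)" "?ratio (g x) \<le> 1" if "x < n" for x
  proof -
    have "0 \<le> F {x}" using S.nonneg[of "{x}"] that by simp
    moreover have "S.ell x \<le> F {x}" using S.ell_le[of "{}" x] S.nonneg[of "{}"] that by simp
    ultimately show "0 \<le> ?ratio (g x)" "?ratio (g x) \<le> 1"
      using S.ell_nonneg[of x] by (auto simp: ell[OF that] Fg[symmetric] divide_le_eq)
  qed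
  have fin: "finite (?ratio ` E)" "?ratio ` E \<noteq> {}" using E by auto
  have c01: "0 \<le> c" "c \<le> 1"
  proof -
    have "g 0 \<in> E" using n1 img by auto
    then have "Min (?ratio ` E) \<le> ?ratio (g 0)" by (intro Min_le[OF fin(1)] imageI)
    then show "0 \<le> c" using ratio(2)[of 0] n1 cE by simp
    have "Min (?ratio ` E) \<in> ?ratio ` E" by (rule Min_in[OF fin])
    then obtain e where e: "e \<in> E" "Min (?ratio ` E) = ?ratio e" by (rule imageE)
    then obtain x where x: "x < n" "e = g x" using img by auto
    have "0 \<le> Min (?ratio ` E)" unfolding e(2) x(2) by (rule ratio(1)[OF x(1)])
    then show "c \<le> 1" using cE by simp
  qed
  \<comment> \<open>If \<open>F {x} = 0\<close>, the quotient is read as 1 and carries no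
    information about \<open>x\<close>; the inequality then only says that \<open>S.ell x\<close> is
    nonnegative.\<close>
  have c_ell: "(1 - c) * F {x} \<le> S.ell x" if "x < n" for x
  proof (cases "F {x} = 0")
    case True
    then show ?thesis using S.ell_nonneg by simp
  next
    case False
    then have pos: "0 < F {x}" using S.nonneg[of "{x}"] that by (simp add: less_le)
    have "g x \<in> E" using that img by auto
    then have "1 - c \<le> ?ratio (g x)" unfolding cE by (intro Min_le[OF fin(1)] imageI)
    then have "1 - c \<le> S.ell x / F {x}" using False by (simp add: ell[OF that] Fg[symmetric])
    then show ?thesis using pos by (simp add: field_simps)
  qed
  have approx: "(1 - c / exp 1 - \<epsilon>) * f Opt \<le> F O'" if Opt: "is_arg_max f (\<lambda>S. S \<subseteq> E \<and> sum w S \<le> 1) Opt" for Opt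
  proof -
    have Opt': "Opt \<subseteq> E" "sum w Opt \<le> 1" "\<And>S. S \<subseteq> E \<Longrightarrow> sum w S \<le> 1 \<Longrightarrow> f S \<le> f Opt"
      using Opt by (auto simp: is_arg_max_def not_less)
    define P where "P = {x. x < n \<and> g x \<in> Opt}"
    have P: "P \<subseteq> {..<n}" "g ` P = Opt" using Opt'(1) img by (auto simp: P_def)
    have FP: "F P = f Opt" "sum u P \<le> 1" using P Opt'(2) sumw[OF P(1)] by (auto simp: F_def)
    have feas: "F X \<le> F P" if "X \<subseteq> {..<n}" "sum u X \<le> 1" for X
      using Opt'(3)[of "g ` X"] sub[OF that(1)] sumw[OF that(1)] that(2) by (simp add: F_def FP[unfolded F_def])
    have F0: "0 \<le> F O'" by (rule S.nonneg[OF O'])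
    obtain M where M: "\<forall>x<n. F {x} \<le> M" "M = 0 \<or> (\<exists>x<n. M = F {x})"
      "\<And>j A t i m D p. j < n \<Longrightarrow> alg.steps n F u L K (real (Suc j) * M) {} N (A, t, i, m, D) \<Longrightarrow> p < L ^ K
            \<Longrightarrow> sum u (items n L K A (dig L p)) \<le> 1 \<Longrightarrow> F (items n L K A (dig L p)) \<le> rmem s' 6 0"
      using M by blast
    have M0: "0 \<le> M" using M(1) S.nonneg[of "{0}"] n1 by (auto intro: order_trans)
    have FPM: "F P \<le> real n * M"
    \<comment> \<open>The empty set is separate because \<open>F {}\<close> may be positive and is
      not bounded by an empty sum of singletons.\<close>
    proof (cases "P = {}")
      case True
      have "F {} \<le> F {0}" using S.mono[of "{}" "{0}"] n1 by auto
      also have "\<dots> \<le> 1 * M" using M(1) n1 by simp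
      also have "\<dots> \<le> real n * M" using n1 M0 by (intro mult_right_mono) auto
      finally show ?thesis using True by simp
    next
      case False
      have finP: "finite P" using P(1) finite_subset by blast
      have "F P \<le> (\<Sum>x\<in>P. F {x})" by (rule S.F_le_sum[OF finP False P(1)])
      also have "\<dots> \<le> (\<Sum>x\<in>P. M)" by (rule sum_mono) (use M(1) P(1) in auto)
      also have "\<dots> = real (card P) * M" by simp
      also have "\<dots> \<le> real n * M"
        using card_mono[OF _ P(1)] M0 by (intro mult_right_mono) auto
      finally show ?thesis .
    qed
    show ?thesis
    proof (cases "M = 0")
      case True
      then have "F P \<le> 0" using FPM by simp
      then have "f Opt = 0" using S.nonneg[OF P(1)] FP by simp
      then show ?thesis using F0 by simp
    next
      case False
      then have Mp: "0 < M" using M0 by simp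
      obtain x where x: "x < n" "M = F {x}" using M(2) False by blast
      have MP: "M \<le> F P" unfolding x(2) by (rule feas) (use x S.w1 in auto)
      \<comment> \<open>Since \<open>q * M \<le> F P < (q + 1) * M \<le> 2 * (q * M)\<close>, the
        value \<open>q * M\<close> is an estimate of the optimum up to a factor of 2. It is among
        the tried ones, as \<open>FPM\<close> gives \<open>q \<le> n\<close>; the index is
        \<open>q - 1\<close> because the loop starts at 0.\<close>
      define q where "q = nat \<lfloor>F P / M\<rfloor>"
      have "1 \<le> F P / M" using MP Mp by simp
      then have fl: "1 \<le> \<lfloor>F P / M\<rfloor>" by linarith
      then have q1: "1 \<le> q" unfolding q_def by linarith
      have qr: "real q = of_int \<lfloor>F P / M\<rfloor>" using fl by (simp add: q_def)
      have "real q \<le> F P / M" "F P / M < real q + 1" unfolding qr by linarith+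
      then have qb: "real q * M \<le> F P" "F P < (real q + 1) * M" using Mp by (simp_all add: field_simps)
      have "real q * M \<le> real n * M" using qb(1) FPM by linarith
      then have qn: "q \<le> n" using Mp by simp
      define j where "j = q - 1"
      have j: "Suc j = q" "j < n" using q1 qn by (auto simp: j_def)
      define U where "U = real (Suc j) * M"
      have U: "0 < U" "U \<le> F P" using qb q1 Mp by (simp_all add: U_def j del: of_nat_Suc)
      have "1 * M \<le> real q * M" using q1 Mp by (intro mult_right_mono) auto
      then have U2: "F P \<le> 2 * U" using qb(2) by (simp add: U_def j algebra_simps del: of_nat_Suc)
      have "alg n F u L" by (intro alg.intro S.setfun_axioms alg_axioms.intro L1)
      then interpret A: alg n F u L K U .
      obtain Os A t i m D p where R: "Os \<subseteq> {..<n}" "F P - 2 * U / real L \<le> F Os"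
        "A.steps {} (3400 * L ^ 14) (A, t, i, m, D)" "p < L ^ K" "sum u (A.its A p) \<le> 1"
        "F Os - A.a0 * (F Os - F {} - sum S.ell Os) - 4 * U / real L \<le> F (A.its A p)"
        using A.near_opt[OF U(1) K_def _ P(1) FP(2)] feas U2 by (meson order_trans)
      have "F (A.its A p) \<le> rmem s' 6 0"
        using M(3)[OF j(2), of A t i m D p] R(3-5) by (simp only: U_def[symmetric] N_def[symmetric])
      then have "F Os - A.a0 * (F Os - F {} - sum S.ell Os) - 4 * U / real L \<le> F O'"
        using R(6) out(2) by (simp add: O'_def)
      from A.final_bound[OF U R(1,2) c01 c_ell Le this] show ?thesis by (simp add: FP)
    qed
  qed
  show "\<exists>T. halts_within prog_com xs f w \<epsilon> T \<and>
         (curvature E f < 1 \<longrightarrow> real T \<le> 8000 * time_bound [:1:] (monom (81600 * 8 ^ 14) 14) (card E) \<epsilon> (curvature E f)) \<and>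
         (\<forall>S \<in> set_pmf (output_after prog_com xs f w \<epsilon> T). S \<subseteq> E \<and> sum w S \<le> 1) \<and>
         (\<forall>Opt. is_arg_max f (\<lambda>S. S \<subseteq> E \<and> sum w S \<le> 1) Opt \<longrightarrow>
            (1 - curvature E f / exp 1 - \<epsilon>) * f Opt \<le> measure_pmf.expectation (output_after prog_com xs f w \<epsilon> T) f)"
  proof (intro exI[of _ T] conjI impI allI)
    show "halts_within prog_com xs f w \<epsilon> T" by (simp add: halts_within_def fin_state)
    show "real T \<le> 8000 * time_bound [:1:] (monom (81600 * 8 ^ 14) 14) (card E) \<epsilon> (curvature E f)" if "curvature E f < 1"
      unfolding T_def W_def N_def K_def L_def cardE
      by (rule time_bound_ge[OF n1 \<epsilon>]) (use c01 that in \<open>auto simp: c_def\<close>)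
    show "\<forall>S \<in> set_pmf (output_after prog_com xs f w \<epsilon> T). S \<subseteq> E \<and> sum w S \<le> 1"
      using sub[OF O'] sumw[OF O'] out(1) by (simp add: outp O'_def)
    show "(1 - curvature E f / exp 1 - \<epsilon>) * f Opt \<le> measure_pmf.expectation (output_after prog_com xs f w \<epsilon> T) f"
      if "is_arg_max f (\<lambda>S. S \<subseteq> E \<and> sum w S \<le> 1) Opt" for Opt
      using approx[OF that] by (simp add: outp F_def c_def)
  qed
qed

end
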